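(* Let $N\ge 3$ and let $\mathbb PCurr_+(F_N)$ be the set of all $[\mu]\in\mathbb PCurr(F_N)$ such that $\mu$ has full support. Then the action of $\mathrm{Out}(F_N)$ on $\mathbb PCurr_+(F_N)$ is properly discontinuous.
   Context: $F_N$ is the free group of rank $N$, and $\partial^2F_N=\{(x,y)\in\partial F_N\times\partial F_N:x\ne y\}$, where $\partial F_N$ is the hyperbolic boundary. A geodesic current on $F_N$ is a positive Radon measure on $\partial^2F_N$ that is invariant under the diagonal translation action of $F_N$ and under the flip $(x,y)\mapsto(y,x)$. $Curr(F_N)$ is the space of all geodesic currents with the weak-* topology, and $\mathbb PCurr(F_N)$ is the quotient of $Curr(F_N)\setminus\{0\}$ by multiplication by positive scalars, with classes $[\mu]$. $\mathrm{Out}(F_N)$ acts by $(\phi\mu)(S)=\mu(\Phi^{-1}(S))$ for Borel $S\subseteq \partial^2F_N$, where $\Phi\in\mathrm{Aut}(F_N)$ is any representative of $\phi$ (extended to $\partial^2 F_N$), and $\phi[\mu]=[\phi\mu]$. A current $\mu$ has full support if its support is all of $\partial^2F_N$. An action of a group $G$ on a space $X$ is properly discontinuous if for every compact $K\subseteq X$ the set $\{g\in G:K\cap gK\ne\emptyset\}$ is finite. *)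

theory Defs
  imports "HOL-Analysis.Analysis" "HOL-Algebra.Bij" "HOL-Algebra.Coset"
begin

section \<open>The free group of rank \<open>N\<close>\<close>

text \<open>The letter \<open>(i, True)\<close> is the basis element \<open>a\<^sub>i\<close>, and \<open>(i, False)\<close> is its inverse.
  Elements of the free group are the freely reduced words.\<close>

type_synonym letter = "nat \<times> bool"
type_synonym fword = "letter list"

definition inv_letter :: "letter \<Rightarrow> letter"
  where "inv_letter a = (fst a, \<not> snd a)"

definition reduced :: "fword \<Rightarrow> bool"
  where "reduced w \<longleftrightarrow> successively (\<lambda>a b. b \<noteq> inv_letter a) w"

fun red_cons :: "letter \<Rightarrow> fword \<Rightarrow> fword" where
  "red_cons a [] = [a]"
| "red_cons a (b # w) = (if b = inv_letter a then w else a # b # w)"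

definition free_group :: "nat \<Rightarrow> fword monoid"
  where "free_group N =
    \<lparr>carrier = {w. set w \<subseteq> {..<N} \<times> UNIV \<and> reduced w},
     mult = (\<lambda>u v. foldr red_cons u v),
     one = []\<rparr>"


section \<open>The outer automorphism group\<close>

definition inner_auto :: "('a, 'm) monoid_scheme \<Rightarrow> ('a \<Rightarrow> 'a) set"
  where "inner_auto G =
    (\<lambda>g. \<lambda>x\<in>carrier G. g \<otimes>\<^bsub>G\<^esub> x \<otimes>\<^bsub>G\<^esub> inv\<^bsub>G\<^esub> g) ` carrier G"

definition OutGroup :: "('a, 'm) monoid_scheme \<Rightarrow> ('a \<Rightarrow> 'a) set monoid"
  where "OutGroup G = AutoGroup G Mod inner_auto G"


section \<open>The hyperbolic boundary\<close>

text \<open>This is the Gromov boundary of the free group with the word metric of its basis: sequences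
  \<open>x\<close> with \<open>(x\<^sub>i|x\<^sub>j) \<rightarrow> \<infinity>\<close>, modulo \<open>(x\<^sub>i|y\<^sub>j) \<rightarrow> \<infinity>\<close>, where \<open>(u|v)\<close> is the Gromov product based
  at the identity. The sets \<open>boundary_nhd N p r\<close> form the usual neighbourhood basis at \<open>p\<close>.\<close>

definition word_dist :: "nat \<Rightarrow> fword \<Rightarrow> fword \<Rightarrow> real"
  where "word_dist N u v =
    real (length (inv\<^bsub>free_group N\<^esub> u \<otimes>\<^bsub>free_group N\<^esub> v))"

definition gromov_prod :: "nat \<Rightarrow> fword \<Rightarrow> fword \<Rightarrow> real"
  where "gromov_prod N u v =
    (word_dist N u \<one>\<^bsub>free_group N\<^esub> + word_dist N v \<one>\<^bsub>free_group N\<^esub> - word_dist N u v) / 2"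

definition gromov_related :: "nat \<Rightarrow> (nat \<Rightarrow> fword) \<Rightarrow> (nat \<Rightarrow> fword) \<Rightarrow> bool"
  where "gromov_related N x y \<longleftrightarrow>
    filterlim (\<lambda>(i, j). gromov_prod N (x i) (y j)) at_top (sequentially \<times>\<^sub>F sequentially)"

definition gromov_seqs :: "nat \<Rightarrow> (nat \<Rightarrow> fword) set"
  where "gromov_seqs N = {x. range x \<subseteq> carrier (free_group N) \<and> gromov_related N x x}"

type_synonym bpoint = "(nat \<Rightarrow> fword) set"

definition boundary :: "nat \<Rightarrow> bpoint set"
  where "boundary N =
    gromov_seqs N // {(x, y). x \<in> gromov_seqs N \<and> y \<in> gromov_seqs N \<and> gromov_related N x y}"

definition boundary_nhd :: "nat \<Rightarrow> bpoint \<Rightarrow> real \<Rightarrow> bpoint set"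
  where "boundary_nhd N p r = {q \<in> boundary N. \<exists>x\<in>p. \<exists>y\<in>q.
    Liminf (sequentially \<times>\<^sub>F sequentially) (\<lambda>(i, j). ereal (gromov_prod N (x i) (y j))) \<ge> ereal r}"

definition boundary_top :: "nat \<Rightarrow> bpoint topology"
  where "boundary_top N =
    topology (\<lambda>U. U \<subseteq> boundary N \<and> (\<forall>p\<in>U. \<exists>r. boundary_nhd N p r \<subseteq> U))"

lemma openin_boundary_top:
  "openin (boundary_top N) U \<longleftrightarrow>
    U \<subseteq> boundary N \<and> (\<forall>p\<in>U. \<exists>r. boundary_nhd N p r \<subseteq> U)"
proof -
  let ?P = "\<lambda>U. U \<subseteq> boundary N \<and> (\<forall>p\<in>U. \<exists>r. boundary_nhd N p r \<subseteq> U)"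
  have mono: "boundary_nhd N p r \<subseteq> boundary_nhd N p s" if "s \<le> r" for p r s
  proof -
    have "ereal s \<le> ereal r" using that by simp
    then show ?thesis
      unfolding boundary_nhd_def by (blast intro: order_trans)
  qed
  have "?P (S \<inter> T)" if S: "?P S" and T: "?P T" for S T
  proof (intro conjI ballI)
    show "S \<inter> T \<subseteq> boundary N" using S by (rule le_infI1[OF conjunct1])
    fix p assume "p \<in> S \<inter> T"
    with S T obtain r s where r: "boundary_nhd N p r \<subseteq> S" and s: "boundary_nhd N p s \<subseteq> T"
      by (meson IntD1 IntD2)
    have "boundary_nhd N p (max r s) \<subseteq> S \<inter> T"
      using order_trans[OF mono r] order_trans[OF mono s] by (intro Int_greatest) simp_all
    then show "\<exists>r. boundary_nhd N p r \<subseteq> S \<inter> T" ..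
  qed
  moreover have "?P (\<Union>\<K>)" if \<K>: "\<forall>K\<in>\<K>. ?P K" for \<K>
  proof (intro conjI ballI)
    show "\<Union>\<K> \<subseteq> boundary N" using \<K> by (intro Union_least) simp
    fix p assume "p \<in> \<Union>\<K>"
    then obtain K where K: "K \<in> \<K>" "p \<in> K" by (rule UnionE)
    with \<K> obtain r where "boundary_nhd N p r \<subseteq> K" by meson
    with K(1) have "boundary_nhd N p r \<subseteq> \<Union>\<K>" by (meson Union_upper order_trans)
    then show "\<exists>r. boundary_nhd N p r \<subseteq> \<Union>\<K>" ..
  qed
  ultimately have "istopology ?P"
    unfolding istopology_def by meson
  then show ?thesis
    unfolding boundary_top_def by (simp only: topology_inverse')
qed

lemma topspace_boundary_top: "topspace (boundary_top N) = boundary N"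
proof (rule subset_antisym)
  have "boundary_nhd N p 0 \<subseteq> boundary N" for p
    unfolding boundary_nhd_def by (rule Collect_subset)
  then have "openin (boundary_top N) (boundary N)"
    unfolding openin_boundary_top by (intro conjI ballI exI subset_refl)
  then show "boundary N \<subseteq> topspace (boundary_top N)"
    by (rule openin_subset)
  show "topspace (boundary_top N) \<subseteq> boundary N"
    using openin_topspace[of "boundary_top N"] unfolding openin_boundary_top by (rule conjunct1)
qed

definition boundary2 :: "nat \<Rightarrow> (bpoint \<times> bpoint) set"
  where "boundary2 N = {(x, y) \<in> boundary N \<times> boundary N. x \<noteq> y}"

definition boundary2_top :: "nat \<Rightarrow> (bpoint \<times> bpoint) topology"
  where "boundary2_top N =
    subtopology (prod_topology (boundary_top N) (boundary_top N)) (boundary2 N)"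

text \<open>The map on the boundary induced by a self-map \<open>f\<close> of the group, given by
  \<open>[x\<^sub>n] \<mapsto> [f x\<^sub>n]\<close>. It is only used when \<open>f\<close> is a bijective quasi-isometry (an automorphism
  or a left translation); the image of an equivalence class is then again an equivalence class.\<close>

definition boundary_map :: "(fword \<Rightarrow> fword) \<Rightarrow> bpoint \<Rightarrow> bpoint"
  where "boundary_map f p = (\<lambda>x. f \<circ> x) ` p"

definition boundary2_map :: "(fword \<Rightarrow> fword) \<Rightarrow> bpoint \<times> bpoint \<Rightarrow> bpoint \<times> bpoint"
  where "boundary2_map f = map_prod (boundary_map f) (boundary_map f)"


section \<open>Radon measures, supports, quotient topologies\<close>

definition borel_of :: "'a topology \<Rightarrow> 'a measure"
  where "borel_of X = sigma (topspace X) {U. openin X U}"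

definition radon_measure :: "'a topology \<Rightarrow> 'a measure \<Rightarrow> bool"
  where "radon_measure X \<mu> \<longleftrightarrow>
    space \<mu> = topspace X \<and> sets \<mu> = sets (borel_of X) \<and>
    (\<forall>K. compactin X K \<longrightarrow> emeasure \<mu> K < \<infinity>) \<and>
    (\<forall>S\<in>sets \<mu>. emeasure \<mu> S = (INF U\<in>{U. openin X U \<and> S \<subseteq> U}. emeasure \<mu> U)) \<and>
    (\<forall>U. openin X U \<longrightarrow>
      emeasure \<mu> U = (SUP K\<in>{K. compactin X K \<and> K \<subseteq> U}. emeasure \<mu> K))"

definition measure_support :: "'a topology \<Rightarrow> 'a measure \<Rightarrow> 'a set"
  where "measure_support X \<mu> =
    {x \<in> topspace X. \<forall>U. openin X U \<and> x \<in> U \<longrightarrow> emeasure \<mu> U > 0}"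

definition cont_compact_support :: "'a topology \<Rightarrow> ('a \<Rightarrow> real) set"
  where "cont_compact_support X =
    {f. continuous_map X euclideanreal f \<and>
      compactin X (Abstract_Topology.closure_of X {x \<in> topspace X. f x \<noteq> 0})}"

definition quotient_top :: "'a topology \<Rightarrow> ('a \<Rightarrow> 'b) \<Rightarrow> 'b topology"
  where "quotient_top X q =
    topology (\<lambda>U. U \<subseteq> q ` topspace X \<and> openin X {x \<in> topspace X. q x \<in> U})"

lemma openin_quotient_top:
  "openin (quotient_top X q) U \<longleftrightarrow>
    U \<subseteq> q ` topspace X \<and> openin X {x \<in> topspace X. q x \<in> U}"
proof -
  let ?P = "\<lambda>U. U \<subseteq> q ` topspace X \<and> openin X {x \<in> topspace X. q x \<in> U}"
  have "?P (S \<inter> T)" if S: "?P S" and T: "?P T" for S T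
  proof (intro conjI)
    show "S \<inter> T \<subseteq> q ` topspace X" using S by (rule le_infI1[OF conjunct1])
    have "{x \<in> topspace X. q x \<in> S \<inter> T} =
        {x \<in> topspace X. q x \<in> S} \<inter> {x \<in> topspace X. q x \<in> T}" by blast
    then show "openin X {x \<in> topspace X. q x \<in> S \<inter> T}"
      using S T by (simp only: openin_Int)
  qed
  moreover have "?P (\<Union>\<K>)" if \<K>: "\<forall>K\<in>\<K>. ?P K" for \<K>
  proof (intro conjI)
    show "\<Union>\<K> \<subseteq> q ` topspace X" using \<K> by (intro Union_least) simp
    have "{x \<in> topspace X. q x \<in> \<Union>\<K>} = (\<Union>K\<in>\<K>. {x \<in> topspace X. q x \<in> K})"
      by blast
    moreover have "openin X (\<Union>K\<in>\<K>. {x \<in> topspace X. q x \<in> K})"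
      using \<K> by (intro openin_Union) (elim imageE, simp)
    ultimately show "openin X {x \<in> topspace X. q x \<in> \<Union>\<K>}" by (simp only:)
  qed
  ultimately have "istopology ?P"
    unfolding istopology_def by meson
  then show ?thesis
    unfolding quotient_top_def by (simp only: topology_inverse')
qed

lemma quotient_map_quotient_top: "quotient_map X (quotient_top X q) q"
proof -
  have "{x \<in> topspace X. q x \<in> q ` topspace X} = topspace X" by blast
  then have "openin (quotient_top X q) (q ` topspace X)"
    unfolding openin_quotient_top by (simp only: openin_topspace subset_refl)
  moreover have "topspace (quotient_top X q) \<subseteq> q ` topspace X"
    using openin_topspace[of "quotient_top X q"] unfolding openin_quotient_top by (rule conjunct1)
  ultimately have "q ` topspace X = topspace (quotient_top X q)"
    using openin_subset by (intro subset_antisym)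
  then show ?thesis
    unfolding quotient_map_def by (simp add: openin_quotient_top)
qed


section \<open>Geodesic currents\<close>

type_synonym current = "(bpoint \<times> bpoint) measure"

text \<open>\<open>(push f \<mu>)(S) = \<mu>(f\<^sup>-\<^sup>1(S))\<close> for Borel sets \<open>S\<close>.\<close>

definition push :: "nat \<Rightarrow> (bpoint \<times> bpoint \<Rightarrow> bpoint \<times> bpoint) \<Rightarrow> current \<Rightarrow> current"
  where "push N f \<mu> = distr \<mu> (borel_of (boundary2_top N)) f"

definition Curr :: "nat \<Rightarrow> current set"
  where "Curr N = {\<mu>. radon_measure (boundary2_top N) \<mu> \<and>
    (\<forall>g\<in>carrier (free_group N). push N (boundary2_map (\<lambda>x. g \<otimes>\<^bsub>free_group N\<^esub> x)) \<mu> = \<mu>) \<and>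
    push N prod.swap \<mu> = \<mu>}"

text \<open>The weak-* topology is the coarsest one making \<open>\<mu> \<mapsto> \<integral>f d\<mu>\<close> continuous for every
  continuous compactly supported \<open>f\<close>.\<close>

definition Curr_top :: "nat \<Rightarrow> current topology"
  where "Curr_top N = topology_generated_by
    {{\<mu> \<in> Curr N. integral\<^sup>L \<mu> f \<in> U} | f U.
      f \<in> cont_compact_support (boundary2_top N) \<and> open (U :: real set)}"

definition Curr_nonzero :: "nat \<Rightarrow> current set"
  where "Curr_nonzero N = Curr N - {null_measure (borel_of (boundary2_top N))}"

definition proj_class :: "current \<Rightarrow> current set"
  where "proj_class \<mu> = {scale_measure (ennreal r) \<mu> | r :: real. r > 0}"

definition PCurr :: "nat \<Rightarrow> current set set"
  where "PCurr N = proj_class ` Curr_nonzero N"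

definition PCurr_top :: "nat \<Rightarrow> current set topology"
  where "PCurr_top N = quotient_top (subtopology (Curr_top N) (Curr_nonzero N)) proj_class"

definition full_support :: "nat \<Rightarrow> current \<Rightarrow> bool"
  where "full_support N \<mu> \<longleftrightarrow> measure_support (boundary2_top N) \<mu> = boundary2 N"

definition PCurr_plus :: "nat \<Rightarrow> current set set"
  where "PCurr_plus N = {proj_class \<mu> | \<mu>. \<mu> \<in> Curr_nonzero N \<and> full_support N \<mu>}"

definition PCurr_plus_top :: "nat \<Rightarrow> current set topology"
  where "PCurr_plus_top N = subtopology (PCurr_top N) (PCurr_plus N)"


section \<open>The action of the outer automorphism group\<close>

text \<open>An element \<open>\<phi>\<close> of \<open>OutGroup (free_group N)\<close> is a coset, that is, the set of its
  representatives in the automorphism group. The action on currents does not depend on the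
  representative, since an inner automorphism acts on the boundary as a left translation.\<close>

definition out_act :: "nat \<Rightarrow> (fword \<Rightarrow> fword) set \<Rightarrow> current \<Rightarrow> current"
  where "out_act N \<phi> \<mu> = push N (boundary2_map (SOME \<Phi>. \<Phi> \<in> \<phi>)) \<mu>"

text \<open>The image of the class of \<open>\<mu>\<close> is the class of \<open>\<phi>\<mu>\<close>, because the action commutes with
  scaling.\<close>

definition out_act_proj :: "nat \<Rightarrow> (fword \<Rightarrow> fword) set \<Rightarrow> current set \<Rightarrow> current set"
  where "out_act_proj N \<phi> c = out_act N \<phi> ` c"

definition properly_discontinuous ::
    "('g, 'm) monoid_scheme \<Rightarrow> 'x topology \<Rightarrow> ('g \<Rightarrow> 'x \<Rightarrow> 'x) \<Rightarrow> bool"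
  where "properly_discontinuous G X act \<longleftrightarrow>
    (\<forall>K. compactin X K \<longrightarrow> finite {g \<in> carrier G. K \<inter> act g ` K \<noteq> {}})"

end

theory Submission
  imports Defs
begin

text \<open>Call the measure \<open>\<ell>(\<mu>)\<close> of the set of all pairs whose geodesic in the Cayley tree passes
  through the identity the length of the current \<open>\<mu>\<close>. It is finite, because that set is compact.
  If \<open>\<Phi>\<mu> = r\<nu>\<close> with \<open>[\<mu>]\<close> and \<open>[\<nu>]\<close> in a compact set \<open>K\<close>, then either \<open>\<ell>(\<Phi>\<mu>) \<le> \<ell>(\<mu>)\<close>, or
  \<open>\<ell>(\<Phi>\<^sup>-\<^sup>1\<nu>) \<le> \<ell>(\<nu>)\<close>. Hence it suffices that, up to inner automorphisms, only finitely many \<open>\<Phi>\<close> do not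
  increase the length of some \<open>\<mu>\<close> with \<open>[\<mu>] \<in> K\<close>.

  For a word \<open>w\<close> let \<open>Cyl(w)\<close> be the set of pairs whose geodesic passes through the identity and
  then through \<open>w\<close>. It is open and compact, so for \<open>w\<close> in a finite set of words the ratios
  \<open>\<mu>(Cyl(w)) / \<ell>(\<mu>)\<close> are continuous functions of \<open>[\<mu>]\<close>. They are positive for full support, and
  therefore bounded below by a positive constant on \<open>K\<close> (\<open>compact_positive\<close>). So everything
  follows from an inequality \<open>V(\<Phi>) \<mu>(Cyl(w)) \<le> const * \<ell>(\<Phi>\<mu>)\<close> for some \<open>w\<close> in a finite set that
  depends only on the rank. Here \<open>V(\<Phi>)\<close> is the sum of the word lengths of the images of the letters,
  for a representative of the outer class for which it is minimal; only finitely many automorphisms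
  have \<open>V(\<Phi>) \<le> R\<close> (\<open>finite_bounded_volume\<close>).

  To prove the inequality, suppose that the reduced image \<open>\<Phi> w\<close> is longer, by a fixed fraction of
  \<open>V(\<Phi>)\<close>, than what can be lost at its two ends by cancellation. If a geodesic passes through the
  identity and \<open>w\<close>, then its image passes through all vertices \<open>h = \<Phi> g\<close> in the middle part of
  \<open>[1, \<Phi> w]\<close>. This says that \<open>g\<^sup>-\<^sup>1 Cyl(w) \<subseteq> \<Phi>\<^sup>-\<^sup>1(Z)\<close>, with \<open>Z\<close> the set that defines \<open>\<ell>\<close>. The number of
  these translates is at least a fixed multiple of \<open>V(\<Phi>)\<close>, they all have the measure of \<open>Cyl(w)\<close>, and they cover
  each pair at most \<open>|w|\<close> times, because non-overlapping occurrences of \<open>w\<close> on a geodesic have images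
  with disjoint middle parts (\<open>middle_current_bound\<close>).

  Two facts make this work. First, cancellation is bounded linearly in \<open>V(\<Phi>)\<close>
  (\<open>bounded_cancellation\<close>). Second, there are words \<open>w\<close> of bounded length with such a long image
  (\<open>test_word_with_long_middle\<close>): if \<open>V(\<Phi>)\<close> is minimal, then at most half of the words
  \<open>\<Phi>(a\<^sub>i\<^sup>\<plusminus>\<^sup>1)\<close> begin with any given letter, since otherwise conjugation by this letter would shorten
  the basis. It follows that a letter \<open>l\<close> with longest image, or a product \<open>l a\<close> of it with another
  letter, has powers whose images are concatenated without cancellation, and a fixed power is long
  enough.\<close>

section \<open>Cancellation in the free group\<close>

abbreviation fmul :: "fword \<Rightarrow> fword \<Rightarrow> fword" (infixr "\<odot>" 70)
  where "u \<odot> v \<equiv> foldr red_cons u v"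

definition finv :: "fword \<Rightarrow> fword"
  where "finv u = rev (map inv_letter u)"

lemma inv_letter_inv [simp]: "inv_letter (inv_letter a) = a"
  by (simp add: inv_letter_def)

lemma inv_letter_neq [simp]: "inv_letter a \<noteq> a" "a \<noteq> inv_letter a"
  by (simp_all add: inv_letter_def prod_eq_iff)

lemma inv_letter_eq_iff [simp]: "inv_letter a = inv_letter b \<longleftrightarrow> a = b"
  by (metis inv_letter_inv)

lemma reduced_Nil [simp]: "reduced []"
  by (simp add: reduced_def)

lemma reduced_Cons: "reduced (a # w) \<longleftrightarrow> (w \<noteq> [] \<longrightarrow> hd w \<noteq> inv_letter a) \<and> reduced w"
  by (auto simp: reduced_def successively_Cons)

lemma reduced_append:
  "reduced (u @ v) \<longleftrightarrow> reduced u \<and> reduced v \<and> (u \<noteq> [] \<longrightarrow> v \<noteq> [] \<longrightarrow> hd v \<noteq> inv_letter (last u))"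
  by (auto simp: reduced_def successively_append_iff)

lemma reduced_take: "reduced u \<Longrightarrow> reduced (take k u)"
  using reduced_append[of "take k u" "drop k u"] by simp

lemma reduced_drop: "reduced u \<Longrightarrow> reduced (drop k u)"
  using reduced_append[of "take k u" "drop k u"] by simp

lemma reduced_finv [simp]: "reduced (finv u) \<longleftrightarrow> reduced u"
proof -
  have "(\<lambda>x y. x \<noteq> inv_letter y) = (\<lambda>a b. b \<noteq> inv_letter a)"
    using inv_letter_inv by metis
  then have "successively (\<lambda>x y. x \<noteq> inv_letter y) u = successively (\<lambda>a b. b \<noteq> inv_letter a) u"
    by (rule arg_cong)
  then show ?thesis by (simp add: finv_def reduced_def successively_map)
qed

lemma finv_Nil [simp]: "finv [] = []" and finv_append: "finv (u @ v) = finv v @ finv u"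
  and finv_finv [simp]: "finv (finv u) = u" and length_finv [simp]: "length (finv u) = length u"
  and finv_eq_Nil [simp]: "finv u = [] \<longleftrightarrow> u = []"
  by (simp_all add: finv_def rev_map comp_def)

lemma finv_Cons: "finv (a # u) = finv u @ [inv_letter a]"
  by (simp add: finv_def)

lemma set_finv: "set (finv u) = inv_letter ` set u"
  by (simp add: finv_def)

lemma hd_finv: "u \<noteq> [] \<Longrightarrow> hd (finv u) = inv_letter (last u)"
  by (simp add: finv_def hd_rev last_map)

lemma reduced_red_cons: "reduced w \<Longrightarrow> reduced (red_cons a w)"
  by (cases w) (auto simp: reduced_Cons)

lemma reduced_fmul [simp]: "reduced v \<Longrightarrow> reduced (u \<odot> v)"
  by (induction u) (auto simp: reduced_red_cons)

lemma red_cons_cancel: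
  assumes "reduced w" shows "red_cons (inv_letter a) (red_cons a w) = w"
proof (cases w)
  case (Cons b w')
  then show ?thesis using assms by (cases w') (auto simp: reduced_Cons)
qed simp

lemma red_cons_cancel': "reduced w \<Longrightarrow> red_cons a (red_cons (inv_letter a) w) = w"
  using red_cons_cancel[of w "inv_letter a"] by simp

lemma red_cons_reduced: "reduced (a # w) \<Longrightarrow> red_cons a w = a # w"
  by (cases w) (auto simp: reduced_Cons)

lemma fmul_reduced_append: "reduced (u @ v) \<Longrightarrow> u \<odot> v = u @ v"
  by (induction u) (auto simp: reduced_Cons red_cons_reduced)

lemma fmul_Nil_right [simp]: "reduced u \<Longrightarrow> u \<odot> [] = u"
  using fmul_reduced_append[of u "[]"] by simp

lemma red_cons_fmul: "reduced w \<Longrightarrow> red_cons a t \<odot> w = red_cons a (t \<odot> w)"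
  by (cases t) (auto simp: red_cons_cancel')

lemma fmul_assoc: "reduced w \<Longrightarrow> (u \<odot> v) \<odot> w = u \<odot> v \<odot> w"
  by (induction u) (auto simp: red_cons_fmul)

lemma finv_fmul_cancel: "reduced v \<Longrightarrow> finv u \<odot> u \<odot> v = v"
  by (induction u) (auto simp: finv_Cons red_cons_cancel)

lemma fmul_finv_cancel: "reduced v \<Longrightarrow> u \<odot> finv u \<odot> v = v"
  using finv_fmul_cancel[of v "finv u"] by simp

lemma finv_fmul: "reduced u \<Longrightarrow> finv u \<odot> u = []"
  using finv_fmul_cancel[of "[]" u] by simp

lemma fmul_finv: "reduced u \<Longrightarrow> u \<odot> finv u = []"
  using fmul_finv_cancel[of "[]" u] by simp

lemma fmul_left_cancel: "reduced u \<Longrightarrow> reduced v \<Longrightarrow> g \<odot> u = g \<odot> v \<longleftrightarrow> u = v"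
  by (metis finv_fmul_cancel)

lemma finv_of_fmul:
  assumes "reduced u" "reduced v" shows "finv (u \<odot> v) = finv v \<odot> finv u"
proof -
  have "finv (u \<odot> v) \<odot> (u \<odot> v) \<odot> finv v \<odot> finv u = finv v \<odot> finv u"
    using assms by (simp add: finv_fmul_cancel)
  moreover have "(u \<odot> v) \<odot> finv v \<odot> finv u = []"
    using assms by (simp add: fmul_assoc fmul_finv_cancel fmul_finv)
  ultimately show ?thesis using assms by simp
qed

text \<open>The part \<open>s\<^sup>-\<^sup>1 s\<close> that cancels is maximal, so that first letters, lengths and common
  prefixes of products can be read off.\<close>

lemma fmul_cancellation:
  assumes "reduced u" "reduced v"
  obtains s u' v' where "u = u' @ finv s" "v = s @ v'" "reduced (u' @ v')" "u \<odot> v = u' @ v'"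
  using assms
proof (induction u arbitrary: v thesis rule: rev_induct)
  case Nil
  then show ?case using Nil.prems(1)[of "[]" "[]" v] by simp
next
  case (snoc a u)
  show ?case
  proof (cases "v \<noteq> [] \<and> hd v = inv_letter a")
    case True
    then obtain w where v: "v = inv_letter a # w" by (cases v) auto
    then have w: "reduced w" "reduced u" using snoc.prems by (auto simp: reduced_Cons reduced_append)
    then obtain s u' v' where s: "u = u' @ finv s" "w = s @ v'" "reduced (u' @ v')" "u \<odot> w = u' @ v'"
      using snoc.IH by metis
    have "(u @ [a]) \<odot> v = u \<odot> w" using v by simp
    then show ?thesis
      using snoc.prems(1)[of u' "inv_letter a # s" v'] s v by (simp add: finv_Cons)
  next
    case False
    then have "reduced ((u @ [a]) @ v)"
      using snoc.prems reduced_append[of "u @ [a]" v] by auto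
    then show ?thesis
      using snoc.prems(1)[of "u @ [a]" "[]" v] fmul_reduced_append by (metis append.right_neutral append_Nil finv_Nil)
  qed
qed

lemma length_fmul_le: "reduced u \<Longrightarrow> reduced v \<Longrightarrow> length (u \<odot> v) \<le> length u + length v"
  by (erule (1) fmul_cancellation[of u v]) (simp)

lemma set_red_cons: "set (red_cons a w) \<subseteq> insert a (set w)"
  by (cases w) auto

lemma set_fmul: "set (u \<odot> v) \<subseteq> set u \<union> set v"
  by (induction u) (use set_red_cons in fastforce)+

subsection \<open>The free group as a group\<close>

abbreviation FG :: "nat \<Rightarrow> fword set"
  where "FG N \<equiv> carrier (free_group N)"

lemma FG_iff: "w \<in> FG N \<longleftrightarrow> set w \<subseteq> {..<N} \<times> UNIV \<and> reduced w"
  by (simp add: free_group_def)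

lemma mult_free_group [simp]: "u \<otimes>\<^bsub>free_group N\<^esub> v = u \<odot> v"
  and one_free_group [simp]: "\<one>\<^bsub>free_group N\<^esub> = []"
  by (simp_all add: free_group_def)

lemma FG_reduced: "w \<in> FG N \<Longrightarrow> reduced w"
  by (simp add: FG_iff)

lemma Nil_FG [simp]: "[] \<in> FG N"
  by (simp add: FG_iff)

lemma fmul_FG [simp]: "u \<in> FG N \<Longrightarrow> v \<in> FG N \<Longrightarrow> u \<odot> v \<in> FG N"
  using set_fmul[of u v] by (auto simp: FG_iff)

lemma finv_FG [simp]: "u \<in> FG N \<Longrightarrow> finv u \<in> FG N"
  by (auto simp: FG_iff set_finv inv_letter_def)

lemma FG_appendD: "u @ v \<in> FG N \<Longrightarrow> u \<in> FG N \<and> v \<in> FG N"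
  by (simp add: FG_iff reduced_append)

lemma take_FG: "u \<in> FG N \<Longrightarrow> take k u \<in> FG N"
  using FG_appendD[of "take k u" "drop k u" N] by simp

lemma singleton_FG: "[l] \<in> FG N \<longleftrightarrow> fst l < N"
  by (cases l) (simp add: FG_iff reduced_Cons)

lemma group_free_group: "group (free_group N)"
proof (rule groupI)
  fix u assume "u \<in> FG N"
  then show "\<exists>v\<in>FG N. v \<otimes>\<^bsub>free_group N\<^esub> u = \<one>\<^bsub>free_group N\<^esub>"
    by (intro bexI[of _ "finv u"]) (simp_all add: finv_fmul FG_reduced)
qed (simp_all add: fmul_assoc FG_reduced)

lemma inv_free_group [simp]: "u \<in> FG N \<Longrightarrow> inv\<^bsub>free_group N\<^esub> u = finv u"
  by (rule group.inv_equality[OF group_free_group]) (auto simp: finv_fmul FG_reduced)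

lemma finite_FG_bounded: "finite {w \<in> FG N. length w \<le> k}"
  by (rule finite_subset[OF _ finite_lists_length_le[of "{..<N} \<times> UNIV" k]]) (auto simp: FG_iff)

subsection \<open>Directions at the identity\<close>

text \<open>In the Cayley tree, the components of the complement of the identity correspond to the first
  letters. Hence this says that the identity lies on the geodesic between \<open>u\<close> and \<open>v\<close>.\<close>

definition sep :: "fword \<Rightarrow> fword \<Rightarrow> bool"
  where "sep u v \<longleftrightarrow> u = [] \<or> v = [] \<or> hd u \<noteq> hd v"

lemma sep_sym: "sep u v \<longleftrightarrow> sep v u"
  by (auto simp: sep_def)

text \<open>If no step passed through the identity, all the vertices would lie in one component of its
  complement.\<close>

lemma sep_chain:
  assumes "sep (f 0) (f n)" "n > 0"
  shows "\<exists>i<n. sep (f i) (f (Suc i))"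
proof (rule ccontr)
  assume *: "\<not> ?thesis"
  have "f 0 \<noteq> [] \<and> f i \<noteq> [] \<and> hd (f i) = hd (f 0)" if "i \<le> n" for i
    using that * \<open>n > 0\<close> by (induction i) (auto simp: sep_def Suc_le_eq)
  from this[of n] show False using assms by (auto simp: sep_def)
qed

lemma sep_prefixes:
  assumes "sep (f []) (f a)" "a \<noteq> []"
  shows "\<exists>i<length a. sep (f (take i a)) (f (take (Suc i) a))"
  using sep_chain[of "\<lambda>i. f (take i a)" "length a"] assms by simp

text \<open>If \<open>h\<close> and \<open>h u\<close> have no common first letter, then all of \<open>h\<close> has cancelled. Hence only
  \<open>|u| + 1\<close> translates of the path \<open>u\<close> pass through the identity.\<close>

lemma sep_mult_prefix:
  assumes "reduced h" "reduced u" "sep h (h \<odot> u)"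
  shows "\<exists>k\<le>length u. h = finv (take k u)"
proof -
  obtain s h' u' where s: "h = h' @ finv s" "u = s @ u'" "reduced (h' @ u')" "h \<odot> u = h' @ u'"
    using fmul_cancellation[OF assms(1,2)] by metis
  then have "h' = []" using assms(3) by (cases h') (auto simp: sep_def)
  then show ?thesis using s by (intro exI[of _ "length s"]) auto
qed

section \<open>Bounded cancellation for automorphisms\<close>

lemma equiv_quotient_card_less:
  assumes fin: "finite S" and Q: "equiv S Q" and Q': "equiv S Q'" and sub: "Q \<subset> Q'"
  shows "card (S // Q') < card (S // Q)"
proof -
  have cls: "Q' `` (Q `` {x}) = Q' `` {x}" if "x \<in> S" for x
  proof -
    have "(x, x) \<in> Q" using Q that by (auto simp: equiv_def refl_on_def)
    moreover have "trans Q'" using Q' by (simp add: equiv_def)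
    ultimately show ?thesis using sub by (auto dest: transD)
  qed
  have im: "(\<lambda>X. Q' `` X) ` (S // Q) = S // Q'"
    by (auto simp: quotient_def cls image_UN)
  have finq: "finite (S // Q)" using fin by (simp add: quotient_def)
  obtain x y where xy: "(x, y) \<in> Q'" "(x, y) \<notin> Q" using sub by auto
  then have S: "x \<in> S" "y \<in> S" using Q' by (auto simp: equiv_def)
  have "Q `` {x} \<noteq> Q `` {y}" using xy(2) eq_equiv_class_iff[OF Q S] by simp
  moreover have "Q' `` (Q `` {x}) = Q' `` (Q `` {y})"
    unfolding cls[OF S(1)] cls[OF S(2)] using equiv_class_eq[OF Q' xy(1)] .
  ultimately have "\<not> inj_on (\<lambda>X. Q' `` X) (S // Q)"
    using quotientI[OF S(1), of Q] quotientI[OF S(2), of Q] unfolding inj_on_def by metis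
  then have "card ((\<lambda>X. Q' `` X) ` (S // Q)) \<noteq> card (S // Q)"
    using eq_card_imp_inj_on[OF finq] by blast
  then show ?thesis using card_image_le[OF finq, of "\<lambda>X. Q' `` X"] im by simp
qed

text \<open>Each strict step merges two classes, so a chain of equivalence relations in which one
  repetition forces all later ones is constant after \<open>card S\<close> steps.\<close>

lemma equiv_chain_stabilizes:
  assumes fin: "finite S" and eq: "\<And>r. equiv S (Q r)" and mono: "\<And>r. Q r \<subseteq> Q (Suc r)"
    and stall: "\<And>r. Q (Suc r) \<subseteq> Q r \<Longrightarrow> Q (Suc (Suc r)) \<subseteq> Q (Suc r)"
  shows "Q r \<subseteq> Q (card S)"
proof -
  have mono': "Q r \<subseteq> Q s" if "r \<le> s" for r s :: nat
    using that lift_Suc_mono_le[of Q] mono by blast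
  show ?thesis
  proof (cases "\<exists>r0\<le>card S. Q (Suc r0) \<subseteq> Q r0")
    case True
    then obtain r0 where r0: "r0 \<le> card S" "Q (Suc r0) \<subseteq> Q r0" by blast
    have step: "Q (Suc (r0 + d)) \<subseteq> Q (r0 + d)" for d
      using r0(2) stall by (induction d) auto
    have "Q (r0 + d) \<subseteq> Q r0" for d
      using step by (induction d) force+
    then have "Q r \<subseteq> Q r0"
      using mono'[of r "r0 + r"] by (meson le_add2 subset_trans)
    then show ?thesis using mono'[OF r0(1)] by blast
  next
    case False
    have "card (S // Q r) + r \<le> card S" if "r \<le> Suc (card S)" for r
      using that
    proof (induction r)
      case 0
      have "S // Q 0 = (\<lambda>x. Q 0 `` {x}) ` S" by (auto simp: quotient_def)
      then show ?case using card_image_le[OF fin] by simp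
    next
      case (Suc r)
      then have "Q r \<subset> Q (Suc r)" using False mono[of r] by (auto dest!: spec[of _ r])
      then have "card (S // Q (Suc r)) < card (S // Q r)"
        using equiv_quotient_card_less[OF fin eq eq] by blast
      then show ?case using Suc by simp
    qed
    from this[of "Suc (card S)"] show ?thesis by simp
  qed
qed

definition letters :: "nat \<Rightarrow> letter set"
  where "letters N = {..<N} \<times> UNIV"

lemma finite_letters [simp]: "finite (letters N)"
  by (simp add: letters_def)

lemma card_letters: "card (letters N) = 2 * N"
  by (simp add: letters_def card_cartesian_product)

lemma letter_FG: "l \<in> letters N \<longleftrightarrow> [l] \<in> FG N"
  by (cases l) (simp add: letters_def singleton_FG)

lemma inv_letter_letters [simp]: "inv_letter l \<in> letters N \<longleftrightarrow> l \<in> letters N"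
  by (cases l) (simp add: letters_def inv_letter_def)

lemma FG_letters: "w \<in> FG N \<longleftrightarrow> set w \<subseteq> letters N \<and> reduced w"
  by (simp add: FG_iff letters_def)

definition halftree :: "letter \<Rightarrow> fword set"
  where "halftree b = {k. k \<noteq> [] \<and> hd k = b}"

lemma halftree_Cons [simp]: "c # k \<in> halftree b \<longleftrightarrow> c = b" and Nil_halftree [simp]: "[] \<notin> halftree b"
  by (auto simp: halftree_def)

lemma halftree_disjoint: "k \<in> halftree b \<Longrightarrow> k \<in> halftree c \<Longrightarrow> b = c"
  by (simp add: halftree_def)

lemma sep_iff_halftree: "sep u v \<longleftrightarrow> (\<forall>b. \<not> {u, v} \<subseteq> halftree b)"
  by (auto simp: sep_def halftree_def)

lemma halftree_shift:
  assumes "k \<in> halftree b" "reduced k"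
  shows "[inv_letter b] \<odot> k = tl k" "tl k \<notin> halftree (inv_letter b)" "[b] \<odot> tl k = k"
  using assms by (cases k; cases "tl k"; auto simp: halftree_def reduced_Cons)+

text \<open>In contrast to the elements of \<open>auto\<close>, these maps are arbitrary outside the group, so that
  composites with translations need not be restricted.\<close>

locale free_auto =
  fixes N :: nat and \<Phi> :: "fword \<Rightarrow> fword"
  assumes hom: "u \<in> FG N \<Longrightarrow> v \<in> FG N \<Longrightarrow> \<Phi> (u \<odot> v) = \<Phi> u \<odot> \<Phi> v"
    and bij: "bij_betw \<Phi> (FG N) (FG N)"
begin

lemma FG_red [simp]: "u \<in> FG N \<Longrightarrow> reduced u"
  by (rule FG_reduced)

lemma \<Phi>_FG [simp]: "u \<in> FG N \<Longrightarrow> \<Phi> u \<in> FG N"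
  using bij by (auto simp: bij_betw_def)

lemma \<Phi>_Nil [simp]: "\<Phi> [] = []"
proof -
  have "\<Phi> [] \<odot> \<Phi> [] = \<Phi> [] \<odot> []"
    using hom[of "[]" "[]"] by (simp add: FG_reduced)
  then show ?thesis by (subst (asm) fmul_left_cancel) simp_all
qed

lemma \<Phi>_finv: "u \<in> FG N \<Longrightarrow> \<Phi> (finv u) = finv (\<Phi> u)"
proof -
  assume u: "u \<in> FG N"
  have "\<Phi> u \<odot> \<Phi> (finv u) = \<Phi> u \<odot> finv (\<Phi> u)"
    using u hom[of u "finv u"] by (simp add: fmul_finv)
  then show ?thesis using u by (subst (asm) fmul_left_cancel) simp_all
qed

lemma inj: "u \<in> FG N \<Longrightarrow> v \<in> FG N \<Longrightarrow> \<Phi> u = \<Phi> v \<longleftrightarrow> u = v"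
  using bij by (auto simp: bij_betw_def dest: inj_onD)

lemma surj: "v \<in> FG N \<Longrightarrow> \<exists>u\<in>FG N. \<Phi> u = v"
  using bij by (metis bij_betw_def imageE)

text \<open>Twice the volume of the rose whose \<open>i\<close>-th edge has length \<open>|\<Phi> a\<^sub>i|\<close>, the domain on which \<open>\<Phi>\<close> is
  an isometry on edges.\<close>

definition volume :: nat
  where "volume = (\<Sum>l\<in>letters N. length (\<Phi> [l]))"

text \<open>The Cayley tree of the basis that consists of the words \<open>\<Phi> [l]\<close>. Applying \<open>\<Phi>\<close> identifies the
  Cayley tree of the letters with it, whereas the lengths of its vertices are distances in the Cayley
  tree of the letters itself. Cancellation is the difference of the two geometries.\<close>

definition edges :: "fword set set"
  where "edges = {{h, h \<odot> \<Phi> [l]} | h l. h \<in> FG N \<and> l \<in> letters N}"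

text \<open>The edges whose ends are separated by the identity in the Cayley tree of the letters.\<close>

definition crossing :: "fword set set"
  where "crossing = {e \<in> edges. \<forall>b. \<not> e \<subseteq> halftree b}"

text \<open>Chains of these steps are paths in the tree of the basis, all of whose vertices, except the ends,
  are words of length at most \<open>r\<close>.\<close>

definition joined :: "nat \<Rightarrow> (fword set \<times> fword set) set"
  where "joined r = {(e, e'). e \<in> edges \<and> e' \<in> edges \<and> (\<exists>k \<in> e \<inter> e'. length k \<le> r)}"

definition joined_in :: "letter \<Rightarrow> nat \<Rightarrow> (fword set \<times> fword set) set"
  where "joined_in b r =
    {(e, e'). e \<in> edges \<and> e' \<in> edges \<and> (\<exists>k \<in> e \<inter> e' \<inter> halftree b. length k \<le> r)}"

lemma joinedI: "e \<in> edges \<Longrightarrow> e' \<in> edges \<Longrightarrow> k \<in> e \<Longrightarrow> k \<in> e' \<Longrightarrow> length k \<le> r \<Longrightarrow> (e, e') \<in> joined r"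
  by (auto simp: joined_def)

lemma edges_FG: "e \<in> edges \<Longrightarrow> k \<in> e \<Longrightarrow> k \<in> FG N"
  by (auto simp: edges_def letter_FG)

lemma edges_shift: "g \<in> FG N \<Longrightarrow> e \<in> edges \<Longrightarrow> (\<odot>) g ` e \<in> edges"
  by (auto simp: edges_def letter_FG fmul_assoc[symmetric]) 
    (metis fmul_FG fmul_assoc \<Phi>_FG letter_FG)

lemma finite_crossing: "finite crossing" and card_crossing: "card crossing \<le> volume + 2 * N"
proof -
  define T where
    "T = (\<Union>l\<in>letters N. (\<lambda>k. {finv (take k (\<Phi> [l])), finv (take k (\<Phi> [l])) \<odot> \<Phi> [l]}) ` {..length (\<Phi> [l])})"
  have T: "finite T" by (simp add: T_def)
  have sub: "crossing \<subseteq> T"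
  proof
    fix e assume "e \<in> crossing"
    then obtain h l where e: "e = {h, h \<odot> \<Phi> [l]}" "h \<in> FG N" "l \<in> letters N" "sep h (h \<odot> \<Phi> [l])"
      by (auto simp: crossing_def edges_def sep_iff_halftree)
    then obtain k where "k \<le> length (\<Phi> [l])" "h = finv (take k (\<Phi> [l]))"
      using sep_mult_prefix[of h "\<Phi> [l]"] by (auto simp: letter_FG)
    then show "e \<in> T" using e by (auto simp: T_def)
  qed
  show "finite crossing" using finite_subset[OF sub T] .
  have "card T \<le> (\<Sum>l\<in>letters N. card {..length (\<Phi> [l])})"
    unfolding T_def by (rule order_trans[OF card_UN_le]) (auto intro!: sum_mono order_trans[OF card_image_le])
  also have "\<dots> = volume + 2 * N"
    by (simp only: card_atMost volume_def Suc_eq_plus1 sum.distrib sum_constant card_letters) simp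
  finally show "card crossing \<le> volume + 2 * N" using card_mono[OF T sub] by simp
qed

lemma sym_joined: "sym (joined r)"
  by (auto simp: joined_def sym_def)

lemma joined_mono: "r \<le> s \<Longrightarrow> joined r \<subseteq> joined s"
  by (auto simp: joined_def intro: order_trans)

lemma equiv_joined: "equiv crossing ((joined r)\<^sup>* \<inter> crossing \<times> crossing)"
  by (rule equivI) (use sym_rtrancl[OF sym_joined, of r] in \<open>auto simp: refl_on_def sym_def trans_def\<close>)

text \<open>A word that connects the two ends of an edge and passes through the identity into the branch at
  \<open>b\<close> passes through \<open>b\<close> as well.\<close>

lemma crossing_shift:
  assumes "e \<in> crossing" "k \<in> e" "k \<in> halftree b" "b \<in> letters N"
  shows "(\<odot>) [inv_letter b] ` e \<in> crossing"
proof -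
  obtain k' where e: "e = {k, k'}" using assms by (auto simp: crossing_def edges_def)
  have kk: "k \<in> FG N" "k' \<in> FG N" using assms(1) e by (auto simp: crossing_def intro: edges_FG)
  have k': "k' \<notin> halftree b" using assms(1,3) e unfolding crossing_def by blast
  have "[inv_letter b] \<odot> k = tl k" "tl k \<notin> halftree (inv_letter b)"
    using halftree_shift assms(3) kk FG_reduced by blast+
  moreover have "[inv_letter b] \<odot> k' \<in> halftree (inv_letter b)"
    using k' by (cases k') auto
  moreover have "{[inv_letter b] \<odot> k, [inv_letter b] \<odot> k'} \<subseteq> (\<odot>) [inv_letter b] ` e"
    unfolding e by blast
  ultimately have "\<not> (\<odot>) [inv_letter b] ` e \<subseteq> halftree c" for c
    using halftree_disjoint[of "[inv_letter b] \<odot> k'" "inv_letter b" c] by auto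
  moreover have "(\<odot>) [inv_letter b] ` e \<in> edges"
    using assms edges_shift[of "[inv_letter b]" e] by (auto simp: crossing_def letter_FG[symmetric])
  ultimately show ?thesis by (simp add: crossing_def)
qed

lemma joined_in_shift:
  assumes "(e, e') \<in> (joined_in b (Suc r))\<^sup>*" "b \<in> letters N"
  shows "((\<odot>) [inv_letter b] ` e, (\<odot>) [inv_letter b] ` e') \<in> (joined r)\<^sup>*"
  using assms(1)
proof (induction rule: rtrancl_induct)
  case (step e1 e2)
  from step(2) obtain k where k: "k \<in> e1" "k \<in> e2" "k \<in> halftree b" "length k \<le> Suc r"
    and e: "e1 \<in> edges" "e2 \<in> edges" by (auto simp: joined_in_def)
  have "[inv_letter b] \<odot> k = tl k" using halftree_shift k e edges_FG FG_reduced by blast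
  then have "tl k \<in> (\<odot>) [inv_letter b] ` e1" "tl k \<in> (\<odot>) [inv_letter b] ` e2"
    using k by (metis imageI)+
  moreover have "(\<odot>) [inv_letter b] ` e1 \<in> edges" "(\<odot>) [inv_letter b] ` e2 \<in> edges"
    using e assms(2) edges_shift[of "[inv_letter b]"] by (simp_all add: letter_FG[symmetric])
  ultimately have "((\<odot>) [inv_letter b] ` e1, (\<odot>) [inv_letter b] ` e2) \<in> joined r"
    using k(4) by (intro joinedI[of _ _ "tl k"]) simp_all
  with step(3) show ?case by simp
qed simp

lemma joined_shift:
  assumes "(e, e') \<in> (joined r)\<^sup>*" "b \<in> letters N"
  shows "((\<odot>) [b] ` e, (\<odot>) [b] ` e') \<in> (joined (Suc r))\<^sup>*"
  using assms(1)
proof (induction rule: rtrancl_induct)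
  case (step e1 e2)
  from step(2) obtain k where k: "k \<in> e1" "k \<in> e2" "length k \<le> r"
    and e: "e1 \<in> edges" "e2 \<in> edges" by (auto simp: joined_def)
  have "length ([b] \<odot> k) \<le> Suc r"
    using length_fmul_le[of "[b]" k] k e edges_FG FG_reduced assms(2) letter_FG by fastforce
  then have "((\<odot>) [b] ` e1, (\<odot>) [b] ` e2) \<in> joined (Suc r)"
    using e k assms(2) edges_shift[of "[b]"] by (auto simp: joined_def letter_FG[symmetric])
  with step(3) show ?case by simp
qed simp

text \<open>A chain that leaves the identity and comes back for the first time does so through the same
  neighbour \<open>b\<close>. Seen from \<open>b\<close> its joints are one step closer, so the assumption applies there, and
  going back to the identity costs one step again.\<close>

lemma excursion_shortcut:
  assumes stall: "(joined (Suc r))\<^sup>* \<inter> crossing \<times> crossing \<subseteq> (joined r)\<^sup>*"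
    and exc: "(e, e') \<in> (joined_in b (Suc (Suc r)))\<^sup>*" and e: "e \<in> crossing" "e' \<in> crossing"
  shows "(e, e') \<in> (joined (Suc r))\<^sup>*"
proof (cases "e = e'")
  case False
  have "\<exists>k\<in>e. k \<in> halftree b"
    using exc False by (cases rule: converse_rtranclE) (auto simp: joined_in_def)
  then obtain k where k: "k \<in> e" "k \<in> halftree b" by blast
  have "\<exists>k\<in>e'. k \<in> halftree b"
    using exc False by (cases rule: rtranclE) (auto simp: joined_in_def)
  then obtain k' where k': "k' \<in> e'" "k' \<in> halftree b" by blast
  have "k \<in> FG N" using k e by (auto simp: crossing_def intro: edges_FG)
  then have b: "b \<in> letters N" using k(2) by (cases k) (auto simp: FG_letters)
  let ?\<beta> = "(`) ((\<odot>) [inv_letter b])"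
  have "(?\<beta> e, ?\<beta> e') \<in> (joined (Suc r))\<^sup>*" by (rule joined_in_shift[OF exc b])
  moreover have "?\<beta> e \<in> crossing" "?\<beta> e' \<in> crossing"
    using crossing_shift e k k' b by blast+
  ultimately have "(?\<beta> e, ?\<beta> e') \<in> (joined r)\<^sup>*" using stall by blast
  then have "((\<odot>) [b] ` ?\<beta> e, (\<odot>) [b] ` ?\<beta> e') \<in> (joined (Suc r))\<^sup>*"
    using joined_shift b by blast
  moreover have "(\<odot>) [b] ` ?\<beta> x = x" if "x \<in> edges" for x
  proof -
    have "[b] \<odot> [inv_letter b] \<odot> k = k" if "k \<in> x" for k
      using red_cons_cancel'[of k b] that \<open>x \<in> edges\<close> by (simp add: edges_FG)
    then show ?thesis by (force simp: image_image)
  qed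
  ultimately show ?thesis using e by (simp add: crossing_def)
qed simp

text \<open>Cut a chain into excursions at its visits to the identity, and shorten each of them.\<close>

lemma joined_stall:
  assumes stall: "(joined (Suc r))\<^sup>* \<inter> crossing \<times> crossing \<subseteq> (joined r)\<^sup>*"
    and conn: "(e, e') \<in> (joined (Suc (Suc r)))\<^sup>*" and e: "e \<in> crossing" "e' \<in> crossing"
  shows "(e, e') \<in> (joined (Suc r))\<^sup>*"
proof -
  \<comment> \<open>The last edge of the chain through the identity, followed by an excursion.\<close>
  have last: "\<exists>e1\<in>crossing. (e, e1) \<in> (joined (Suc r))\<^sup>* \<and> (\<exists>b. (e1, e'') \<in> (joined_in b (Suc (Suc r)))\<^sup>*)"
    if "(e, e'') \<in> (joined (Suc (Suc r)))\<^sup>*" for e''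
    using that
  proof (induction rule: rtrancl_induct)
    case base
    then show ?case using e by blast
  next
    case (step e2 e3)
    then obtain e1 b where e1: "e1 \<in> crossing" "(e, e1) \<in> (joined (Suc r))\<^sup>*"
      "(e1, e2) \<in> (joined_in b (Suc (Suc r)))\<^sup>*" by blast
    obtain k where k: "k \<in> e2" "k \<in> e3" "length k \<le> Suc (Suc r)" and ed: "e2 \<in> edges" "e3 \<in> edges"
      using step(2) by (auto simp: joined_def)
    have ret: "(e, e2) \<in> (joined (Suc r))\<^sup>*" if "e2 \<in> crossing"
      using excursion_shortcut[OF stall e1(3) e1(1) that] e1(2) by simp
    show ?case
    proof (cases "k = []")
      case True
      then have "e2 \<in> crossing" "e3 \<in> crossing" using k ed by (auto simp: crossing_def)
      moreover have "(e2, e3) \<in> joined (Suc r)" using k ed True by (intro joinedI[of _ _ k]) simp_all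
      ultimately show ?thesis using ret by (blast intro: rtrancl_into_rtrancl)
    next
      case False
      define c where "c = hd k"
      have kc: "k \<in> halftree c" using False by (simp add: c_def halftree_def)
      have st: "(e2, e3) \<in> joined_in c (Suc (Suc r))" using kc k ed by (auto simp: joined_in_def)
      show ?thesis
      proof (cases "e2 \<in> crossing")
        case True
        then show ?thesis using ret st by blast
      next
        case out: False
        then have "e1 \<noteq> e2" using e1 by auto
        with e1(3) have "\<exists>k\<in>e2. k \<in> halftree b"
          by (cases rule: rtranclE) (auto simp: joined_in_def)
        moreover obtain d where "e2 \<subseteq> halftree d" using out ed by (auto simp: crossing_def)
        ultimately have "b = c" using kc k halftree_disjoint by (metis subsetD)
        then show ?thesis using e1 st by (blast intro: rtrancl_into_rtrancl)
      qed
    qed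
  qed
  from last[OF conn] obtain e1 b where "e1 \<in> crossing" "(e, e1) \<in> (joined (Suc r))\<^sup>*"
    "(e1, e') \<in> (joined_in b (Suc (Suc r)))\<^sup>*" by blast
  then show ?thesis using excursion_shortcut[OF stall _ _ e(2)] by (meson rtrancl_trans)
qed

text \<open>The classes of crossing edges connected by chains of radius \<open>r\<close> merge as \<open>r\<close> grows, and they do
  so until nothing changes any more, by \<open>joined_stall\<close>. So a radius as large as the number of crossing
  edges is enough. This is linear in the volume, whereas the constants of \<open>\<Phi>\<close> as a quasi-isometry
  depend on the inverse of \<open>\<Phi>\<close> too.\<close>

lemma crossing_joined_bound:
  assumes "(e, e') \<in> (joined r)\<^sup>*" "e \<in> crossing" "e' \<in> crossing"
  shows "(e, e') \<in> (joined (volume + 2 * N))\<^sup>*"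
proof -
  define Q where "Q r = (joined r)\<^sup>* \<inter> crossing \<times> crossing" for r
  have mono: "(joined r)\<^sup>* \<subseteq> (joined s)\<^sup>*" if "r \<le> s" for r s
    using that by (intro rtrancl_mono joined_mono)
  have "Q r \<subseteq> Q (card crossing)"
  proof (rule equiv_chain_stabilizes[OF finite_crossing])
    show "equiv crossing (Q r)" for r unfolding Q_def by (rule equiv_joined)
    show "Q r \<subseteq> Q (Suc r)" for r using mono[of r "Suc r"] unfolding Q_def by auto
    show "Q (Suc (Suc r)) \<subseteq> Q (Suc r)" if "Q (Suc r) \<subseteq> Q r" for r
      using that joined_stall[of r] unfolding Q_def by auto
  qed
  then show ?thesis using assms mono[OF card_crossing] by (auto simp: Q_def)
qed

lemma \<Phi>_take_Suc:
  assumes "a \<in> FG N" "i < length a" 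
  shows "\<Phi> (take (Suc i) a) = \<Phi> (take i a) \<odot> \<Phi> [a ! i]" "a ! i \<in> letters N"
proof -
  show l: "a ! i \<in> letters N" using assms nth_mem[of i a] by (auto simp: FG_letters)
  have "take i a \<odot> [a ! i] = take (Suc i) a"
    using fmul_reduced_append[of "take i a" "[a ! i]"] assms
    by (simp add: take_Suc_conv_app_nth[symmetric] reduced_take)
  then show "\<Phi> (take (Suc i) a) = \<Phi> (take i a) \<odot> \<Phi> [a ! i]"
    using hom[of "take i a" "[a ! i]"] assms l by (simp add: take_FG letter_FG)
qed

lemma prefix_edge:
  assumes "a \<in> FG N" "i < length a" "c \<in> FG N"
  shows "{c \<odot> \<Phi> (take i a), c \<odot> \<Phi> (take (Suc i) a)} \<in> edges"
  unfolding edges_def \<Phi>_take_Suc(1)[OF assms(1,2)]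
  by (rule CollectI, rule exI[of _ "c \<odot> \<Phi> (take i a)"], rule exI[of _ "a ! i"])
    (use assms \<Phi>_take_Suc(2)[OF assms(1,2)] in \<open>simp add: fmul_assoc take_FG letter_FG\<close>)

lemma prefix_edges_joined:
  assumes "a \<in> FG N" "i < length a" "c \<in> FG N"
  shows "\<exists>r. ({c \<odot> \<Phi> (take 0 a), c \<odot> \<Phi> (take 1 a)}, {c \<odot> \<Phi> (take i a), c \<odot> \<Phi> (take (Suc i) a)}) \<in> (joined r)\<^sup>*"
  using assms(2)
proof (induction i)
  case (Suc i)
  then obtain r where r: "({c \<odot> \<Phi> (take 0 a), c \<odot> \<Phi> (take 1 a)},
    {c \<odot> \<Phi> (take i a), c \<odot> \<Phi> (take (Suc i) a)}) \<in> (joined r)\<^sup>*" by auto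
  let ?s = "max r (length (c \<odot> \<Phi> (take (Suc i) a)))"
  have "(joined r)\<^sup>* \<subseteq> (joined ?s)\<^sup>*" by (intro rtrancl_mono joined_mono) simp
  moreover have "({c \<odot> \<Phi> (take i a), c \<odot> \<Phi> (take (Suc i) a)},
      {c \<odot> \<Phi> (take (Suc i) a), c \<odot> \<Phi> (take (Suc (Suc i)) a)}) \<in> joined ?s"
    using prefix_edge assms Suc by (auto simp: joined_def)
  ultimately show ?case using r by (meson rtrancl_into_rtrancl subsetD)
qed auto

text \<open>The image of a geodesic through \<open>s\<close> can turn back between \<open>\<Phi> s\<close> and the identity only
  if \<open>\<Phi> s\<close> is close to the identity. In the statement \<open>s\<close> is translated to the identity, and \<open>c\<close> stands
  for \<open>\<Phi> s\<close>. On both sides of \<open>s\<close> there is an edge of the geodesic whose image passes through the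
  identity. A chain of small radius connects these two edges; since \<open>s\<close> separates them in the tree of
  the basis, it passes through \<open>s\<close>.\<close>

lemma bounded_cancellation:
  assumes abc: "a \<in> FG N" "b \<in> FG N" "c \<in> FG N"
    and ab: "sep a b" and ca: "sep c (c \<odot> \<Phi> a)" and cb: "sep c (c \<odot> \<Phi> b)"
  shows "length c \<le> volume + 2 * N"
proof (cases "a = [] \<or> b = []")
  case True
  then have "sep c c" using ca cb abc by auto
  then show ?thesis by (auto simp: sep_def)
next
  case False
  define C where "C = volume + 2 * N"
  define ed where "ed a i = {c \<odot> \<Phi> (take i a), c \<odot> \<Phi> (take (Suc i) a)}" for a i
  have ex: "\<exists>i<length a. ed a i \<in> crossing" if a: "a \<noteq> []" "a \<in> FG N" "sep c (c \<odot> \<Phi> a)" for a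
  proof -
    have "c \<odot> \<Phi> [] = c" using abc by simp
    then obtain i where "i < length a" "sep (c \<odot> \<Phi> (take i a)) (c \<odot> \<Phi> (take (Suc i) a))"
      using sep_prefixes[of "\<lambda>x. c \<odot> \<Phi> x" a] a(1,3) by metis
    then show ?thesis
      using prefix_edge[OF a(2) _ abc(3)] by (auto simp: crossing_def ed_def sep_iff_halftree)
  qed
  obtain i where i: "i < length a" "ed a i \<in> crossing" using ex[of a] False abc ca by blast
  obtain j where j: "j < length b" "ed b j \<in> crossing" using ex[of b] False abc cb by blast
  have sym: "sym ((joined r)\<^sup>*)" for r by (intro sym_rtrancl sym_joined)
  have "\<exists>r. (ed a i, ed b j) \<in> (joined r)\<^sup>*"
  proof -
    obtain r1 where r1: "(ed a 0, ed a i) \<in> (joined r1)\<^sup>*"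
      using prefix_edges_joined[OF abc(1) i(1) abc(3)] by (auto simp: ed_def)
    obtain r2 where r2: "(ed b 0, ed b j) \<in> (joined r2)\<^sup>*"
      using prefix_edges_joined[OF abc(2) j(1) abc(3)] by (auto simp: ed_def)
    have "ed a 0 \<in> edges" "ed b 0 \<in> edges"
      using prefix_edge[of a 0 c] prefix_edge[of b 0 c] abc False by (simp_all add: ed_def)
    then have r3: "(ed a 0, ed b 0) \<in> joined (length (c \<odot> []))" by (auto simp: joined_def ed_def)
    define s where "s = r1 + r2 + length (c \<odot> [])"
    have mono: "(joined r)\<^sup>* \<subseteq> (joined s)\<^sup>*" if "r \<le> s" for r
      using that by (intro rtrancl_mono joined_mono)
    have "(ed a i, ed a 0) \<in> (joined s)\<^sup>*" using r1 mono[of r1] sym by (auto simp: s_def dest: symD)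
    moreover have "(ed a 0, ed b 0) \<in> (joined s)\<^sup>*" using r3 mono[of "length (c \<odot> [])"] by (auto simp: s_def)
    moreover have "(ed b 0, ed b j) \<in> (joined s)\<^sup>*" using r2 mono[of r2] by (auto simp: s_def)
    ultimately show ?thesis by (meson rtrancl_trans)
  qed
  then have chain: "(ed a i, ed b j) \<in> (joined C)\<^sup>*"
    using crossing_joined_bound i j unfolding C_def by blast
  show ?thesis
  proof (rule ccontr)
    assume "\<not> ?thesis"
    then have long: "C < length c" by (simp add: C_def)
    \<comment> \<open>The position of the vertex \<open>v\<close> relative to \<open>c\<close>, as a word in the basis.\<close>
    define pos where "pos v = (THE g. g \<in> FG N \<and> c \<odot> \<Phi> g = v)" for v
    have pos: "pos (c \<odot> \<Phi> g) = g" if "g \<in> FG N" for g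
      unfolding pos_def using that abc inj by (auto simp: fmul_left_cancel intro!: the_equality)
    have col: "x \<in> halftree l \<longleftrightarrow> y \<in> halftree l"
      if "e \<in> edges" "h \<in> e" "k \<in> e" "x = pos h" "y = pos k" "x \<noteq> []" "y \<noteq> []" for e h k x y l
    proof -
      obtain h' m where e: "e = {h', h' \<odot> \<Phi> [m]}" "h' \<in> FG N" "m \<in> letters N"
        using \<open>e \<in> edges\<close> unfolding edges_def by blast
      obtain g where g: "g \<in> FG N" "\<Phi> g = finv c \<odot> h'" using surj[of "finv c \<odot> h'"] e abc by auto
      have h': "h' = c \<odot> \<Phi> g" using g abc e by (simp add: fmul_finv_cancel)
      have h'm: "h' \<odot> \<Phi> [m] = c \<odot> \<Phi> (g \<odot> [m])"
        unfolding h' using g(1) e(3) by (simp add: hom letter_FG fmul_assoc)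
      have p: "pos h' = g" "pos (h' \<odot> \<Phi> [m]) = g \<odot> [m]"
        using pos[of g] pos[of "g \<odot> [m]"] g(1) e(3) fmul_FG[of g N "[m]"]
        by (simp_all only: h'[symmetric] h'm[symmetric] letter_FG)
      have nsep: "\<not> sep g (g \<odot> [m])" if "g \<noteq> []" "g \<odot> [m] \<noteq> []"
      proof
        assume "sep g (g \<odot> [m])"
        then obtain k where "k \<le> length [m]" "g = finv (take k [m])"
          using sep_mult_prefix[of g "[m]"] g e by (auto simp: letter_FG)
        then have "g = [] \<or> g = [inv_letter m]" by (cases k) (auto simp: finv_Cons)
        then show False using that by auto
      qed
      show ?thesis using nsep that p e by (auto simp: sep_def halftree_def)
    qed
    \<comment> \<open>No joint of the chain is the vertex \<open>c\<close>, so the chain stays in one component of the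
      complement of \<open>c\<close> in the tree of the basis, and the two edges lie in different ones.\<close>
    define \<alpha> where "\<alpha> = hd a"
    have inv: "\<forall>k\<in>e'. pos k \<noteq> [] \<longrightarrow> pos k \<in> halftree \<alpha>"
      if "(ed a i, e') \<in> (joined C)\<^sup>*" for e'
      using that
    proof (induction rule: rtrancl_induct)
      case base
      have hd_take: "take k a \<in> halftree \<alpha>" if "take k a \<noteq> []" for k
        using that by (auto simp: \<alpha>_def halftree_def hd_take)
      show ?case using pos abc hd_take by (auto simp: ed_def take_FG simp del: take_eq_Nil)
    next
      case (step e1 e2)
      then obtain k where k: "k \<in> e1" "k \<in> e2" "length k \<le> C" "e2 \<in> edges" by (auto simp: joined_def)
      have "k \<in> FG N" using k edges_FG by blast
      then obtain g where g: "g \<in> FG N" "\<Phi> g = finv c \<odot> k" using surj[of "finv c \<odot> k"] abc by auto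
      have kg: "k = c \<odot> \<Phi> g" using g abc \<open>k \<in> FG N\<close> by (simp add: fmul_finv_cancel)
      have "pos k \<noteq> []" using long k(3) kg pos[OF g(1)] abc by auto
      then show ?case using step(3) k col by blast
    qed
    \<comment> \<open>An end of the edge on the side of \<open>b\<close> that is not \<open>c\<close> itself.\<close>
    obtain k where k: "k \<in> {j, Suc j}" "take k b \<noteq> []" using False by auto
    have "c \<odot> \<Phi> (take k b) \<in> ed b j" using k by (auto simp: ed_def)
    then have "take k b \<in> halftree \<alpha>" using inv[OF chain] pos[of "take k b"] k abc by (auto simp: take_FG)
    then have "hd b = hd a" using k by (auto simp: \<alpha>_def halftree_def hd_take)
    then show False using ab False by (simp add: sep_def)
  qed
qed

end

section \<open>Images of long words\<close>

text \<open>If \<open>u\<close> is a prefix of neither word, then some letter of \<open>u\<^sup>-\<^sup>1\<close> survives in both differences, and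
  they begin with the same letter.\<close>

lemma geodesic_point:
  assumes "reduced x" "reduced y" "reduced u" and sep: "sep (finv u \<odot> x) (finv u \<odot> y)"
  shows "\<exists>k. (k \<le> length x \<and> u = take k x) \<or> (k \<le> length y \<and> u = take k y)"
proof -
  obtain s p x' where p: "finv u = p @ finv s" "x = s @ x'" "finv u \<odot> x = p @ x'"
    using fmul_cancellation[of "finv u" x] assms(1,3) reduced_finv by metis
  obtain s2 p2 y' where p2: "finv u = p2 @ finv s2" "y = s2 @ y'" "finv u \<odot> y = p2 @ y'"
    using fmul_cancellation[of "finv u" y] assms(2,3) reduced_finv by metis
  have "p = [] \<or> p2 = []"
  proof (rule ccontr)
    assume *: "\<not> ?thesis"
    then have "hd p = hd p2" using p(1) p2(1) by (metis hd_append2)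
    then show False using sep * p p2 by (auto simp: sep_def)
  qed
  then have "u = s \<or> u = s2" using p(1) p2(1) finv_finv by (metis append_Nil)
  then show ?thesis using p p2 by (metis append_eq_conv_conj le_add1 length_append)
qed

lemma inv_letter_image: "l \<in> inv_letter ` B \<longleftrightarrow> inv_letter l \<in> B"
  by (auto intro: image_eqI[of _ _ "inv_letter l"])

text \<open>Conjugation by \<open>b\<close> removes a letter at each end where cancellation takes place, and adds a
  letter at each other end.\<close>

lemma hd_last_conjugate:
  assumes "reduced u" "u \<noteq> []"
  shows "length ([inv_letter b] \<odot> u \<odot> [b]) + (if hd u = b then 2 else 0)
    + (if last u = inv_letter b then 2 else 0) \<le> length u + 2"
proof -
  have single: "reduced [c]" for c by (simp add: reduced_Cons)
  have right: "length (u' \<odot> [b]) \<le> length u' + 1" if "reduced u'" for u'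
    using length_fmul_le[OF that single[of b]] by simp
  have left: "length ([inv_letter b] \<odot> u') \<le> length u' + 1" if "reduced u'" for u'
    using length_fmul_le[OF single[of "inv_letter b"] that] by simp
  have hdb: "[inv_letter b] \<odot> u \<odot> [b] = tl u \<odot> [b]" if "hd u = b"
    using that assms red_cons_cancel[of "tl u \<odot> [b]" b]
    by (cases u) (simp_all add: reduced_Cons single)
  have lastb: "u \<odot> [b] = butlast u" if "last u = inv_letter b"
  proof -
    have u: "u = butlast u @ [inv_letter b]" using that assms by (metis append_butlast_last_id)
    then have red: "reduced (butlast u)" using assms by (metis reduced_append)
    have "u \<odot> [b] = butlast u \<odot> ([inv_letter b] \<odot> [b])" by (subst u) simp
    then show ?thesis using red by simp
  qed
  show ?thesis
  proof (cases "last u = inv_letter b")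
    case last: True
    show ?thesis
    proof (cases "hd u = b")
      case True
      obtain c u' where u: "u = c # u'" using assms by (cases u) auto
      then have u': "u' \<noteq> []" using last True by auto
      have "tl u \<odot> [b] = butlast u'"
      proof -
        have e: "u' = butlast u' @ [inv_letter b]" using last u u' by (metis append_butlast_last_id last_ConsR)
        moreover have "reduced (butlast u')" using assms u e by (metis reduced_append reduced_Cons)
        moreover have "u' \<odot> [b] = butlast u' \<odot> ([inv_letter b] \<odot> [b])" by (subst e) simp
        ultimately show ?thesis using u by simp
      qed
      then show ?thesis using hdb[OF True] last True u u' by (cases u') simp_all
    next
      case False
      have "reduced (butlast u)" using assms by (simp add: butlast_conv_take reduced_take)
      then show ?thesis using lastb[OF last] left[of "butlast u"] last False assms by (cases u) simp_all
    qed
  next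
    case False
    show ?thesis
    proof (cases "hd u = b")
      case True
      have "reduced (tl u)" using assms by (cases u) (auto simp: reduced_Cons)
      then show ?thesis using hdb[OF True] right[of "tl u"] True False assms by (cases u) simp_all
    next
      case nhd: False
      have "reduced (u \<odot> [b])" by (simp add: single)
      then show ?thesis using left[of "u \<odot> [b]"] right[OF assms(1)] nhd False by simp
    qed
  qed
qed

lemma reduced_concat_replicate: "reduced (v @ v) \<Longrightarrow> reduced (concat (replicate m v))"
proof (induction m)
  case (Suc m)
  then show ?case by (cases m) (auto simp: reduced_append)
qed simp

text \<open>Let \<open>L\<close> be the largest length of an image of a letter. If there is no cancellation, the images of
  the test words have length at least \<open>(8 N + 2) L\<close>, whereas the parts that cancellation can reach,
  \<open>volume + 2 N\<close> at each end, have length at most \<open>4 N L\<close>.\<close>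

definition test_words :: "nat \<Rightarrow> fword set"
  where "test_words N = (\<lambda>v. concat (replicate (8 * N + 2) v)) `
    {v \<in> FG N. v \<noteq> [] \<and> length v \<le> 2 \<and> reduced (v @ v)}"

lemma finite_test_words: "finite (test_words N)"
  unfolding test_words_def
  by (rule finite_imageI, rule finite_subset[OF _ finite_FG_bounded[of N 2]]) auto

lemma test_words:
  assumes "w \<in> test_words N"
  shows "w \<in> FG N" "w \<noteq> []" "length w \<le> 16 * N + 4"
proof -
  obtain v where v: "v \<in> FG N" "v \<noteq> []" "length v \<le> 2" "reduced (v @ v)"
    and w: "w = concat (replicate (8 * N + 2) v)"
    using assms by (auto simp: test_words_def)
  have "set w \<subseteq> set v" unfolding w by auto
  then show "w \<in> FG N" using v(1) reduced_concat_replicate[OF v(4)] unfolding w FG_iff by blast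
  show "w \<noteq> []" using v w by simp
  have "length w = (8 * N + 2) * length v"
    unfolding w by (simp only: length_concat map_replicate sum_list_replicate) simp
  also have "\<dots> \<le> (8 * N + 2) * 2" using v(3) by (intro mult_le_mono2)
  finally show "length w \<le> 16 * N + 4" by simp
qed

context free_auto
begin

text \<open>Bounded cancellation for an arbitrary point \<open>s\<close> of the geodesic \<open>[a, b]\<close> and the base
  point \<open>c\<^sup>-\<^sup>1\<close>.\<close>

lemma bounded_cancellation_at:
  assumes FG: "a \<in> FG N" "b \<in> FG N" "s \<in> FG N" "c \<in> FG N"
    and ab: "sep (finv s \<odot> a) (finv s \<odot> b)"
    and a: "sep (c \<odot> \<Phi> s) (c \<odot> \<Phi> a)" and b: "sep (c \<odot> \<Phi> s) (c \<odot> \<Phi> b)"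
  shows "length (c \<odot> \<Phi> s) \<le> volume + 2 * N"
proof -
  have "(c \<odot> \<Phi> s) \<odot> \<Phi> (finv s \<odot> x) = c \<odot> \<Phi> x" if "x \<in> FG N" for x
    using FG that by (simp add: hom \<Phi>_finv fmul_assoc fmul_finv_cancel)
  then show ?thesis
    using bounded_cancellation[of "finv s \<odot> a" "finv s \<odot> b" "c \<odot> \<Phi> s"] assms by simp
qed

text \<open>The vertices of the geodesic from the identity to \<open>\<Phi> w\<close> that cancellation cannot reach.\<close>

definition middle :: "fword \<Rightarrow> fword set"
  where "middle w = (\<lambda>j. take j (\<Phi> w)) ` {volume + 2 * N <..< length (\<Phi> w) - (volume + 2 * N)}"

lemma middle_FG: "w \<in> FG N \<Longrightarrow> h \<in> middle w \<Longrightarrow> h \<in> FG N"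
  by (auto simp: middle_def take_FG)

lemma card_middle: "card (middle w) = length (\<Phi> w) - 2 * (volume + 2 * N) - 1"
proof -
  have "inj_on (\<lambda>j. take j (\<Phi> w)) {volume + 2 * N <..< length (\<Phi> w) - (volume + 2 * N)}"
    by (rule inj_onI) (auto dest: arg_cong[where f = length])
  then show ?thesis by (simp add: middle_def card_image)
qed

lemma middleD:
  assumes w: "w \<in> FG N" and "h \<in> middle w"
  shows "volume + 2 * N < length (finv h)" "volume + 2 * N < length (finv h \<odot> \<Phi> w)"
    "sep (finv h) (finv h \<odot> \<Phi> w)"
proof -
  obtain j where j: "volume + 2 * N < j" "j < length (\<Phi> w) - (volume + 2 * N)" "h = take j (\<Phi> w)"
    using assms by (auto simp: middle_def)
  have "h \<odot> drop j (\<Phi> w) = \<Phi> w"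
    using fmul_reduced_append[of h "drop j (\<Phi> w)"] w j by simp
  then have d: "finv h \<odot> \<Phi> w = drop j (\<Phi> w)"
    using finv_fmul_cancel[of "drop j (\<Phi> w)" h] w by (simp add: reduced_drop)
  then show "volume + 2 * N < length (finv h)" "volume + 2 * N < length (finv h \<odot> \<Phi> w)"
    using j by auto
  have ne: "h \<noteq> []" using j by auto
  have "reduced (h @ drop j (\<Phi> w))" using j w by simp
  then show "sep (finv h) (finv h \<odot> \<Phi> w)"
    unfolding d sep_def using ne by (auto simp: reduced_append hd_finv)
qed

text \<open>As seen from \<open>h\<close>, the points \<open>\<Phi> x\<close> and \<open>\<Phi> y\<close> have the same directions as the identity and \<open>\<Phi> w\<close>,
  by bounded cancellation.\<close>

lemma middle_on_image:
  assumes w: "w \<in> FG N" "w \<noteq> []" and h: "h \<in> middle w" and xy: "x \<in> FG N" "y \<in> FG N"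
    and x: "sep x w" and y: "take (length w) y = w"
  shows "sep (finv h \<odot> \<Phi> x) (finv h \<odot> \<Phi> y)"
proof -
  note m = middleD[OF w(1) h]
  have hF: "h \<in> FG N" "finv h \<in> FG N" using middle_FG[OF w(1) h] by simp_all
  obtain y' where y': "y = w @ y'" using y by (metis append_take_drop_id)
  have red: "reduced (w @ y')" using xy y' by auto
  have "w \<odot> y' = y" using fmul_reduced_append[OF red] y' by simp
  then have fy: "finv w \<odot> y = y'"
    using finv_fmul_cancel[of y' w] red by (auto simp: reduced_append)
  have "\<not> sep (finv h) (finv h \<odot> \<Phi> x)"
    using bounded_cancellation_at[of x w "[]" "finv h"] hF xy w m x by auto
  moreover have "\<not> sep (finv h \<odot> \<Phi> w) (finv h \<odot> \<Phi> y)"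
  proof -
    have "sep (finv w \<odot> []) (finv w \<odot> y)"
      using red fy w by (auto simp: sep_def reduced_append hd_finv)
    then show ?thesis
      using bounded_cancellation_at[of "[]" y w "finv h"] hF xy w m by (auto simp: sep_sym)
  qed
  ultimately show ?thesis using m(3) by (auto simp: sep_def)
qed

text \<open>The words \<open>w\<close> from \<open>1\<close> to \<open>w\<close> and from \<open>u\<close> to \<open>u w\<close> are non-overlapping parts of one geodesic.
  If their images had a common middle vertex, then, by bounded cancellation, \<open>\<Phi> u\<close> and \<open>\<Phi> (u w)\<close> would
  both have the direction of \<open>\<Phi> w\<close> from it, but they have different directions.\<close>

lemma middles_disjoint:
  assumes w: "w \<in> FG N" "w \<noteq> []" and h: "h \<in> middle w" "h' \<in> middle w"
    and u: "u = w @ r" "u @ w \<in> FG N" and eq: "finv h \<odot> \<Phi> u = finv h'"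
  shows False
proof -
  note m = middleD[OF w(1) h(1)] and m' = middleD[OF w(1) h(2)]
  have hF: "h \<in> FG N" "h' \<in> FG N" "finv h \<in> FG N" "finv h' \<in> FG N" using middle_FG[OF w(1)] h by simp_all
  have uF: "u \<in> FG N" "r \<in> FG N" using u FG_appendD[of u w] FG_appendD[of w r] by auto
  have uw: "u \<odot> w = u @ w" using fmul_reduced_append u(2) by simp
  have e: "finv h \<odot> \<Phi> (u @ w) = finv h' \<odot> \<Phi> w"
    unfolding uw[symmetric] eq[symmetric] using uF w hF by (simp add: hom fmul_assoc)
  have rw: "w @ r @ w \<in> FG N" using u by simp
  then have "w \<odot> (r @ w) = u @ w" using fmul_reduced_append[of w "r @ w"] u by simp
  then have "finv w \<odot> (u @ w) = r @ w"
    using finv_fmul_cancel[of "r @ w" w] rw by (metis FG_appendD FG_red)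
  moreover have "sep (finv w) (r @ w)"
    using rw w by (auto simp: sep_def hd_finv FG_iff reduced_append)
  ultimately have "\<not> sep (finv h \<odot> \<Phi> w) (finv h' \<odot> \<Phi> w)"
    using bounded_cancellation_at[of "[]" "u @ w" w "finv h"] m hF w u(2) e by (auto simp: sep_sym)
  moreover have "\<not> sep (finv h') (finv h \<odot> \<Phi> w)"
  proof -
    have "finv u \<odot> (u @ w) = w" using finv_fmul_cancel[of w u] uw w by simp
    moreover have "finv u \<odot> w = finv r"
    proof -
      have "w \<odot> r = u" using fmul_reduced_append[of w r] u uF by simp
      then have "finv u = finv r \<odot> finv w" using finv_of_fmul[of w r] w uF by simp
      then show ?thesis using w uF by (simp add: fmul_assoc finv_fmul)
    qed
    moreover have "sep (finv r) w"
      using rw w by (cases "r = []") (auto simp: sep_def hd_finv FG_iff reduced_append)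
    ultimately have "sep (finv u \<odot> w) (finv u \<odot> (u @ w))" by simp
    then show ?thesis
      using bounded_cancellation_at[of w "u @ w" u "finv h"] m' hF w u(2) uF e eq by (auto simp: sep_sym)
  qed
  ultimately show False using m' by (auto simp: sep_def)
qed

text \<open>The condition on \<open>g\<close> says that the geodesic from \<open>x\<close> to \<open>y\<close> passes through \<open>g\<^sup>-\<^sup>1\<close> and \<open>g\<^sup>-\<^sup>1 w\<close>, and
  that the identity is a middle vertex of the image of this part. So the vertices \<open>g\<^sup>-\<^sup>1\<close> lie on a
  geodesic, and any two of them have distance less than \<open>|w|\<close>, by \<open>middles_disjoint\<close>.\<close>

lemma overlap_bound:
  assumes w: "w \<in> FG N" "w \<noteq> []" and xy: "x \<in> FG N" "y \<in> FG N"
  shows "card {g \<in> FG N. \<Phi> g \<in> middle w \<and> sep (g \<odot> x) w \<and> take (length w) (g \<odot> y) = w} \<le> length w"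
    (is "card ?G \<le> _")
proof (cases "?G = {}")
  case False
  \<comment> \<open>Among the vertices \<open>g\<^sup>-\<^sup>1\<close>, the one closest to \<open>x\<close>.\<close>
  define g1 where "g1 = (ARG_MIN (\<lambda>g. length (finv x \<odot> finv g)) g. g \<in> ?G)"
  from False obtain g0 where "g0 \<in> ?G" by blast
  then have g1G: "g1 \<in> ?G" and g1_min: "\<And>g. g \<in> ?G \<Longrightarrow> length (finv x \<odot> finv g1) \<le> length (finv x \<odot> finv g)"
    unfolding g1_def using arg_min_nat_lemma[of "\<lambda>g. g \<in> ?G" g0 "\<lambda>g. length (finv x \<odot> finv g)"] by blast+
  define X Y where "X = g1 \<odot> x" and "Y = g1 \<odot> y"
  have g1: "g1 \<in> FG N" "\<Phi> g1 \<in> middle w" "sep X w" "take (length w) Y = w"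
    using g1G by (auto simp: X_def Y_def)
  have XY: "X \<in> FG N" "Y \<in> FG N" using g1 xy by (simp_all add: X_def Y_def)
  have "(\<lambda>g. g1 \<odot> finv g) ` ?G \<subseteq> (\<lambda>k. take k Y) ` {..<length w}"
  proof (rule image_subsetI)
    fix g assume gG: "g \<in> ?G"
    then have g: "g \<in> FG N" "\<Phi> g \<in> middle w" "sep (g \<odot> x) w" "take (length w) (g \<odot> y) = w" by auto
    define u where "u = g1 \<odot> finv g"
    have uF: "u \<in> FG N" using g1 g by (simp add: u_def)
    have fu: "finv u \<odot> g1 \<odot> z = g \<odot> z" if "z \<in> FG N" for z
      using g g1 that by (simp add: u_def finv_of_fmul fmul_assoc finv_fmul_cancel)
    have "sep (g \<odot> x) (g \<odot> y)"
    proof -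
      have "g \<odot> y \<noteq> []" "hd (g \<odot> y) = hd w"
        using g(4) w(2) by (auto simp: hd_append dest: arg_cong[where f = hd] intro: hd_take[symmetric])
      then show ?thesis using g(3) w(2) by (auto simp: sep_def)
    qed
    then have "sep (finv u \<odot> X) (finv u \<odot> Y)" using fu xy by (simp add: X_def Y_def)
    then obtain k where k: "(k \<le> length X \<and> u = take k X) \<or> (k \<le> length Y \<and> u = take k Y)"
      using geodesic_point[of X Y u] XY uF by auto
    have "\<exists>k<length w. u = take k Y"
    proof (cases "u = []")
      case True
      then show ?thesis using w(2) by (intro exI[of _ 0]) simp
    next
      case ne: False
      have "\<not> (k \<le> length X \<and> u = take k X)"
      proof
        assume *: "k \<le> length X \<and> u = take k X"
        have "u \<odot> drop k X = X" using fmul_reduced_append[of u "drop k X"] * XY by simp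
        then have "finv X = finv (drop k X) \<odot> finv u"
          using finv_of_fmul[of u "drop k X"] uF XY by (simp add: reduced_drop)
        then have "finv X \<odot> u = finv (drop k X)"
          using uF XY by (simp add: fmul_assoc finv_fmul reduced_drop)
        moreover have "finv X \<odot> u = finv x \<odot> finv g"
          using g g1 xy by (simp add: X_def u_def finv_of_fmul fmul_assoc finv_fmul_cancel)
        ultimately have "length (finv x \<odot> finv g) = length X - k" by (metis length_drop length_finv)
        moreover have "finv X = finv x \<odot> finv g1" using g1 xy by (simp add: X_def finv_of_fmul)
        then have "length (finv x \<odot> finv g1) = length X" by (metis length_finv)
        moreover have "k > 0" "length X > 0" using ne * by auto
        ultimately show False using g1_min[OF gG] by linarith
      qed
      with k have k: "k \<le> length Y" "u = take k Y" by auto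
      have "k < length w"
      proof (rule ccontr)
        assume "\<not> k < length w"
        then have le: "length w \<le> k" by simp
        have "take (length w) u = w" using k g1(4) le by (simp add: min_def)
        then have u: "u = w @ drop (length w) u" by (metis append_take_drop_id)
        have Yk: "Y = u @ drop k Y" using k by simp
        have "u \<odot> drop k Y = Y" using fmul_reduced_append[of u "drop k Y"] k XY by simp
        then have "finv u \<odot> Y = drop k Y"
          using finv_fmul_cancel[of "drop k Y" u] XY by (simp add: reduced_drop)
        then have "g \<odot> y = drop k Y" using fu[OF xy(2)] by (simp add: Y_def)
        then have "Y = (u @ w) @ drop (length w) (drop k Y)"
          using Yk g(4) by (metis append.assoc append_take_drop_id)
        then have uw: "u @ w \<in> FG N" using XY(2) FG_appendD by metis
        have "finv (\<Phi> g1) \<odot> \<Phi> u = finv (\<Phi> g)"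
          using g g1 uF by (simp add: u_def hom \<Phi>_finv finv_fmul_cancel)
        then show False using middles_disjoint[OF w g1(2) g(2) u uw] by simp
      qed
      then show ?thesis using k by blast
    qed
    then show "g1 \<odot> finv g \<in> (\<lambda>k. take k Y) ` {..<length w}" by (auto simp: u_def)
  qed
  then have "card ((\<lambda>g. g1 \<odot> finv g) ` ?G) \<le> length w"
    using surj_card_le[of "{..<length w}"] by simp
  moreover have "inj_on (\<lambda>g. g1 \<odot> finv g) ?G"
    by (rule inj_onI) (use g1 in \<open>auto simp: fmul_left_cancel dest: arg_cong[where f = finv]\<close>)
  ultimately show ?thesis by (simp add: card_image)
next
  case True
  show ?thesis unfolding True by simp
qed

lemma card_middle_preimage:
  assumes "w \<in> FG N"
  shows "card {g \<in> FG N. \<Phi> g \<in> middle w} = card (middle w)" "finite {g \<in> FG N. \<Phi> g \<in> middle w}"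
proof -
  have "bij_betw \<Phi> {g \<in> FG N. \<Phi> g \<in> middle w} (middle w)"
    using bij surj middle_FG[OF assms] unfolding bij_betw_def
    by (auto simp: image_iff inj_on_def)
  moreover have "finite (middle w)" by (simp add: middle_def)
  ultimately show "card {g \<in> FG N. \<Phi> g \<in> middle w} = card (middle w)"
    "finite {g \<in> FG N. \<Phi> g \<in> middle w}"
    by (auto dest: bij_betw_same_card bij_betw_finite)
qed

lemma \<Phi>_power:
  assumes "v \<in> FG N" "reduced (v @ v)" "reduced (\<Phi> v @ \<Phi> v)"
  shows "\<Phi> (concat (replicate m v)) = concat (replicate m (\<Phi> v))"
proof (induction m)
  case (Suc m)
  have red: "reduced (concat (replicate m v))" "reduced (concat (replicate (Suc m) v))"
    "reduced (concat (replicate (Suc m) (\<Phi> v)))"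
    using assms(2,3) by (blast intro: reduced_concat_replicate)+
  then have "concat (replicate m v) \<in> FG N" using assms(1) by (auto simp: FG_iff)
  then have "\<Phi> (v \<odot> concat (replicate m v)) = \<Phi> v \<odot> concat (replicate m (\<Phi> v))"
    using hom assms(1) Suc by simp
  then show ?case using fmul_reduced_append red by simp
qed simp

text \<open>Each of the \<open>2 N\<close> words \<open>\<Phi> l\<close> contributes at most \<open>2\<close> to the change of the volume under conjugation by
  \<open>b\<close>, minus \<open>2\<close> if it begins with \<open>b\<close>, and minus \<open>2\<close> if it ends with \<open>b\<^sup>-\<^sup>1\<close>. As the words come in
  inverse pairs, the last two cases are equally frequent.\<close>

lemma minimal_first_letters:
  assumes min: "volume \<le> (\<Sum>l\<in>letters N. length ([inv_letter b] \<odot> \<Phi> [l] \<odot> [b]))"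
  shows "card {l \<in> letters N. hd (\<Phi> [l]) = b} \<le> N"
proof -
  let ?B = "{l \<in> letters N. hd (\<Phi> [l]) = b}" and ?E = "{l \<in> letters N. last (\<Phi> [l]) = inv_letter b}"
  have ne: "\<Phi> [l] \<noteq> []" if "l \<in> letters N" for l
    using inj[of "[l]" "[]"] that by (simp add: letter_FG)
  have finv_l: "\<Phi> [inv_letter l] = finv (\<Phi> [l])" if "l \<in> letters N" for l
    using \<Phi>_finv[of "[l]"] that by (simp add: letter_FG finv_Cons)
  have "inv_letter c = b \<longleftrightarrow> c = inv_letter b" for c by auto
  then have hd_last: "hd (\<Phi> [inv_letter l]) = b \<longleftrightarrow> last (\<Phi> [l]) = inv_letter b" if "l \<in> letters N" for l
    by (simp add: finv_l[OF that] hd_finv[OF ne[OF that]])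
  have "?E = inv_letter ` ?B"
  proof (rule Set.set_eqI)
    fix l
    show "l \<in> ?E \<longleftrightarrow> l \<in> inv_letter ` ?B"
      unfolding inv_letter_image mem_Collect_eq inv_letter_letters using hd_last by blast
  qed
  then have cE: "card ?E = card ?B" by (simp add: card_image inj_on_def)
  have "(\<Sum>l\<in>letters N. length ([inv_letter b] \<odot> \<Phi> [l] \<odot> [b]) + (if hd (\<Phi> [l]) = b then 2 else 0)
      + (if last (\<Phi> [l]) = inv_letter b then 2 else 0)) \<le> (\<Sum>l\<in>letters N. length (\<Phi> [l]) + 2)"
    using ne by (intro sum_mono hd_last_conjugate) (auto simp: letter_FG)
  moreover have "(\<Sum>l\<in>letters N. if hd (\<Phi> [l]) = b then 2 else 0) = 2 * card ?B"
    by (simp add: sum.If_cases Int_def conj_commute)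
  moreover have "(\<Sum>l\<in>letters N. if last (\<Phi> [l]) = inv_letter b then 2 else 0) = 2 * card ?E"
    by (simp add: sum.If_cases Int_def conj_commute)
  moreover have "(\<Sum>l\<in>letters N. length (\<Phi> [l]) + 2) = volume + 4 * N"
    unfolding sum.distrib volume_def by (simp add: card_letters)
  ultimately show ?thesis using min cE by (simp add: sum.distrib)
qed

text \<open>If \<open>\<Phi> l\<close> cancels with itself, then both \<open>\<Phi> l\<close> and its inverse begin with the same letter \<open>b\<close>. Since
  at most half of the images begin with \<open>b\<close>, there is a letter \<open>a\<close> such that neither \<open>\<Phi> a\<close> nor its
  inverse does, and inserting \<open>a\<close> between copies of \<open>l\<close> avoids all cancellation.\<close>

lemma noncancelling_word:
  assumes min: "\<And>b. b \<in> letters N \<Longrightarrow> volume \<le> (\<Sum>l\<in>letters N. length ([inv_letter b] \<odot> \<Phi> [l] \<odot> [b]))"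
    and l: "l \<in> letters N"
  shows "\<exists>v\<in>FG N. v \<noteq> [] \<and> length v \<le> 2 \<and> reduced (v @ v) \<and> reduced (\<Phi> v @ \<Phi> v) \<and>
    length (\<Phi> [l]) \<le> length (\<Phi> v)"
proof -
  have ne: "\<Phi> [l] \<noteq> []" if "l \<in> letters N" for l
    using inj[of "[l]" "[]"] that by (simp add: letter_FG)
  have finv_l: "\<Phi> [inv_letter l] = finv (\<Phi> [l])" if "l \<in> letters N" for l
    using \<Phi>_finv[of "[l]"] that by (simp add: letter_FG finv_Cons)
  have red: "reduced (\<Phi> [l])" if "l \<in> letters N" for l using that by (simp add: letter_FG)
  define b where "b = hd (\<Phi> [l])"
  have bl: "b \<in> letters N" 
  proof -
    have "\<Phi> [l] \<in> FG N" using l by (simp add: letter_FG)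
    then show ?thesis using hd_in_set[OF ne[OF l]] unfolding b_def FG_letters by blast
  qed
  show ?thesis
  proof (cases "hd (\<Phi> [inv_letter l]) = b")
    case False
    then have "hd (\<Phi> [l]) \<noteq> inv_letter (last (\<Phi> [l]))" using finv_l[OF l] ne[OF l] by (simp add: hd_finv b_def)
    then have "reduced (\<Phi> [l] @ \<Phi> [l])" using red[OF l] by (simp add: reduced_append)
    moreover have "reduced ([l] @ [l])" by (simp add: reduced_Cons)
    ultimately show ?thesis using l by (intro bexI[of _ "[l]"]) (auto simp: letter_FG)
  next
    case True
    let ?B = "{l \<in> letters N. hd (\<Phi> [l]) = b}"
    have "\<exists>a\<in>letters N. hd (\<Phi> [a]) \<noteq> b \<and> hd (\<Phi> [inv_letter a]) \<noteq> b"
    proof (rule ccontr)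
      assume *: "\<not> ?thesis"
      \<comment> \<open>Otherwise each pair \<open>a, a\<^sup>-\<^sup>1\<close> meets \<open>?B\<close>, and the pair of \<open>l\<close> is contained in it.\<close>
      have "letters N \<subseteq> ?B \<union> inv_letter ` ?B"
      proof
        fix a assume a: "a \<in> letters N"
        then show "a \<in> ?B \<union> inv_letter ` ?B"
          using * image_eqI[of a inv_letter "inv_letter a" ?B] by auto
      qed
      then have "2 * N \<le> card (?B \<union> inv_letter ` ?B)"
        using card_mono[of "?B \<union> inv_letter ` ?B" "letters N"] by (simp add: card_letters)
      moreover have "card (?B \<union> inv_letter ` ?B) + card (?B \<inter> inv_letter ` ?B) = card ?B + card (inv_letter ` ?B)"
        using card_Un_Int[of ?B "inv_letter ` ?B"] by simp
      moreover have "l \<in> ?B \<inter> inv_letter ` ?B"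
        using l True image_eqI[of l inv_letter "inv_letter l" ?B] by (auto simp: b_def)
      then have "?B \<inter> inv_letter ` ?B \<noteq> {}" by blast
      then have "card (?B \<inter> inv_letter ` ?B) > 0" unfolding card_gt_0_iff by simp
      moreover have "card (inv_letter ` ?B) \<le> card ?B" by (rule card_image_le) simp
      ultimately show False using minimal_first_letters[OF min[OF bl]] by linarith
    qed
    then obtain a where a: "a \<in> letters N" "hd (\<Phi> [a]) \<noteq> b" "hd (\<Phi> [inv_letter a]) \<noteq> b" by blast
    have lasta: "last (\<Phi> [a]) \<noteq> inv_letter b" using a finv_l[OF a(1)] ne[OF a(1)] by (auto simp: hd_finv)
    have lastl: "last (\<Phi> [l]) = inv_letter b" using True finv_l[OF l] ne[OF l] by (auto simp: hd_finv)
    have nal: "a \<noteq> inv_letter l" "l \<noteq> inv_letter a" using a True by auto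
    then have la: "[l, a] \<in> FG N" "reduced ([l, a] @ [l, a])"
      using l a by (auto simp: FG_letters reduced_Cons)
    have r: "reduced (\<Phi> [l] @ \<Phi> [a])" using red l a lastl by (simp add: reduced_append)
    have "[l] \<odot> [a] = [l, a]" using nal by simp
    then have \<Phi>la: "\<Phi> [l, a] = \<Phi> [l] @ \<Phi> [a]"
      using hom[of "[l]" "[a]"] l a fmul_reduced_append[OF r] by (metis letter_FG)
    have "hd (\<Phi> [l]) \<noteq> inv_letter (last (\<Phi> [a]))" using lasta by (auto simp: b_def)
    then have "reduced (\<Phi> [l, a] @ \<Phi> [l, a])"
      unfolding \<Phi>la using r ne[OF l] ne[OF a(1)] by (auto simp: reduced_append)
    then show ?thesis using la \<Phi>la by (intro bexI[of _ "[l, a]"]) auto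
  qed
qed

lemma test_word_with_long_middle:
  assumes min: "\<And>b. b \<in> letters N \<Longrightarrow> volume \<le> (\<Sum>l\<in>letters N. length ([inv_letter b] \<odot> \<Phi> [l] \<odot> [b]))"
    and N: "N > 0"
  shows "\<exists>w\<in>test_words N. volume \<le> 2 * N * card (middle w)"
proof -
  have "letters N \<noteq> {}" using N by (auto simp: letters_def)
  then have "Max ((\<lambda>k. length (\<Phi> [k])) ` letters N) \<in> (\<lambda>k. length (\<Phi> [k])) ` letters N"
    by (intro Max_in) auto
  then obtain l where l: "l \<in> letters N" and "length (\<Phi> [l]) = Max ((\<lambda>k. length (\<Phi> [k])) ` letters N)"
    by auto
  then have max: "length (\<Phi> [k]) \<le> length (\<Phi> [l])" if "k \<in> letters N" for k
    using that by simp
  define L where "L = length (\<Phi> [l])"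
  have "\<Phi> [l] \<noteq> []" using inj[of "[l]" "[]"] l by (simp add: letter_FG)
  then have L: "1 \<le> L" by (cases "\<Phi> [l]") (auto simp: L_def)
  have "volume \<le> (\<Sum>k\<in>letters N. L)" unfolding volume_def L_def by (rule sum_mono) (rule max)
  then have vol: "volume \<le> 2 * N * L" by (simp add: card_letters)
  obtain v where v: "v \<in> FG N" "v \<noteq> []" "length v \<le> 2" "reduced (v @ v)" "reduced (\<Phi> v @ \<Phi> v)" "L \<le> length (\<Phi> v)"
    using noncancelling_word[OF min l] unfolding L_def by blast
  define w where "w = concat (replicate (8 * N + 2) v)"
  have "w \<in> test_words N" using v by (auto simp: test_words_def w_def)
  moreover have "L \<le> card (middle w)"
  proof -
    have "length (\<Phi> w) = (8 * N + 2) * length (\<Phi> v)"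
      unfolding w_def \<Phi>_power[OF v(1,4,5)] by (simp only: length_concat map_replicate sum_list_replicate) simp
    moreover have "(8 * N + 2) * L \<le> (8 * N + 2) * length (\<Phi> v)" by (intro mult_le_mono2 v)
    moreover have "4 * (2 * N * L) + 2 * L = (8 * N + 2) * L" by (simp add: algebra_simps)
    ultimately have long: "4 * (2 * N * L) + 2 * L \<le> length (\<Phi> w)" by (simp only:)
    have N2: "2 * N \<le> 2 * N * L" using L by simp
    have bnd: "L \<le> W - 2 * (V + M) - 1" if "4 * X + 2 * L \<le> W" "V \<le> X" "M \<le> X" for W V X M :: nat
    proof -
      have "L + 1 + 2 * (V + M) \<le> W" using that L by simp
      then show ?thesis by simp
    qed
    show ?thesis unfolding card_middle by (rule bnd[OF long vol N2])
  qed
  then have "volume \<le> 2 * N * card (middle w)"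
    using vol by (meson le_trans mult_le_mono2)
  ultimately show ?thesis by blast
qed

end

section \<open>Boundary points as infinite words\<close>

text \<open>For elements of the free group: the Gromov product of \<open>u\<close> and \<open>v\<close> is at least \<open>k\<close>.\<close>

definition agree :: "nat \<Rightarrow> fword \<Rightarrow> fword \<Rightarrow> bool"
  where "agree k u v \<longleftrightarrow> k \<le> length u \<and> k \<le> length v \<and> take k u = take k v"

lemma agree_sym: "agree k u v \<Longrightarrow> agree k v u"
  by (simp add: agree_def)

lemma agree_trans: "agree k u v \<Longrightarrow> agree k v w \<Longrightarrow> agree k u w"
  by (simp add: agree_def)

lemma agree_mono: "agree k u v \<Longrightarrow> j \<le> k \<Longrightarrow> agree j u v"
  unfolding agree_def by (metis le_trans min.absorb1 take_take)

text \<open>The number \<open>c\<close> is the length of the longest common prefix.\<close>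

lemma length_finv_fmul:
  assumes "reduced u" "reduced v"
  obtains c where "length u + length v = length (finv u \<odot> v) + 2 * c" "\<And>k. agree k u v \<longleftrightarrow> k \<le> c"
proof -
  obtain s p q where s: "finv u = p @ finv s" "v = s @ q" "reduced (p @ q)" "finv u \<odot> v = p @ q"
    using fmul_cancellation[of "finv u" v] assms reduced_finv by metis
  then have u: "u = s @ finv p" by (metis finv_append finv_finv)
  have "agree k u v \<longleftrightarrow> k \<le> length s" for k
  proof
    show "agree k u v" if "k \<le> length s" using that u s by (simp add: agree_def)
    show "k \<le> length s" if k: "agree k u v"
    proof (rule ccontr)
      assume "\<not> ?thesis"
      then have a: "agree (Suc (length s)) u v" using agree_mono[OF k] by simp
      then have ne: "p \<noteq> []" "q \<noteq> []" using u s by (auto simp: agree_def)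
      have "take (Suc (length s)) u ! length s = take (Suc (length s)) v ! length s"
        using a by (simp add: agree_def)
      then have "hd (finv p) = hd q" using u s ne by (simp add: nth_append hd_conv_nth)
      then show False using ne s(3) by (simp add: reduced_append hd_finv)
    qed
  qed
  moreover have "length u + length v = length (finv u \<odot> v) + 2 * length s"
    unfolding s(4) using u s(2) by simp
  ultimately show ?thesis using that by blast
qed

text \<open>As the product is an integer, the first form can be used when a strict inequality is
  available only below \<open>k\<close>, as for a lower limit.\<close>

lemma gromov_prod_ge:
  assumes "u \<in> FG N" "v \<in> FG N"
  shows "(real k - 1/2 \<le> gromov_prod N u v \<longleftrightarrow> agree k u v)" "(real k \<le> gromov_prod N u v \<longleftrightarrow> agree k u v)"
proof -
  have red: "reduced u" "reduced v" using assms FG_reduced by blast+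
  obtain c where c: "length u + length v = length (finv u \<odot> v) + 2 * c" "\<And>k. agree k u v \<longleftrightarrow> k \<le> c"
    using length_finv_fmul[OF red] by blast
  have "gromov_prod N u v = (real (length u + length v) - real (length (finv u \<odot> v))) / 2"
    using assms red by (simp add: gromov_prod_def word_dist_def)
  then have "gromov_prod N u v = real c" unfolding c(1) by simp
  then show "(real k - 1/2 \<le> gromov_prod N u v \<longleftrightarrow> agree k u v)" "(real k \<le> gromov_prod N u v \<longleftrightarrow> agree k u v)"
    unfolding c(2) by linarith+
qed

lemma gromov_related_iff:
  assumes "range x \<subseteq> FG N" "range y \<subseteq> FG N"
  shows "gromov_related N x y \<longleftrightarrow> (\<forall>k. \<exists>n. \<forall>i\<ge>n. \<forall>j\<ge>n. agree k (x i) (y j))"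
proof -
  have xy: "x i \<in> FG N" "y j \<in> FG N" for i j using assms by auto
  have "gromov_related N x y \<longleftrightarrow> (\<forall>Z::real. \<exists>n. \<forall>i\<ge>n. \<forall>j\<ge>n. Z \<le> gromov_prod N (x j) (y i))"
    unfolding gromov_related_def filterlim_at_top eventually_prod_sequentially by simp
  also have "\<dots> \<longleftrightarrow> (\<forall>k. \<exists>n. \<forall>i\<ge>n. \<forall>j\<ge>n. agree k (x j) (y i))"
  proof (intro iffI allI)
    fix k assume "\<forall>Z::real. \<exists>n. \<forall>i\<ge>n. \<forall>j\<ge>n. Z \<le> gromov_prod N (x j) (y i)"
    then have "\<exists>n. \<forall>i\<ge>n. \<forall>j\<ge>n. real k \<le> gromov_prod N (x j) (y i)" by blast
    then show "\<exists>n. \<forall>i\<ge>n. \<forall>j\<ge>n. agree k (x j) (y i)"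
      unfolding gromov_prod_ge(2)[OF xy] .
  next
    fix Z :: real assume "\<forall>k. \<exists>n. \<forall>i\<ge>n. \<forall>j\<ge>n. agree k (x j) (y i)"
    then obtain n where "\<forall>i\<ge>n. \<forall>j\<ge>n. agree (nat \<lceil>Z\<rceil>) (x j) (y i)" by blast
    then have "\<forall>i\<ge>n. \<forall>j\<ge>n. real (nat \<lceil>Z\<rceil>) \<le> gromov_prod N (x j) (y i)"
      unfolding gromov_prod_ge(2)[OF xy] .
    moreover have "Z \<le> real (nat \<lceil>Z\<rceil>)" by (rule real_nat_ceiling_ge)
    ultimately show "\<exists>n. \<forall>i\<ge>n. \<forall>j\<ge>n. Z \<le> gromov_prod N (x j) (y i)" by (meson order_trans)
  qed
  finally show ?thesis by blast
qed

definition gromov_rel :: "nat \<Rightarrow> ((nat \<Rightarrow> fword) \<times> (nat \<Rightarrow> fword)) set"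
  where "gromov_rel N = {(x, y). x \<in> gromov_seqs N \<and> y \<in> gromov_seqs N \<and> gromov_related N x y}"

lemma boundary_eq: "boundary N = gromov_seqs N // gromov_rel N"
  by (simp add: boundary_def gromov_rel_def)

lemma gromov_seqs_iff:
  "x \<in> gromov_seqs N \<longleftrightarrow> range x \<subseteq> FG N \<and> (\<forall>k. \<exists>n. \<forall>i\<ge>n. \<forall>j\<ge>n. agree k (x i) (x j))"
  using gromov_related_iff[of x N x] by (auto simp: gromov_seqs_def)

lemma gromov_rel_iff:
  "(x, y) \<in> gromov_rel N \<longleftrightarrow> x \<in> gromov_seqs N \<and> y \<in> gromov_seqs N \<and>
    (\<forall>k. \<exists>n. \<forall>i\<ge>n. \<forall>j\<ge>n. agree k (x i) (y j))"
  using gromov_related_iff[of x N y] by (auto simp: gromov_seqs_def gromov_rel_def)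

lemma equiv_gromov_rel: "equiv (gromov_seqs N) (gromov_rel N)"
proof (rule equivI)
  show "gromov_rel N \<subseteq> gromov_seqs N \<times> gromov_seqs N" by (auto simp: gromov_rel_def)
  show "refl_on (gromov_seqs N) (gromov_rel N)"
    by (auto simp: refl_on_def gromov_rel_def gromov_seqs_def)
  show "sym (gromov_rel N)"
  proof (rule symI)
    fix x y assume "(x, y) \<in> gromov_rel N"
    then show "(y, x) \<in> gromov_rel N" unfolding gromov_rel_iff using agree_sym by meson
  qed
  show "trans (gromov_rel N)"
  proof (rule transI)
    fix x y z assume xy: "(x, y) \<in> gromov_rel N" and yz: "(y, z) \<in> gromov_rel N"
    have "\<exists>n. \<forall>i\<ge>n. \<forall>j\<ge>n. agree k (x i) (z j)" for k
    proof -
      obtain n m where n: "\<forall>i\<ge>n. \<forall>j\<ge>n. agree k (x i) (y j)" and m: "\<forall>i\<ge>m. \<forall>j\<ge>m. agree k (y i) (z j)"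
        using xy yz unfolding gromov_rel_iff by meson
      have "agree k (x i) (z j)" if "i \<ge> max n m" "j \<ge> max n m" for i j
        using n[rule_format, of i "max n m"] m[rule_format, of "max n m" j] that agree_trans by simp
      then show ?thesis by blast
    qed
    then show "(x, z) \<in> gromov_rel N" using xy yz by (simp add: gromov_rel_iff)
  qed
qed

lemma boundary_nonempty: "p \<in> boundary N \<Longrightarrow> \<exists>x. x \<in> p"
  unfolding boundary_eq using in_quotient_imp_non_empty[OF equiv_gromov_rel] by blast

lemma boundary_seqs: "p \<in> boundary N \<Longrightarrow> x \<in> p \<Longrightarrow> x \<in> gromov_seqs N"
  unfolding boundary_eq using in_quotient_imp_subset[OF equiv_gromov_rel] by blast

lemma boundary_seq_FG: "p \<in> boundary N \<Longrightarrow> x \<in> p \<Longrightarrow> x i \<in> FG N"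
  using boundary_seqs[of p N x] by (auto simp: gromov_seqs_def)

lemma boundary_related: "p \<in> boundary N \<Longrightarrow> x \<in> p \<Longrightarrow> y \<in> p \<longleftrightarrow> (x, y) \<in> gromov_rel N"
  unfolding boundary_eq
  using in_quotient_imp_in_rel[OF equiv_gromov_rel] in_quotient_imp_closed[OF equiv_gromov_rel] by blast

lemma boundary_class: "x \<in> gromov_seqs N \<Longrightarrow> gromov_rel N `` {x} \<in> boundary N \<and> x \<in> gromov_rel N `` {x}"
  unfolding boundary_eq using equiv_class_self[OF equiv_gromov_rel] by (blast intro: quotientI)

lemma boundary_eqI: "p \<in> boundary N \<Longrightarrow> q \<in> boundary N \<Longrightarrow> x \<in> p \<Longrightarrow> y \<in> q \<Longrightarrow> (x, y) \<in> gromov_rel N \<Longrightarrow> p = q"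
  unfolding boundary_eq using quotient_eqI[OF equiv_gromov_rel] by blast

text \<open>The first \<open>k\<close> letters of the geodesic ray from the identity to \<open>p\<close>. All sequences in the class
  \<open>p\<close> eventually begin with the same letters, so the choice is unique.\<close>

definition bpref :: "bpoint \<Rightarrow> nat \<Rightarrow> fword"
  where "bpref p k = (SOME w. \<exists>x\<in>p. \<forall>\<^sub>F i in sequentially. k \<le> length (x i) \<and> take k (x i) = w)"

lemma bpref:
  assumes p: "p \<in> boundary N" "x \<in> p"
  shows "\<forall>\<^sub>F i in sequentially. k \<le> length (x i) \<and> take k (x i) = bpref p k"
proof -
  let ?P = "\<lambda>w x. \<forall>\<^sub>F i in sequentially. k \<le> length (x i) \<and> take k (x i) = w"
  have ex: "\<exists>w. ?P w y" if "y \<in> p" for y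
  proof -
    obtain n where n: "\<forall>i\<ge>n. \<forall>j\<ge>n. agree k (y i) (y j)"
      using boundary_seqs[OF p(1) \<open>y \<in> p\<close>] unfolding gromov_seqs_iff by meson
    have "\<forall>i\<ge>n. k \<le> length (y i) \<and> take k (y i) = take k (y n)"
      using n unfolding agree_def by blast
    then show ?thesis unfolding eventually_sequentially by blast
  qed
  have uniq: "w = w'" if "?P w y" "?P w' z" "y \<in> p" "z \<in> p" for w w' y z
  proof -
    have "(y, z) \<in> gromov_rel N" using boundary_related[OF p(1) that(3)] that(4) by blast
    then obtain n where n: "\<forall>i\<ge>n. \<forall>j\<ge>n. agree k (y i) (z j)"
      unfolding gromov_rel_iff by meson
    have "\<forall>\<^sub>F i in sequentially. agree k (y i) (z i)"
      using n unfolding eventually_sequentially by blast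
    with that(1,2) have "\<forall>\<^sub>F i in sequentially. w = w'"
      by eventually_elim (simp add: agree_def)
    then show ?thesis by simp
  qed
  have "\<exists>w. \<exists>x\<in>p. ?P w x" using ex p by blast
  then have "\<exists>x\<in>p. ?P (bpref p k) x"
    unfolding bpref_def by (rule someI_ex)
  then obtain y where "y \<in> p" "?P (bpref p k) y" by blast
  moreover obtain w where "?P w x" using ex p by blast
  ultimately show ?thesis using uniq p by blast
qed

lemma bpref_witness:
  assumes "p \<in> boundary N" "q \<in> boundary N"
  obtains x y where "x \<in> FG N" "y \<in> FG N" "k \<le> length x" "take k x = bpref p k" "m \<le> length y" "take m y = bpref q m"
proof -
  obtain x y where xy: "x \<in> p" "y \<in> q" using assms boundary_nonempty by blast
  have "\<forall>\<^sub>F i in sequentially. (k \<le> length (x i) \<and> take k (x i) = bpref p k) \<and> (m \<le> length (y i) \<and> take m (y i) = bpref q m)"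
    using bpref[OF assms(1) xy(1)] bpref[OF assms(2) xy(2)] by (rule eventually_conj)
  then obtain i where "(k \<le> length (x i) \<and> take k (x i) = bpref p k) \<and> (m \<le> length (y i) \<and> take m (y i) = bpref q m)"
    by (auto simp: eventually_sequentially)
  moreover have "x i \<in> FG N" "y i \<in> FG N"
    using assms xy by (auto intro: boundary_seq_FG)
  ultimately show ?thesis using that by blast
qed

lemma bpref_FG: "p \<in> boundary N \<Longrightarrow> bpref p k \<in> FG N"
  by (rule bpref_witness[of p N p k k]) (auto dest: take_FG[of _ _ k])

lemma length_bpref: "p \<in> boundary N \<Longrightarrow> length (bpref p k) = k"
  by (rule bpref_witness[of p N p k k]) (auto dest: arg_cong[where f = length])

lemma take_bpref:
  assumes p: "p \<in> boundary N" and "j \<le> k" shows "take j (bpref p k) = bpref p j"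
proof -
  obtain x where x: "x \<in> p" using p boundary_nonempty by blast
  have "\<forall>\<^sub>F i in sequentially. take j (bpref p k) = bpref p j"
    using bpref[OF p x, of k] bpref[OF p x, of j]
  proof eventually_elim
    case (elim i)
    then show ?case using \<open>j \<le> k\<close> by (metis min.absorb1 take_take)
  qed
  then show ?thesis by simp
qed

lemma bpref_related:
  assumes p: "p \<in> boundary N" "x \<in> p" and q: "q \<in> boundary N" "y \<in> q" and eq: "bpref p k = bpref q k"
  shows "\<exists>n. \<forall>i\<ge>n. \<forall>j\<ge>n. agree k (x i) (y j)"
proof -
  obtain n m where n: "\<forall>i\<ge>n. k \<le> length (x i) \<and> take k (x i) = bpref p k"
    and m: "\<forall>i\<ge>m. k \<le> length (y i) \<and> take k (y i) = bpref q k"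
    using bpref[OF p, of k] bpref[OF q, of k] unfolding eventually_sequentially by blast
  have "\<forall>i\<ge>max n m. \<forall>j\<ge>max n m. agree k (x i) (y j)"
    using n m eq by (simp add: agree_def)
  then show ?thesis by blast
qed

lemma boundary_point_exists:
  assumes w: "\<And>k. w k \<in> FG N" "\<And>k. length (w k) = k" "\<And>k. take k (w (Suc k)) = w k"
  obtains p where "p \<in> boundary N" "\<And>k. bpref p k = w k"
proof -
  have tk: "take k (w i) = w k" if "k \<le> i" for k i
    using that
  proof (induction i rule: dec_induct)
    case base
    then show ?case using w(2) by simp
  next
    case (step i)
    have "take k (w (Suc i)) = take k (take i (w (Suc i)))" using step by (simp add: min_def)
    then show ?case using step w(3) by simp
  qed
  have "agree k (w i) (w j)" if "i \<ge> k" "j \<ge> k" for i j k using tk that w(2) by (simp add: agree_def)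
  then have "w \<in> gromov_seqs N" unfolding gromov_seqs_iff using w(1) by blast
  then have p: "gromov_rel N `` {w} \<in> boundary N" "w \<in> gromov_rel N `` {w}" using boundary_class by blast+
  have "bpref (gromov_rel N `` {w}) k = w k" for k
  proof -
    have "\<forall>\<^sub>F i in sequentially. i \<ge> k" by (rule eventually_ge_at_top)
    with bpref[OF p, of k] have "\<forall>\<^sub>F i in sequentially. bpref (gromov_rel N `` {w}) k = w k"
      by eventually_elim (simp add: tk)
    then show ?thesis by simp
  qed
  then show ?thesis using that p by blast
qed

section \<open>Cylinders\<close>

lemma boundary_nhd_eq:
  assumes p: "p \<in> boundary N"
  shows "boundary_nhd N p (real k) = {q \<in> boundary N. bpref q k = bpref p k}"
proof (intro Set.set_eqI iffI)
  fix q assume q: "q \<in> boundary_nhd N p (real k)"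
  then obtain x y where qb: "q \<in> boundary N" and xy: "x \<in> p" "y \<in> q"
    and lim: "Liminf (sequentially \<times>\<^sub>F sequentially) (\<lambda>(i, j). ereal (gromov_prod N (x i) (y j))) \<ge> ereal (real k)"
    by (auto simp: boundary_nhd_def)
  have FG: "x i \<in> FG N" "y i \<in> FG N" for i
    using p qb xy by (auto intro: boundary_seq_FG)
  have "ereal (real k - 1/2) < Liminf (sequentially \<times>\<^sub>F sequentially) (\<lambda>(i, j). ereal (gromov_prod N (x i) (y j)))"
    by (rule less_le_trans[OF _ lim]) simp
  then have "\<forall>\<^sub>F (i, j) in sequentially \<times>\<^sub>F sequentially. ereal (real k - 1/2) < ereal (gromov_prod N (x i) (y j))"
    by (auto dest: less_LiminfD simp: case_prod_unfold)
  then obtain n where n: "\<forall>i\<ge>n. \<forall>j\<ge>n. real k - 1/2 < gromov_prod N (x j) (y i)"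
    unfolding eventually_prod_sequentially by auto
  then have ag: "agree k (x i) (y i)" if "i \<ge> n" for i
    using gromov_prod_ge(1)[OF FG, of k i i] that by (simp add: less_imp_le)
  have "\<forall>\<^sub>F i in sequentially. i \<ge> n" by (rule eventually_ge_at_top)
  with bpref[OF p xy(1), of k] bpref[OF qb xy(2), of k] have "\<forall>\<^sub>F i in sequentially. bpref q k = bpref p k"
    by eventually_elim (use ag in \<open>auto simp: agree_def\<close>)
  then show "q \<in> {q \<in> boundary N. bpref q k = bpref p k}" using qb by simp
next
  fix q assume "q \<in> {q \<in> boundary N. bpref q k = bpref p k}"
  then have q: "q \<in> boundary N" and eq: "bpref p k = bpref q k" by auto
  obtain x y where xy: "x \<in> p" "y \<in> q" using p q boundary_nonempty by blast
  have FG: "x i \<in> FG N" "y i \<in> FG N" for i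
    using p q xy by (auto intro: boundary_seq_FG)
  obtain n where n: "\<forall>i\<ge>n. \<forall>j\<ge>n. agree k (x i) (y j)"
    using bpref_related[OF p xy(1) q xy(2) eq] by blast
  then have "\<forall>i\<ge>n. \<forall>j\<ge>n. real k \<le> gromov_prod N (x j) (y i)"
    unfolding gromov_prod_ge(2)[OF FG] by blast
  then have "\<forall>\<^sub>F (i, j) in sequentially \<times>\<^sub>F sequentially. ereal (real k) \<le> ereal (gromov_prod N (x i) (y j))"
    unfolding eventually_prod_sequentially by auto
  then have "Liminf (sequentially \<times>\<^sub>F sequentially) (\<lambda>(i, j). ereal (gromov_prod N (x i) (y j))) \<ge> ereal (real k)"
    by (intro Liminf_bounded) (simp add: case_prod_unfold)
  then show "q \<in> boundary_nhd N p (real k)" using q xy by (auto simp: boundary_nhd_def)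
qed

lemma openin_boundary:
  "openin (boundary_top N) U \<longleftrightarrow>
    U \<subseteq> boundary N \<and> (\<forall>p\<in>U. \<exists>k. \<forall>q\<in>boundary N. bpref q k = bpref p k \<longrightarrow> q \<in> U)"
proof -
  have "(\<exists>r. boundary_nhd N p r \<subseteq> U) \<longleftrightarrow> (\<exists>k. \<forall>q\<in>boundary N. bpref q k = bpref p k \<longrightarrow> q \<in> U)"
    if p: "p \<in> boundary N" for p
  proof
    assume "\<exists>r. boundary_nhd N p r \<subseteq> U"
    then obtain r where r: "boundary_nhd N p r \<subseteq> U" by blast
    have "ereal r \<le> ereal (real (nat \<lceil>r\<rceil>))" using real_nat_ceiling_ge by simp
    then have "boundary_nhd N p (real (nat \<lceil>r\<rceil>)) \<subseteq> boundary_nhd N p r"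
      unfolding boundary_nhd_def by (blast intro: order_trans)
    then show "\<exists>k. \<forall>q\<in>boundary N. bpref q k = bpref p k \<longrightarrow> q \<in> U"
      using r unfolding boundary_nhd_eq[OF p] by blast
  next
    assume "\<exists>k. \<forall>q\<in>boundary N. bpref q k = bpref p k \<longrightarrow> q \<in> U"
    then obtain k where "\<forall>q\<in>boundary N. bpref q k = bpref p k \<longrightarrow> q \<in> U" by blast
    then have "boundary_nhd N p (real k) \<subseteq> U" unfolding boundary_nhd_eq[OF p] by blast
    then show "\<exists>r. boundary_nhd N p r \<subseteq> U" by blast
  qed
  then show ?thesis unfolding openin_boundary_top by blast
qed

definition cyl :: "nat \<Rightarrow> fword \<Rightarrow> bpoint set"
  where "cyl N w = {p \<in> boundary N. bpref p (length w) = w}"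

lemma openin_cyl: "openin (boundary_top N) (cyl N w)"
  unfolding openin_boundary cyl_def by (auto intro!: exI[of _ "length w"])

lemma cyl_split: "cyl N w \<subseteq> (\<Union>l\<in>letters N. cyl N (w @ [l]))"
proof
  fix p assume p: "p \<in> cyl N w"
  then have pb: "p \<in> boundary N" by (simp add: cyl_def)
  let ?v = "bpref p (Suc (length w))"
  have "take (length w) ?v = w" using take_bpref[OF pb] p by (simp add: cyl_def)
  moreover have len: "length ?v = Suc (length w)" using length_bpref[OF pb] .
  ultimately have v: "?v = w @ [?v ! length w]"
    by (metis lessI order_refl take_Suc_conv_app_nth take_all)
  have "?v ! length w \<in> letters N"
    using bpref_FG[OF pb, of "Suc (length w)"] nth_mem[of "length w" ?v] len unfolding FG_letters by auto
  moreover have "p \<in> cyl N (w @ [?v ! length w])" using pb len v[symmetric] by (simp add: cyl_def)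
  ultimately show "p \<in> (\<Union>l\<in>letters N. cyl N (w @ [l]))" by blast
qed

text \<open>A cylinder that no finite subfamily covers contains such a cylinder with one more letter. The
  infinite word obtained in this way lies in some member of the cover, and this member covers one of
  the cylinders.\<close>

lemma compactin_cyl: "compactin (boundary_top N) (cyl N w)"
proof -
  have "\<exists>\<F>. finite \<F> \<and> \<F> \<subseteq> \<U> \<and> cyl N w \<subseteq> \<Union>\<F>"
    if open_cover: "\<And>U. U \<in> \<U> \<Longrightarrow> openin (boundary_top N) U" and cover: "cyl N w \<subseteq> \<Union>\<U>" for \<U>
  proof (rule ccontr)
    define bad where "bad v \<longleftrightarrow> (\<nexists>\<F>. finite \<F> \<and> \<F> \<subseteq> \<U> \<and> cyl N v \<subseteq> \<Union>\<F>)" for v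
    assume "\<not> ?thesis"
    then have bad0: "bad w" by (simp add: bad_def)
    have step: "\<exists>l. bad (v @ [l])" if "bad v" for v
    proof (rule ccontr)
      assume "\<nexists>l. bad (v @ [l])"
      then have "\<forall>l. \<exists>\<F>. finite \<F> \<and> \<F> \<subseteq> \<U> \<and> cyl N (v @ [l]) \<subseteq> \<Union>\<F>"
        unfolding bad_def by blast
      then obtain \<F> where \<F>: "\<And>l. finite (\<F> l)" "\<And>l. \<F> l \<subseteq> \<U>" "\<And>l. cyl N (v @ [l]) \<subseteq> \<Union>(\<F> l)" by metis
      have "cyl N v \<subseteq> \<Union>(\<Union>l\<in>letters N. \<F> l)" using cyl_split[of N v] \<F>(3) by blast
      moreover have "finite (\<Union>l\<in>letters N. \<F> l)" "(\<Union>l\<in>letters N. \<F> l) \<subseteq> \<U>"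
        using \<F>(1,2) finite_letters by blast+
      ultimately show False using that unfolding bad_def by blast
    qed
    define nxt where "nxt v = v @ [SOME l. bad (v @ [l])]" for v
    have nxt: "bad (nxt v)" if "bad v" for v
      unfolding nxt_def using someI_ex[OF step[OF that]] .
    define s where "s k = (nxt ^^ k) w" for k
    have bad_s: "bad (s k)" for k by (induction k) (auto simp: s_def bad0 nxt)
    have len: "length (s k) = length w + k" for k by (induction k) (auto simp: s_def nxt_def)
    have FG_s: "s k \<in> FG N" for k
    proof -
      have "cyl N (s k) \<noteq> {}"
      proof
        assume "cyl N (s k) = {}"
        then have "finite {} \<and> {} \<subseteq> \<U> \<and> cyl N (s k) \<subseteq> \<Union>{}" by simp
        then show False using bad_s[of k] unfolding bad_def by blast
      qed
      then obtain p where p: "p \<in> boundary N" "bpref p (length (s k)) = s k" by (auto simp: cyl_def)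
      show ?thesis using bpref_FG[OF p(1), of "length (s k)"] p(2) by simp
    qed
    have s_Suc: "take (length w + k) (s (Suc k)) = s k" for k
      using len[of k] by (simp add: s_def nxt_def)
    define v where "v k = take k (s k)" for k
    have "take k (v (Suc k)) = v k" for k
    proof -
      have "v (Suc k) = take (Suc k) (s (Suc k))" by (simp add: v_def)
      then have "take k (v (Suc k)) = take k (take (length w + k) (s (Suc k)))" by simp
      then show ?thesis by (simp only: s_Suc v_def)
    qed
    moreover have "length (v k) = k" for k using len[of k] by (simp add: v_def)
    moreover have "v k \<in> FG N" for k using FG_s take_FG by (simp add: v_def)
    ultimately obtain p where p: "p \<in> boundary N" "\<And>k. bpref p k = v k"
      using boundary_point_exists[of v N] by blast
    have s_v: "s k = v (length w + k)" for k
    proof -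
      have "take (length w + k) (s (k + j)) = s k" for j
      proof (induction j)
        case (Suc j)
        have "take (length w + k) (s (k + Suc j)) = take (length w + k) (take (length w + (k + j)) (s (Suc (k + j))))"
          by simp
        then show ?case using Suc s_Suc by simp
      qed (use len[of k] in simp)
      from this[of "length w"] show ?thesis by (simp add: v_def add.commute)
    qed
    have "s 0 = w" by (simp add: s_def)
    then have "p \<in> cyl N w" using p s_v[of 0] by (simp add: cyl_def)
    then obtain U where U: "U \<in> \<U>" "p \<in> U" using cover by blast
    then obtain k where k: "\<forall>q\<in>boundary N. bpref q k = bpref p k \<longrightarrow> q \<in> U"
      using open_cover[OF U(1)] unfolding openin_boundary by blast
    have "cyl N (s k) \<subseteq> U"
    proof
      fix q assume "q \<in> cyl N (s k)"
      then have q: "q \<in> boundary N" "bpref q (length w + k) = bpref p (length w + k)"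
        using len[of k] s_v[of k] p by (simp_all add: cyl_def)
      then have "bpref q k = bpref p k"
        using take_bpref[OF q(1), of k "length w + k"] take_bpref[OF p(1), of k "length w + k"] by simp
      then show "q \<in> U" using k q by blast
    qed
    then have "finite {U} \<and> {U} \<subseteq> \<U> \<and> cyl N (s k) \<subseteq> \<Union>{U}" using U by simp
    then show False using bad_s[of k] unfolding bad_def by blast
  qed
  moreover have "cyl N w \<subseteq> topspace (boundary_top N)"
    unfolding topspace_boundary_top by (auto simp: cyl_def)
  ultimately show ?thesis unfolding compactin_def by blast
qed

text \<open>The last letter of \<open>w\<close> can be repeated forever.\<close>

lemma cyl_nonempty:
  assumes w: "w \<in> FG N" "w \<noteq> []"
  shows "cyl N w \<noteq> {}"
proof -
  define v where "v k = take k (w @ replicate k (last w))" for k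
  have rep: "reduced (replicate k a)" for k a
  proof (induction k)
    case (Suc k)
    then show ?case by (cases k) (auto simp: reduced_Cons)
  qed simp
  have "v k \<in> FG N" for k
  proof -
    have "reduced (w @ replicate k (last w))"
      using w rep[of k "last w"] FG_reduced[OF w(1)] by (cases k) (auto simp: reduced_append simp del: replicate_Suc)
    moreover have "set (w @ replicate k (last w)) \<subseteq> set w" using w(2) by auto
    ultimately have "w @ replicate k (last w) \<in> FG N" using w(1) unfolding FG_iff by blast
    then show ?thesis unfolding v_def by (rule take_FG)
  qed
  moreover have "length (v k) = k" for k by (simp add: v_def)
  moreover have "take k (v (Suc k)) = v k" for k
  proof -
    have "w @ replicate (Suc k) (last w) = (w @ replicate k (last w)) @ [last w]"
      by (simp add: replicate_append_same)
    then show ?thesis by (simp add: v_def min_def)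
  qed
  ultimately obtain p where p: "p \<in> boundary N" "\<And>k. bpref p k = v k"
    using boundary_point_exists[of v N] by blast
  then have "p \<in> cyl N w" by (simp add: cyl_def v_def)
  then show ?thesis by blast
qed

lemma rectangle:
  assumes "u \<noteq> []" "v \<noteq> []" "hd u \<noteq> hd v"
  shows "openin (boundary2_top N) (cyl N u \<times> cyl N v)" "compactin (boundary2_top N) (cyl N u \<times> cyl N v)"
proof -
  have sub: "cyl N u \<times> cyl N v \<subseteq> boundary2 N"
  proof
    fix z assume "z \<in> cyl N u \<times> cyl N v"
    then obtain p q where z: "z = (p, q)" and pq: "p \<in> boundary N" "q \<in> boundary N"
      "bpref p (length u) = u" "bpref q (length v) = v" by (auto simp: cyl_def)
    have "bpref p 1 = take 1 u" "bpref q 1 = take 1 v"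
      using take_bpref[OF pq(1), of 1 "length u"] take_bpref[OF pq(2), of 1 "length v"] assms pq
      by (simp_all add: Suc_le_eq)
    moreover have "take 1 u \<noteq> take 1 v" using assms by (cases u; cases v) auto
    ultimately show "z \<in> boundary2 N" using z pq by (auto simp: boundary2_def)
  qed
  then show "openin (boundary2_top N) (cyl N u \<times> cyl N v)"
    unfolding boundary2_top_def using openin_cyl
    by (auto simp: openin_subtopology openin_prod_Times_iff intro!: exI[of _ "cyl N u \<times> cyl N v"])
  show "compactin (boundary2_top N) (cyl N u \<times> cyl N v)"
    unfolding boundary2_top_def compactin_subtopology using sub
    by (simp add: compactin_Times compactin_cyl)
qed

text \<open>The pairs whose geodesic passes through the identity, and those whose geodesic passes first
  through the identity and then through \<open>w\<close>.\<close>

definition through_id :: "nat \<Rightarrow> (bpoint \<times> bpoint) set"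
  where "through_id N = {(p, q). p \<in> boundary N \<and> q \<in> boundary N \<and> bpref p 1 \<noteq> bpref q 1}"

definition through_word :: "nat \<Rightarrow> fword \<Rightarrow> (bpoint \<times> bpoint) set"
  where "through_word N w = {(p, q). p \<in> boundary N \<and> q \<in> cyl N w \<and> bpref p 1 \<noteq> take 1 w}"

lemma bpref_1: "p \<in> boundary N \<Longrightarrow> \<exists>l\<in>letters N. bpref p 1 = [l]"
  using length_bpref[of p N 1] bpref_FG[of p N 1]
  by (cases "bpref p 1") (auto simp: letter_FG)

lemma cyl_letter: "p \<in> cyl N [l] \<longleftrightarrow> p \<in> boundary N \<and> bpref p 1 = [l]"
  by (simp add: cyl_def)

lemma through_id_eq:
  "through_id N = (\<Union>(a, b)\<in>{(a, b) \<in> letters N \<times> letters N. a \<noteq> b}. cyl N [a] \<times> cyl N [b])"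
proof (intro subset_antisym subsetI)
  fix z assume "z \<in> through_id N"
  then obtain p q where z: "z = (p, q)" "p \<in> boundary N" "q \<in> boundary N" "bpref p 1 \<noteq> bpref q 1"
    by (auto simp: through_id_def)
  then obtain a b where "a \<in> letters N" "b \<in> letters N" "bpref p 1 = [a]" "bpref q 1 = [b]"
    using bpref_1 by meson
  then have "(a, b) \<in> {(a, b) \<in> letters N \<times> letters N. a \<noteq> b}" "z \<in> cyl N [a] \<times> cyl N [b]"
    using z by (simp_all add: cyl_letter)
  then show "z \<in> (\<Union>(a, b)\<in>{(a, b) \<in> letters N \<times> letters N. a \<noteq> b}. cyl N [a] \<times> cyl N [b])" by blast
qed (auto simp: through_id_def cyl_letter)

lemma through_word_eq:
  assumes "w \<noteq> []"
  shows "through_word N w = (\<Union>a\<in>{a \<in> letters N. a \<noteq> hd w}. cyl N [a] \<times> cyl N w)"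
proof -
  have w: "take 1 w = [hd w]" using assms by (cases w) auto
  show ?thesis
  proof (intro subset_antisym subsetI)
    fix z assume "z \<in> through_word N w"
    then obtain p q where z: "z = (p, q)" "p \<in> boundary N" "q \<in> cyl N w" "bpref p 1 \<noteq> take 1 w"
      by (auto simp: through_word_def)
    then obtain a where "a \<in> letters N" "bpref p 1 = [a]" using bpref_1 by meson
    then have "a \<in> {a \<in> letters N. a \<noteq> hd w}" "z \<in> cyl N [a] \<times> cyl N w"
      using z w by (simp_all add: cyl_letter)
    then show "z \<in> (\<Union>a\<in>{a \<in> letters N. a \<noteq> hd w}. cyl N [a] \<times> cyl N w)" by blast
  qed (use w in \<open>auto simp: through_word_def cyl_letter\<close>)
qed

lemma through_id_top:
  "openin (boundary2_top N) (through_id N)" "compactin (boundary2_top N) (through_id N)"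
proof -
  have "finite {(a, b) \<in> letters N \<times> letters N. a \<noteq> b}"
    by (rule finite_subset[of _ "letters N \<times> letters N"]) auto
  then show "openin (boundary2_top N) (through_id N)" "compactin (boundary2_top N) (through_id N)"
    unfolding through_id_eq by (auto intro!: openin_Union compactin_Union rectangle)
qed

lemma through_word_top:
  assumes "w \<noteq> []"
  shows "openin (boundary2_top N) (through_word N w)" "compactin (boundary2_top N) (through_word N w)"
  unfolding through_word_eq[OF assms] using assms
  by (auto intro!: openin_Union compactin_Union rectangle)

lemma through_word_nonempty:
  assumes w: "w \<in> FG N" "w \<noteq> []"
  shows "through_word N w \<noteq> {}"
proof -
  have "hd w \<in> letters N" using w hd_in_set unfolding FG_letters by blast
  then have l: "inv_letter (hd w) \<in> letters N" by simp
  then have "cyl N [inv_letter (hd w)] \<noteq> {}" using cyl_nonempty by (simp add: letter_FG)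
  moreover have "cyl N w \<noteq> {}" using cyl_nonempty w by blast
  ultimately show ?thesis unfolding through_word_eq[OF w(2)] using l by fastforce
qed

section \<open>Maps of the boundary\<close>

text \<open>Outside a finite set of \<open>t\<close> both \<open>f t\<close> and \<open>f (t l)\<close> are further than \<open>k + L\<close> from the identity and
  at distance at most \<open>L\<close> from each other, hence agree in \<open>k\<close> letters. Two words with a long common
  prefix are connected by a path that avoids the finite set.\<close>

lemma lipschitz_agree:
  assumes f: "\<And>t. t \<in> FG N \<Longrightarrow> f t \<in> FG N" and inj: "inj_on f (FG N)"
    and lip: "\<And>t l. t \<in> FG N \<Longrightarrow> [l] \<in> FG N \<Longrightarrow> length (finv (f t) \<odot> f (t \<odot> [l])) \<le> L"
  shows "\<exists>m. \<forall>x\<in>FG N. \<forall>y\<in>FG N. agree m x y \<longrightarrow> agree k (f x) (f y)"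
proof -
  define B where "B = {t \<in> FG N. length (f t) \<le> k + L}"
  have "finite (f ` B)"
    by (rule finite_subset[OF _ finite_FG_bounded[of N "k + L"]]) (auto simp: B_def f)
  moreover have "inj_on f B" using inj by (rule inj_on_subset) (auto simp: B_def)
  ultimately have "finite B" by (rule finite_imageD)
  then obtain M where M: "\<And>t. t \<in> B \<Longrightarrow> length t \<le> M"
    using Max_ge[of "length ` B"] by (metis finite_imageI imageI)
  have near: "agree k (f t) (f (t \<odot> [l]))"
    if "t \<in> FG N" "[l] \<in> FG N" "t \<notin> B" "t \<odot> [l] \<notin> B" for t l
  proof -
    have red: "reduced (f t)" "reduced (f (t \<odot> [l]))" using that f FG_reduced[of _ N] by simp_all
    obtain c where "length (f t) + length (f (t \<odot> [l])) = length (finv (f t) \<odot> f (t \<odot> [l])) + 2 * c"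
      "\<And>k. agree k (f t) (f (t \<odot> [l])) \<longleftrightarrow> k \<le> c"
      using length_finv_fmul[OF red] by blast
    moreover have "length (f t) > k + L" "length (f (t \<odot> [l])) > k + L" using that by (auto simp: B_def)
    ultimately show ?thesis using lip[OF that(1,2)] by simp
  qed
  have far: "agree k (f (take (Suc M) x)) (f x)" if x: "x \<in> FG N" and len: "Suc M \<le> length x" for x
  proof -
    have "agree k (f (take (Suc M) x)) (f (take i x))" if "Suc M \<le> i" "i \<le> length x" for i
      using that
    proof (induction i rule: dec_induct)
      case base
      have "take (Suc M) x \<notin> B" using M[of "take (Suc M) x"] len by auto
      then show ?case using take_FG[OF x, of "Suc M"] by (auto simp: agree_def B_def)
    next
      case (step i)
      have t: "take i x \<in> FG N" "take (Suc i) x \<in> FG N" using x take_FG by blast+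
      have e: "take (Suc i) x = take i x @ [x ! i]" using step by (simp add: take_Suc_conv_app_nth)
      have l: "[x ! i] \<in> FG N" using t(2) unfolding e by (auto dest: FG_appendD)
      have m: "take i x \<odot> [x ! i] = take (Suc i) x"
        using fmul_reduced_append[of "take i x" "[x ! i]"] t(2) FG_reduced unfolding e by blast
      have "take i x \<notin> B" "take (Suc i) x \<notin> B"
        using M[of "take i x"] M[of "take (Suc i) x"] step by auto
      then have "agree k (f (take i x)) (f (take (Suc i) x))"
        using near[OF t(1) l] m by simp
      then show ?case using step agree_trans by simp
    qed
    from this[of "length x"] show ?thesis using len by simp
  qed
  have "agree k (f x) (f y)" if "x \<in> FG N" "y \<in> FG N" "agree (Suc M) x y" for x y
    using far[OF that(1)] far[OF that(2)] that(3) agree_sym agree_trans unfolding agree_def[of "Suc M"] by metis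
  then show ?thesis by blast
qed

text \<open>The last two assumptions say that both maps are uniformly continuous near the boundary; this is
  what the extension to the boundary requires.\<close>

locale boundary_iso =
  fixes N :: nat and f f' :: "fword \<Rightarrow> fword"
  assumes f_FG: "t \<in> FG N \<Longrightarrow> f t \<in> FG N" and f'_FG: "t \<in> FG N \<Longrightarrow> f' t \<in> FG N"
    and f'_f: "t \<in> FG N \<Longrightarrow> f' (f t) = t" and f_f': "t \<in> FG N \<Longrightarrow> f (f' t) = t"
    and f_agree: "\<exists>m. \<forall>x\<in>FG N. \<forall>y\<in>FG N. agree m x y \<longrightarrow> agree k (f x) (f y)"
    and f'_agree: "\<exists>m. \<forall>x\<in>FG N. \<forall>y\<in>FG N. agree m x y \<longrightarrow> agree k (f' x) (f' y)"
begin

lemma seqs: "x \<in> gromov_seqs N \<Longrightarrow> f \<circ> x \<in> gromov_seqs N"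
proof -
  assume x: "x \<in> gromov_seqs N"
  then have FG: "x i \<in> FG N" for i by (auto simp: gromov_seqs_def)
  have "\<exists>n. \<forall>i\<ge>n. \<forall>j\<ge>n. agree k (f (x i)) (f (x j))" for k
  proof -
    obtain m where m: "\<forall>x\<in>FG N. \<forall>y\<in>FG N. agree m x y \<longrightarrow> agree k (f x) (f y)" using f_agree by blast
    obtain n where "\<forall>i\<ge>n. \<forall>j\<ge>n. agree m (x i) (x j)" using x unfolding gromov_seqs_iff by meson
    then show ?thesis using m FG by blast
  qed
  then show ?thesis using FG f_FG unfolding gromov_seqs_iff by auto
qed

lemma rel: "(x, y) \<in> gromov_rel N \<Longrightarrow> (f \<circ> x, f \<circ> y) \<in> gromov_rel N"
proof -
  assume xy: "(x, y) \<in> gromov_rel N"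
  then have FG: "x i \<in> FG N" "y i \<in> FG N" for i by (auto simp: gromov_seqs_def gromov_rel_def)
  have "\<exists>n. \<forall>i\<ge>n. \<forall>j\<ge>n. agree k (f (x i)) (f (y j))" for k
  proof -
    obtain m where m: "\<forall>x\<in>FG N. \<forall>y\<in>FG N. agree m x y \<longrightarrow> agree k (f x) (f y)" using f_agree by blast
    obtain n where "\<forall>i\<ge>n. \<forall>j\<ge>n. agree m (x i) (y j)" using xy unfolding gromov_rel_iff by meson
    then show ?thesis using m FG by blast
  qed
  then show ?thesis using xy seqs unfolding gromov_rel_iff by auto
qed

lemma inverse: "boundary_iso N f' f"
  by unfold_locales (auto simp: f_FG f'_FG f_f' f'_f f_agree f'_agree)

lemma boundary_map_in:
  assumes p: "p \<in> boundary N"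
  shows "boundary_map f p \<in> boundary N"
proof -
  obtain x where x: "x \<in> p" using p boundary_nonempty by blast
  have xs: "x \<in> gromov_seqs N" using boundary_seqs p x by blast
  have "boundary_map f p = gromov_rel N `` {f \<circ> x}"
  proof (intro Set.set_eqI iffI)
    fix z assume "z \<in> boundary_map f p"
    then obtain y where y: "y \<in> p" "z = f \<circ> y" by (auto simp: boundary_map_def)
    then show "z \<in> gromov_rel N `` {f \<circ> x}" using boundary_related[OF p x] rel by auto
  next
    fix z assume z: "z \<in> gromov_rel N `` {f \<circ> x}"
    then have zr: "(f \<circ> x, z) \<in> gromov_rel N" by simp
    then have zF: "z i \<in> FG N" for i by (auto simp: gromov_seqs_def gromov_rel_def)
    have xF: "x i \<in> FG N" for i using xs by (auto simp: gromov_seqs_def)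
    have "(f' \<circ> (f \<circ> x), f' \<circ> z) \<in> gromov_rel N" using boundary_iso.rel[OF inverse zr] .
    moreover have "f' \<circ> (f \<circ> x) = x" using xF f'_f by auto
    ultimately have "f' \<circ> z \<in> p" using boundary_related[OF p x] by simp
    moreover have "z = f \<circ> (f' \<circ> z)" using zF f_f' by auto
    ultimately show "z \<in> boundary_map f p" by (auto simp: boundary_map_def)
  qed
  then show ?thesis using boundary_class seqs[OF xs] by simp
qed

lemma boundary_map_inverse:
  assumes p: "p \<in> boundary N"
  shows "boundary_map f' (boundary_map f p) = p"
proof -
  have "f' \<circ> (f \<circ> x) = x" if "x \<in> p" for x
    using boundary_seq_FG[OF p that] f'_f by auto
  then show ?thesis by (force simp: boundary_map_def image_image)
qed

lemma bpref_boundary_map: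
  "\<exists>m. \<forall>p\<in>boundary N. \<forall>q\<in>boundary N. bpref p m = bpref q m \<longrightarrow>
    bpref (boundary_map f p) k = bpref (boundary_map f q) k"
proof -
  obtain m where m: "\<forall>x\<in>FG N. \<forall>y\<in>FG N. agree m x y \<longrightarrow> agree k (f x) (f y)" using f_agree by blast
  have "bpref (boundary_map f p) k = bpref (boundary_map f q) k"
    if p: "p \<in> boundary N" and q: "q \<in> boundary N" and eq: "bpref p m = bpref q m" for p q
  proof -
    obtain x y where xy: "x \<in> p" "y \<in> q" using p q boundary_nonempty by blast
    have FG: "x i \<in> FG N" "y i \<in> FG N" for i
      using p q xy by (auto intro: boundary_seq_FG)
    have fx: "f \<circ> x \<in> boundary_map f p" and fy: "f \<circ> y \<in> boundary_map f q"
      using xy by (auto simp: boundary_map_def)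
    have "\<forall>\<^sub>F i in sequentially. bpref (boundary_map f p) k = bpref (boundary_map f q) k"
      using bpref[OF p xy(1), of m] bpref[OF q xy(2), of m]
        bpref[OF boundary_map_in[OF p] fx, of k] bpref[OF boundary_map_in[OF q] fy, of k]
    proof eventually_elim
      case (elim i)
      then have "agree m (x i) (y i)" using eq by (simp add: agree_def)
      then have "agree k (f (x i)) (f (y i))" using m FG by blast
      then show ?case using elim by (simp add: agree_def)
    qed
    then show ?thesis by simp
  qed
  then show ?thesis by blast
qed

lemma continuous_boundary_map: "continuous_map (boundary_top N) (boundary_top N) (boundary_map f)"
  unfolding continuous_map_def topspace_boundary_top
proof (intro conjI allI impI)
  show "boundary_map f \<in> boundary N \<rightarrow> boundary N" using boundary_map_in by auto
  fix U assume U: "openin (boundary_top N) U"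
  show "openin (boundary_top N) {p \<in> boundary N. boundary_map f p \<in> U}"
    unfolding openin_boundary
  proof (intro conjI ballI)
    fix p assume "p \<in> {p \<in> boundary N. boundary_map f p \<in> U}"
    then have p: "p \<in> boundary N" "boundary_map f p \<in> U" by auto
    obtain k where k: "\<forall>q\<in>boundary N. bpref q k = bpref (boundary_map f p) k \<longrightarrow> q \<in> U"
      using U p(2) unfolding openin_boundary by blast
    obtain m where "\<forall>p\<in>boundary N. \<forall>q\<in>boundary N. bpref p m = bpref q m \<longrightarrow>
      bpref (boundary_map f p) k = bpref (boundary_map f q) k" using bpref_boundary_map by blast
    then have "\<forall>q\<in>boundary N. bpref q m = bpref p m \<longrightarrow> boundary_map f q \<in> U"
      using k p(1) boundary_map_in by blast
    then show "\<exists>k. \<forall>q\<in>boundary N. bpref q k = bpref p k \<longrightarrow> q \<in> {p \<in> boundary N. boundary_map f p \<in> U}"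
      by blast
  qed auto
qed

lemma boundary2_map_in:
  assumes "z \<in> boundary2 N"
  shows "boundary2_map f z \<in> boundary2 N"
proof -
  obtain p q where z: "z = (p, q)" and pq: "p \<in> boundary N" "q \<in> boundary N" "p \<noteq> q"
    using assms by (auto simp: boundary2_def)
  have "boundary_map f p \<noteq> boundary_map f q"
  proof
    assume "boundary_map f p = boundary_map f q"
    then have "boundary_map f' (boundary_map f p) = boundary_map f' (boundary_map f q)" by (rule arg_cong)
    then show False using pq by (simp only: boundary_map_inverse)
  qed
  then show ?thesis using z boundary_map_in pq by (simp add: boundary2_def boundary2_map_def)
qed

lemma continuous_boundary2_map: "continuous_map (boundary2_top N) (boundary2_top N) (boundary2_map f)"
proof -
  have "continuous_map (boundary2_top N) (boundary_top N) fst"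
    unfolding boundary2_top_def by (rule continuous_map_from_subtopology[OF continuous_map_fst])
  from continuous_map_compose[OF this continuous_boundary_map]
  have fst: "continuous_map (boundary2_top N) (boundary_top N) (\<lambda>z. boundary_map f (fst z))"
    by (simp add: comp_def)
  have "continuous_map (boundary2_top N) (boundary_top N) snd"
    unfolding boundary2_top_def by (rule continuous_map_from_subtopology[OF continuous_map_snd])
  from continuous_map_compose[OF this continuous_boundary_map]
  have snd: "continuous_map (boundary2_top N) (boundary_top N) (\<lambda>z. boundary_map f (snd z))"
    by (simp add: comp_def)
  have "continuous_map (boundary2_top N) (prod_topology (boundary_top N) (boundary_top N)) (boundary2_map f)"
    using continuous_map_pairedI[OF fst snd] by (simp add: boundary2_map_def map_prod_def case_prod_unfold)
  moreover have "topspace (boundary2_top N) = boundary2 N"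
    by (auto simp: boundary2_top_def topspace_boundary_top boundary2_def)
  ultimately show ?thesis
    using boundary2_map_in by (subst (2) boundary2_top_def) (auto simp: continuous_map_in_subtopology)
qed

end

lemma boundary_isoI:
  assumes f: "\<And>t. t \<in> FG N \<Longrightarrow> f t \<in> FG N" "\<And>t. t \<in> FG N \<Longrightarrow> f' t \<in> FG N"
    and inv: "\<And>t. t \<in> FG N \<Longrightarrow> f' (f t) = t" "\<And>t. t \<in> FG N \<Longrightarrow> f (f' t) = t"
    and lip: "\<And>t l. t \<in> FG N \<Longrightarrow> [l] \<in> FG N \<Longrightarrow> length (finv (f t) \<odot> f (t \<odot> [l])) \<le> L"
    and lip': "\<And>t l. t \<in> FG N \<Longrightarrow> [l] \<in> FG N \<Longrightarrow> length (finv (f' t) \<odot> f' (t \<odot> [l])) \<le> L'"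
  shows "boundary_iso N f f'"
proof
  have "inj_on f (FG N)" "inj_on f' (FG N)" using inv by (metis inj_onI)+
  then show "\<exists>m. \<forall>x\<in>FG N. \<forall>y\<in>FG N. agree m x y \<longrightarrow> agree k (f x) (f y)"
    "\<exists>m. \<forall>x\<in>FG N. \<forall>y\<in>FG N. agree m x y \<longrightarrow> agree k (f' x) (f' y)" for k
    using lipschitz_agree[OF f(1) _ lip] lipschitz_agree[OF f(2) _ lip'] by blast+
qed (fact f inv)+

lemma boundary_iso_left:
  assumes g: "g \<in> FG N"
  shows "boundary_iso N ((\<odot>) g) ((\<odot>) (finv g))"
proof -
  have lip: "length (finv (h \<odot> t) \<odot> h \<odot> t \<odot> [l]) \<le> 1" if "h \<in> FG N" "t \<in> FG N" "[l] \<in> FG N" for h t l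
  proof -
    have "reduced h" "reduced t" "reduced [l]" using that FG_reduced by blast+
    then show ?thesis by (simp add: finv_of_fmul fmul_assoc finv_fmul_cancel del: foldr.simps)
  qed
  have red: "t \<in> FG N \<Longrightarrow> reduced t" for t by (rule FG_reduced)
  show ?thesis
    by (rule boundary_isoI[where L = 1 and L' = 1]) (use g lip red in \<open>auto simp: finv_fmul_cancel fmul_finv_cancel simp del: foldr.simps\<close>)
qed

lemma boundary_iso_right:
  assumes g: "g \<in> FG N"
  shows "boundary_iso N (\<lambda>x. x \<odot> g) (\<lambda>x. x \<odot> finv g)"
proof -
  have red: "t \<in> FG N \<Longrightarrow> reduced t" for t by (rule FG_reduced)
  have lip: "length (finv (t \<odot> h) \<odot> (t \<odot> [l]) \<odot> h) \<le> length h + (1 + length h)"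
    if h: "h \<in> FG N" and t: "t \<in> FG N" and l: "[l] \<in> FG N" for h t l
  proof -
    have "finv (t \<odot> h) \<odot> (t \<odot> [l]) \<odot> h = finv h \<odot> [l] \<odot> h"
      using red[OF h] red[OF t] red[OF l]
      by (simp add: finv_of_fmul fmul_assoc finv_fmul_cancel del: foldr.simps)
    moreover have "length (finv h \<odot> [l] \<odot> h) \<le> length (finv h) + length ([l] \<odot> h)"
      using red[OF h] by (intro length_fmul_le reduced_fmul) simp_all
    moreover have "length ([l] \<odot> h) \<le> length [l] + length h"
      using red[OF h] red[OF l] by (intro length_fmul_le)
    ultimately show ?thesis by (simp del: foldr.simps)
  qed
  show ?thesis
    by (rule boundary_isoI[where L = "length g + (1 + length g)" and L' = "length g + (1 + length g)"])
      (use g lip[of g] lip[of "finv g"] red in \<open>auto simp: fmul_assoc finv_fmul fmul_finv simp del: foldr.simps\<close>)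
qed

lemma agree_fmul_right:
  assumes "reduced v" "reduced e" "agree (k + length e) u v"
  shows "agree k u (v \<odot> e)"
proof -
  obtain s v' e' where s: "v = v' @ finv s" "e = s @ e'" "reduced (v' @ e')" "v \<odot> e = v' @ e'"
    using fmul_cancellation[OF assms(1,2)] by metis
  have "k \<le> length v'" using assms(3) s by (auto simp: agree_def)
  moreover have "agree k u v" using agree_mono[OF assms(3)] by simp
  ultimately show ?thesis unfolding s(4) using s(1) by (simp add: agree_def)
qed

text \<open>Right translations move points by a bounded distance, hence fix the boundary pointwise.\<close>

lemma boundary_map_right:
  assumes g: "g \<in> FG N" and p: "p \<in> boundary N"
  shows "boundary_map (\<lambda>x. x \<odot> g) p = p"
proof -
  interpret boundary_iso N "\<lambda>x. x \<odot> g" "\<lambda>x. x \<odot> finv g" by (rule boundary_iso_right[OF g])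
  obtain x where x: "x \<in> p" using boundary_nonempty[OF p] by blast
  let ?y = "(\<lambda>x. x \<odot> g) \<circ> x"
  have xs: "x \<in> gromov_seqs N" by (rule boundary_seqs[OF p x])
  have "\<exists>n. \<forall>i\<ge>n. \<forall>j\<ge>n. agree k (x i) (?y j)" for k
  proof -
    obtain n where n: "\<forall>i\<ge>n. \<forall>j\<ge>n. agree (k + length g) (x i) (x j)"
      using xs unfolding gromov_seqs_iff by meson
    have "agree k (x i) (?y j)" if "i \<ge> n" "j \<ge> n" for i j
      using agree_fmul_right[of "x j" g k "x i"] n that boundary_seq_FG[OF p x, of j] g FG_reduced by auto
    then show ?thesis by blast
  qed
  then have "(x, ?y) \<in> gromov_rel N" using xs seqs[OF xs] by (simp add: gromov_rel_iff)
  moreover have "?y \<in> boundary_map (\<lambda>x. x \<odot> g) p" using x unfolding boundary_map_def by (rule imageI)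
  ultimately have "p = boundary_map (\<lambda>x. x \<odot> g) p" by (intro boundary_eqI[OF p boundary_map_in[OF p] x])
  then show ?thesis by (rule sym)
qed

lemma (in free_auto) free_auto_inv: "free_auto N (inv_into (FG N) \<Phi>)"
proof
  show "bij_betw (inv_into (FG N) \<Phi>) (FG N) (FG N)" using bij by (rule bij_betw_inv_into)
  fix u v assume uv: "u \<in> FG N" "v \<in> FG N"
  have inv: "inv_into (FG N) \<Phi> t \<in> FG N" "\<Phi> (inv_into (FG N) \<Phi> t) = t" if "t \<in> FG N" for t
    using bij that by (auto simp: bij_betw_def intro: inv_into_into f_inv_into_f)
  have "\<Phi> (inv_into (FG N) \<Phi> u \<odot> inv_into (FG N) \<Phi> v) = u \<odot> v"
    using uv inv by (simp add: hom)
  then show "inv_into (FG N) \<Phi> (u \<odot> v) = inv_into (FG N) \<Phi> u \<odot> inv_into (FG N) \<Phi> v"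
    using inv uv inj[of "inv_into (FG N) \<Phi> (u \<odot> v)" "inv_into (FG N) \<Phi> u \<odot> inv_into (FG N) \<Phi> v"] by simp
qed

lemma (in free_auto) boundary_iso_auto: "boundary_iso N \<Phi> (inv_into (FG N) \<Phi>)"
proof -
  have inv: "inv_into (FG N) \<Phi> t \<in> FG N" "\<Phi> (inv_into (FG N) \<Phi> t) = t" if "t \<in> FG N" for t
    using bij that by (auto simp: bij_betw_def intro: inv_into_into f_inv_into_f)
  have lip: "length (finv (\<Psi> t) \<odot> \<Psi> (t \<odot> [l])) \<le> (\<Sum>l\<in>letters N. length (\<Psi> [l]))"
    if "free_auto N \<Psi>" and t: "t \<in> FG N" "[l] \<in> FG N" for \<Psi> t l
  proof -
    interpret \<Psi>: free_auto N \<Psi> by fact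
    have "finv (\<Psi> t) \<odot> \<Psi> (t \<odot> [l]) = \<Psi> [l]" using t by (simp add: \<Psi>.hom finv_fmul_cancel del: foldr.simps)
    then show ?thesis
      using member_le_sum[of l "letters N" "\<lambda>l. length (\<Psi> [l])"] t by (simp add: letter_FG del: foldr.simps)
  qed
  show ?thesis
    by (rule boundary_isoI[OF _ _ _ _ lip lip]) (use inv free_auto_inv free_auto_axioms bij in \<open>auto simp: bij_betw_def inv_into_f_f\<close>)
qed

section \<open>Currents\<close>

lemma topspace_boundary2_top [simp]: "topspace (boundary2_top N) = boundary2 N"
  by (auto simp: boundary2_top_def topspace_boundary_top boundary2_def)

lemma borel_of_open: "openin X U \<Longrightarrow> U \<in> sets (borel_of X)" and space_borel_of [simp]: "space (borel_of X) = topspace X"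
proof -
  have "{U. openin X U} \<subseteq> Pow (topspace X)" by (auto dest: openin_subset)
  then show "openin X U \<Longrightarrow> U \<in> sets (borel_of X)" "space (borel_of X) = topspace X"
    by (auto simp: borel_of_def sets_measure_of space_measure_of)
qed

lemma measurable_borel_of:
  assumes "continuous_map X Y f"
  shows "f \<in> measurable (borel_of X) (borel_of Y)"
  unfolding borel_of_def[of Y]
proof (rule measurable_measure_of)
  show "{U. openin Y U} \<subseteq> Pow (topspace Y)" by (auto dest: openin_subset)
  show "f \<in> space (borel_of X) \<rightarrow> topspace Y" using assms by (auto simp: continuous_map_def)
  fix U assume "U \<in> {U. openin Y U}"
  then have "openin X {x \<in> topspace X. f x \<in> U}" using assms by (auto simp: continuous_map_def)
  then show "f -` U \<inter> space (borel_of X) \<in> sets (borel_of X)"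
    using borel_of_open[of X] by (simp add: vimage_def Int_def conj_commute)
qed

lemma CurrD:
  assumes "\<mu> \<in> Curr N"
  shows "space \<mu> = boundary2 N" "sets \<mu> = sets (borel_of (boundary2_top N))"
    "compactin (boundary2_top N) C \<Longrightarrow> emeasure \<mu> C < \<infinity>"
    "g \<in> FG N \<Longrightarrow> push N (boundary2_map ((\<odot>) g)) \<mu> = \<mu>"
  using assms by (auto simp: Curr_def radon_measure_def)

lemma (in boundary_iso) emeasure_push:
  assumes "sets \<mu> = sets (borel_of (boundary2_top N))" "S \<in> sets (borel_of (boundary2_top N))"
  shows "emeasure (push N (boundary2_map f) \<mu>) S = emeasure \<mu> (boundary2_map f -` S \<inter> boundary2 N)"
    "boundary2_map f -` S \<inter> boundary2 N \<in> sets (borel_of (boundary2_top N))"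
proof -
  have sp: "space \<mu> = boundary2 N" using sets_eq_imp_space_eq[OF assms(1)] by simp
  have m: "boundary2_map f \<in> measurable \<mu> (borel_of (boundary2_top N))"
    using measurable_borel_of[OF continuous_boundary2_map] measurable_cong_sets[OF assms(1) refl] by blast
  show "emeasure (push N (boundary2_map f) \<mu>) S = emeasure \<mu> (boundary2_map f -` S \<inter> boundary2 N)"
    unfolding push_def using emeasure_distr[OF m assms(2)] sp by simp
  show "boundary2_map f -` S \<inter> boundary2 N \<in> sets (borel_of (boundary2_top N))"
    using measurable_sets[OF m assms(2)] sp assms(1) by simp
qed

lemma Curr_translate:
  assumes "\<mu> \<in> Curr N" "g \<in> FG N" "S \<in> sets (borel_of (boundary2_top N))"
  shows "emeasure \<mu> (boundary2_map ((\<odot>) g) -` S \<inter> boundary2 N) = emeasure \<mu> S"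
  using boundary_iso.emeasure_push(1)[OF boundary_iso_left[OF assms(2)] CurrD(2)[OF assms(1)] assms(3)]
    CurrD(4)[OF assms(1,2)] by simp

lemma through_id_sets [simp]: "through_id N \<in> sets (borel_of (boundary2_top N))"
  by (rule borel_of_open[OF through_id_top(1)])

lemma through_word_sets [simp]: "w \<noteq> [] \<Longrightarrow> through_word N w \<in> sets (borel_of (boundary2_top N))"
  by (rule borel_of_open[OF through_word_top(1)])

lemma sep_take_1: "sep u v \<Longrightarrow> 1 \<le> length u \<Longrightarrow> 1 \<le> length v \<Longrightarrow> take 1 u \<noteq> take 1 v"
  by (cases u; cases v) (auto simp: sep_def)

context free_auto
begin

interpretation \<Phi>: boundary_iso N \<Phi> "inv_into (FG N) \<Phi>" by (rule boundary_iso_auto)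

abbreviation translate_set :: "fword \<Rightarrow> fword \<Rightarrow> (bpoint \<times> bpoint) set"
  where "translate_set w g \<equiv> boundary2_map ((\<odot>) g) -` through_word N w \<inter> boundary2 N"

lemma translate_set_eventually:
  assumes g: "g \<in> FG N" and w: "w \<noteq> []" and pq: "p \<in> boundary N" "q \<in> boundary N"
    and z: "(p, q) \<in> translate_set w g" and xy: "x \<in> p" "y \<in> q"
  shows "\<forall>\<^sub>F i in sequentially. sep (g \<odot> x i) w \<and> take (length w) (g \<odot> y i) = w"
proof -
  interpret g: boundary_iso N "(\<odot>) g" "(\<odot>) (finv g)" by (rule boundary_iso_left[OF g])
  let ?p = "boundary_map ((\<odot>) g) p" and ?q = "boundary_map ((\<odot>) g) q"
  have b: "?p \<in> boundary N" "?q \<in> boundary N" using g.boundary_map_in pq by blast+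
  have in_pq: "(\<odot>) g \<circ> x \<in> ?p" "(\<odot>) g \<circ> y \<in> ?q" using xy by (simp_all add: boundary_map_def)
  have 1: "bpref ?p 1 \<noteq> take 1 w" "bpref ?q (length w) = w"
    using z by (auto simp: through_word_def boundary2_map_def cyl_def)
  show ?thesis
    using bpref[OF b(1) in_pq(1), of 1] bpref[OF b(2) in_pq(2), of "length w"]
  proof eventually_elim
    case (elim i)
    then have "take 1 (g \<odot> x i) \<noteq> take 1 w" using 1 by simp
    then have "sep (g \<odot> x i) w" using w by (cases "g \<odot> x i"; cases w) (auto simp: sep_def)
    then show ?case using elim 1 by simp
  qed
qed

text \<open>The vertex \<open>\<Phi> g\<close> lies on the geodesic from \<open>\<Phi> (g x)\<close> to \<open>\<Phi> (g y)\<close> by \<open>middle_on_image\<close>, so the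
  identity lies on the geodesic from \<open>\<Phi> x\<close> to \<open>\<Phi> y\<close>.\<close>

lemma translate_set_sub:
  assumes w: "w \<in> FG N" "w \<noteq> []" and g: "g \<in> FG N" "\<Phi> g \<in> middle w"
  shows "translate_set w g \<subseteq> boundary2_map \<Phi> -` through_id N \<inter> boundary2 N"
proof
  fix z assume z: "z \<in> translate_set w g"
  then obtain p q where pq: "z = (p, q)" "p \<in> boundary N" "q \<in> boundary N" by (auto simp: boundary2_def)
  obtain x y where xy: "x \<in> p" "y \<in> q" using boundary_nonempty pq by blast
  have FG: "x i \<in> FG N" "y i \<in> FG N" for i
    using pq xy by (auto intro: boundary_seq_FG)
  have "(p, q) \<in> translate_set w g" using z pq by simp
  note ev = translate_set_eventually[OF g(1) w(2) pq(2,3) this xy]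
  let ?p = "boundary_map \<Phi> p" and ?q = "boundary_map \<Phi> q"
  have b: "?p \<in> boundary N" "?q \<in> boundary N" using \<Phi>.boundary_map_in pq by blast+
  have in_pq: "\<Phi> \<circ> x \<in> ?p" "\<Phi> \<circ> y \<in> ?q" using xy by (simp_all add: boundary_map_def)
  have "\<forall>\<^sub>F i in sequentially. bpref ?p 1 \<noteq> bpref ?q 1"
    using ev bpref[OF b(1) in_pq(1), of 1] bpref[OF b(2) in_pq(2), of 1]
  proof eventually_elim
    case (elim i)
    have "sep (finv (\<Phi> g) \<odot> \<Phi> (g \<odot> x i)) (finv (\<Phi> g) \<odot> \<Phi> (g \<odot> y i))"
      using middle_on_image[OF w g(2), of "g \<odot> x i" "g \<odot> y i"] elim g FG by simp
    then have "sep (\<Phi> (x i)) (\<Phi> (y i))" using g FG by (simp add: hom finv_fmul_cancel)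
    moreover have "take 1 (\<Phi> (x i)) = bpref ?p 1" "1 \<le> length (\<Phi> (x i))"
      "take 1 (\<Phi> (y i)) = bpref ?q 1" "1 \<le> length (\<Phi> (y i))" using elim by simp_all
    ultimately show ?case using sep_take_1 by metis
  qed
  then have "bpref ?p 1 \<noteq> bpref ?q 1" by simp
  then show "z \<in> boundary2_map \<Phi> -` through_id N \<inter> boundary2 N"
    using z pq b by (simp add: boundary2_map_def through_id_def)
qed

lemma translate_set_overlap:
  assumes w: "w \<in> FG N" "w \<noteq> []" and z: "z \<in> boundary2 N"
  shows "card {g \<in> FG N. \<Phi> g \<in> middle w \<and> z \<in> translate_set w g} \<le> length w"
proof -
  obtain p q where pq: "z = (p, q)" "p \<in> boundary N" "q \<in> boundary N" using z by (auto simp: boundary2_def)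
  obtain x y where xy: "x \<in> p" "y \<in> q" using boundary_nonempty pq by blast
  let ?G = "{g \<in> FG N. \<Phi> g \<in> middle w \<and> z \<in> translate_set w g}"
  have fin: "finite {g \<in> FG N. \<Phi> g \<in> middle w}" by (rule card_middle_preimage(2)[OF w(1)])
  have finG: "finite ?G" by (rule finite_subset[OF _ fin]) auto
  have "\<forall>g\<in>?G. \<forall>\<^sub>F i in sequentially. sep (g \<odot> x i) w \<and> take (length w) (g \<odot> y i) = w"
    using translate_set_eventually[OF _ w(2) pq(2,3) _ xy] pq(1) by blast
  then have "\<forall>\<^sub>F i in sequentially. \<forall>g\<in>?G. sep (g \<odot> x i) w \<and> take (length w) (g \<odot> y i) = w"
    by (rule eventually_ball_finite[OF finG])
  then obtain i where i: "\<forall>g\<in>?G. sep (g \<odot> x i) w \<and> take (length w) (g \<odot> y i) = w"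
    unfolding eventually_sequentially by blast
  have FG: "x i \<in> FG N" "y i \<in> FG N" using pq xy by (auto intro: boundary_seq_FG)
  have "?G \<subseteq> {g \<in> FG N. \<Phi> g \<in> middle w \<and> sep (g \<odot> x i) w \<and> take (length w) (g \<odot> y i) = w}"
    using i by blast
  then have "card ?G \<le> card {g \<in> FG N. \<Phi> g \<in> middle w \<and> sep (g \<odot> x i) w \<and> take (length w) (g \<odot> y i) = w}"
    by (rule card_mono[rotated]) (rule finite_subset[OF _ fin], auto)
  also have "\<dots> \<le> length w" by (rule overlap_bound[OF w FG])
  finally show ?thesis .
qed

text \<open>The translates of \<open>through_word N w\<close> by \<open>g\<^sup>-\<^sup>1\<close>, one for each middle vertex \<open>\<Phi> g\<close>, have equal measure,
  lie in the preimage of \<open>through_id N\<close>, and cover each of its points at most \<open>|w|\<close> times.\<close>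

lemma middle_current_bound:
  assumes \<mu>: "\<mu> \<in> Curr N" and w: "w \<in> FG N" "w \<noteq> []"
  shows "of_nat (card (middle w)) * emeasure \<mu> (through_word N w)
    \<le> of_nat (length w) * emeasure \<mu> (boundary2_map \<Phi> -` through_id N \<inter> boundary2 N)"
proof -
  let ?G = "{g \<in> FG N. \<Phi> g \<in> middle w}" and ?B = "boundary2_map \<Phi> -` through_id N \<inter> boundary2 N"
  note sets = CurrD(2)[OF \<mu>]
  have fin: "finite ?G" by (rule card_middle_preimage(2)[OF w(1)])
  have A: "translate_set w g \<in> sets \<mu>" if "g \<in> ?G" for g
    unfolding sets using that w boundary_iso.emeasure_push(2)[OF boundary_iso_left sets] by simp
  have B: "?B \<in> sets \<mu>" unfolding sets by (rule \<Phi>.emeasure_push(2)[OF sets]) simp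
  have "of_nat (card (middle w)) * emeasure \<mu> (through_word N w) = (\<Sum>g\<in>?G. emeasure \<mu> (translate_set w g))"
    using Curr_translate[OF \<mu>] w card_middle_preimage(1)[OF w(1)] by simp
  also have "\<dots> = (\<Sum>g\<in>?G. \<integral>\<^sup>+z. indicator (translate_set w g) z \<partial>\<mu>)"
    using A by (intro sum.cong refl) (simp only: nn_integral_indicator)
  also have "\<dots> = (\<integral>\<^sup>+z. (\<Sum>g\<in>?G. indicator (translate_set w g) z) \<partial>\<mu>)"
    by (rule nn_integral_sum[symmetric]) (use A in \<open>rule borel_measurable_indicator\<close>)
  also have "\<dots> \<le> (\<integral>\<^sup>+z. of_nat (length w) * indicator ?B z \<partial>\<mu>)"
  proof (rule nn_integral_mono)
    fix z assume "z \<in> space \<mu>"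
    then have z: "z \<in> boundary2 N" by (simp add: CurrD(1)[OF \<mu>])
    have "(\<Sum>g\<in>?G. indicator (translate_set w g) z) = (of_nat (card {g \<in> ?G. z \<in> translate_set w g}) :: ennreal)"
      using sum.inter_filter[OF fin, of "\<lambda>g. 1::ennreal" "\<lambda>g. z \<in> translate_set w g"]
      unfolding indicator_def of_bool_def by simp
    also have "\<dots> \<le> of_nat (length w) * indicator ?B z"
    proof (cases "z \<in> ?B")
      case True
      have "{g \<in> ?G. z \<in> translate_set w g} = {g \<in> FG N. \<Phi> g \<in> middle w \<and> z \<in> translate_set w g}" by blast
      then have "card {g \<in> ?G. z \<in> translate_set w g} \<le> length w"
        using translate_set_overlap[OF w z] by simp
      then show ?thesis using True by (simp only: indicator_simps mult_1_right of_nat_le_iff)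
    next
      case False
      then have e: "{g \<in> ?G. z \<in> translate_set w g} = {}" using translate_set_sub[OF w] by blast
      show ?thesis unfolding e by simp
    qed
    finally show "(\<Sum>g\<in>?G. indicator (translate_set w g) z) \<le> (of_nat (length w) * indicator ?B z :: ennreal)" .
  qed
  also have "\<dots> = of_nat (length w) * emeasure \<mu> ?B"
    using B by (simp only: nn_integral_cmult_indicator)
  finally show ?thesis .
qed

text \<open>The representatives of the outer class of \<open>\<Phi>\<close>.\<close>

definition twist :: "fword \<Rightarrow> fword \<Rightarrow> fword"
  where "twist d x = \<Phi> (d \<odot> x \<odot> finv d)"

lemma free_auto_twist:
  assumes d: "d \<in> FG N" shows "free_auto N (twist d)"
proof
  show "twist d (u \<odot> v) = twist d u \<odot> twist d v" if "u \<in> FG N" "v \<in> FG N" for u v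
    using that d by (simp add: twist_def hom[symmetric] fmul_assoc finv_fmul_cancel)
  have "bij_betw (\<lambda>x. d \<odot> x \<odot> finv d) (FG N) (FG N)"
    by (rule bij_betwI[where g = "\<lambda>x. finv d \<odot> x \<odot> d"])
      (use d in \<open>auto simp: fmul_assoc finv_fmul_cancel fmul_finv_cancel finv_fmul fmul_finv\<close>)
  from bij_betw_trans[OF this bij] show "bij_betw (twist d) (FG N) (FG N)"
    by (simp add: twist_def[abs_def] comp_def)
qed

text \<open>Take \<open>d\<close> such that the volume is minimal. Conjugating the map \<open>twist d\<close> by a letter gives another
  twist, by the preimage of that letter under \<open>\<Phi>\<close>.\<close>

lemma exists_minimal_twist:
  "\<exists>d\<in>FG N. \<forall>b\<in>letters N. free_auto.volume N (twist d)
    \<le> (\<Sum>l\<in>letters N. length ([inv_letter b] \<odot> twist d [l] \<odot> [b]))"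
proof -
  define vol where "vol d = (\<Sum>l\<in>letters N. length (twist d [l]))" for d
  have ex: "[] \<in> FG N" by simp
  define d where "d = (ARG_MIN vol d. d \<in> FG N)"
  have d: "d \<in> FG N" and min: "\<And>d'. d' \<in> FG N \<Longrightarrow> vol d \<le> vol d'"
    unfolding d_def using arg_min_nat_lemma[of "\<lambda>d. d \<in> FG N" "[]" vol] ex by blast+
  have "free_auto.volume N (twist d) \<le> (\<Sum>l\<in>letters N. length ([inv_letter b] \<odot> twist d [l] \<odot> [b]))"
    if b: "b \<in> letters N" for b
  proof -
    have bF: "[b] \<in> FG N" "[inv_letter b] \<in> FG N" using b by (simp_all add: letter_FG[symmetric])
    obtain e where e: "e \<in> FG N" "\<Phi> e = [inv_letter b]" using surj[OF bF(2)] by blast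
    have e': "\<Phi> (finv e) = [b]" using \<Phi>_finv[OF e(1)] e(2) by (simp add: finv_Cons)
    have "[inv_letter b] \<odot> twist d [l] \<odot> [b] = twist (e \<odot> d) [l]" if "l \<in> letters N" for l
    proof -
      have "[l] \<in> FG N" using that by (simp add: letter_FG[symmetric])
      then show ?thesis
        unfolding e(2)[symmetric] e'[symmetric] twist_def using e(1) d
        by (simp add: hom[symmetric] finv_of_fmul fmul_assoc del: foldr.simps)
    qed
    then have "(\<Sum>l\<in>letters N. length ([inv_letter b] \<odot> twist d [l] \<odot> [b])) = vol (e \<odot> d)"
      unfolding vol_def by (intro sum.cong refl) simp
    then show ?thesis
      using min[of "e \<odot> d"] e(1) d by (simp add: vol_def free_auto.volume_def[OF free_auto_twist])
  qed
  then show ?thesis using d by blast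
qed

text \<open>On the boundary, a twist by \<open>d\<close> is left translation by \<open>d\<close> followed by \<open>\<Phi>\<close>, because the right
  translation acts trivially, and \<open>\<mu>\<close> is translation invariant.\<close>

lemma emeasure_twist:
  assumes \<mu>: "\<mu> \<in> Curr N" and d: "d \<in> FG N"
  shows "emeasure \<mu> (boundary2_map (twist d) -` through_id N \<inter> boundary2 N) =
    emeasure \<mu> (boundary2_map \<Phi> -` through_id N \<inter> boundary2 N)"
proof -
  interpret d: boundary_iso N "(\<odot>) d" "(\<odot>) (finv d)" by (rule boundary_iso_left[OF d])
  have bm: "boundary_map (twist d) p = boundary_map \<Phi> (boundary_map ((\<odot>) d) p)" if p: "p \<in> boundary N" for p
  proof -
    have "boundary_map (twist d) p = boundary_map \<Phi> (boundary_map ((\<odot>) d) (boundary_map (\<lambda>x. x \<odot> finv d) p))"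
      by (simp add: boundary_map_def image_image comp_def twist_def)
    then show ?thesis using boundary_map_right[OF _ p, of "finv d"] d by simp
  qed
  have "boundary2_map (twist d) -` through_id N \<inter> boundary2 N =
    boundary2_map ((\<odot>) d) -` (boundary2_map \<Phi> -` through_id N \<inter> boundary2 N) \<inter> boundary2 N"
  proof (intro Set.set_eqI)
    fix z
    have "boundary2_map (twist d) z = boundary2_map \<Phi> (boundary2_map ((\<odot>) d) z)" if "z \<in> boundary2 N"
      using that bm by (auto simp: boundary2_map_def boundary2_def)
    then show "z \<in> boundary2_map (twist d) -` through_id N \<inter> boundary2 N \<longleftrightarrow>
      z \<in> boundary2_map ((\<odot>) d) -` (boundary2_map \<Phi> -` through_id N \<inter> boundary2 N) \<inter> boundary2 N"
      using d.boundary2_map_in[of z] by auto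
  qed
  then show ?thesis
    using Curr_translate[OF \<mu> d \<Phi>.emeasure_push(2)[OF CurrD(2)[OF \<mu>] through_id_sets]] by simp
qed

text \<open>For a twist of minimal volume some test word has an image whose middle part is, up to a constant,
  as long as the volume. By \<open>middle_current_bound\<close> the length of this middle part is at most
  \<open>|w|\<close> times the ratio of the length of \<open>\<Phi> \<mu>\<close> to the weight of \<open>w\<close>, hence at most \<open>|w| n\<close>.\<close>

lemma bounded_volume:
  assumes \<mu>: "\<mu> \<in> Curr N" and N: "N > 0"
    and pos: "\<And>w. w \<in> test_words N \<Longrightarrow> emeasure \<mu> (through_id N) < of_nat n * emeasure \<mu> (through_word N w)"
    and le: "emeasure \<mu> (boundary2_map \<Phi> -` through_id N \<inter> boundary2 N) \<le> emeasure \<mu> (through_id N)"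
  shows "\<exists>d\<in>FG N. (\<Sum>l\<in>letters N. length (twist d [l])) \<le> 2 * N * ((16 * N + 4) * n)"
proof -
  obtain d where d: "d \<in> FG N" and min: "\<And>b. b \<in> letters N \<Longrightarrow> free_auto.volume N (twist d)
    \<le> (\<Sum>l\<in>letters N. length ([inv_letter b] \<odot> twist d [l] \<odot> [b]))"
    using exists_minimal_twist by blast
  interpret t: free_auto N "twist d" by (rule free_auto_twist[OF d])
  obtain w where w: "w \<in> test_words N" "t.volume \<le> 2 * N * card (t.middle w)"
    using t.test_word_with_long_middle[OF min N] by blast
  note tw = test_words[OF w(1)]
  let ?c = "emeasure \<mu> (through_word N w)"
  have fin: "?c < \<infinity>" by (rule CurrD(3)[OF \<mu> through_word_top(2)[OF tw(2)]])
  have pos': "?c \<noteq> 0" using pos[OF w(1)] by auto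
  have "of_nat (card (t.middle w)) * ?c \<le> of_nat (length w) * emeasure \<mu> (boundary2_map \<Phi> -` through_id N \<inter> boundary2 N)"
    using t.middle_current_bound[OF \<mu> tw(1,2)] emeasure_twist[OF \<mu> d] by simp
  also have "\<dots> \<le> of_nat (length w) * emeasure \<mu> (through_id N)" by (intro mult_left_mono le) simp
  also have "\<dots> \<le> of_nat (length w) * (of_nat n * ?c)"
    by (intro mult_left_mono less_imp_le[OF pos[OF w(1)]]) simp
  finally have "of_nat (card (t.middle w)) * ?c \<le> of_nat (length w * n) * ?c" by (simp add: mult.assoc)
  then have "(of_nat (card (t.middle w)) :: ennreal) \<le> of_nat (length w * n)"
    using fin pos' by (metis ennreal_mult_le_mult_iff mult.commute infinity_ennreal_def less_irrefl)
  then have "card (t.middle w) \<le> length w * n" by (simp only: of_nat_le_iff)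
  also have "\<dots> \<le> (16 * N + 4) * n" using tw(3) by (rule mult_le_mono1)
  finally have "2 * N * card (t.middle w) \<le> 2 * N * ((16 * N + 4) * n)" by (rule mult_le_mono2)
  then have "t.volume \<le> 2 * N * ((16 * N + 4) * n)" using w(2) by (rule le_trans[rotated])
  then show ?thesis using d unfolding t.volume_def by blast
qed

end

section \<open>Uniform positivity on compact sets\<close>

lemma closedin_cyl: "closedin (boundary_top N) (cyl N w)"
  unfolding closedin_def topspace_boundary_top openin_boundary
  by (auto simp: cyl_def intro!: exI[of _ "length w"])

lemma closedin_rectangle:
  assumes "u \<noteq> []" "v \<noteq> []" "hd u \<noteq> hd v"
  shows "closedin (boundary2_top N) (cyl N u \<times> cyl N v)"
proof -
  have "cyl N u \<times> cyl N v \<subseteq> boundary2 N"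
    using openin_subset[OF rectangle(1)[OF assms]] by simp
  moreover have "closedin (prod_topology (boundary_top N) (boundary_top N)) (cyl N u \<times> cyl N v)"
    using closedin_cyl by (simp add: closedin_prod_Times_iff)
  ultimately show ?thesis unfolding boundary2_top_def closedin_subtopology by blast
qed

lemma closedin_through_id: "closedin (boundary2_top N) (through_id N)"
proof -
  have "finite {(a, b) \<in> letters N \<times> letters N. a \<noteq> b}"
    by (rule finite_subset[of _ "letters N \<times> letters N"]) auto
  then show ?thesis unfolding through_id_eq by (auto intro!: closedin_Union closedin_rectangle)
qed

lemma closedin_through_word: "w \<noteq> [] \<Longrightarrow> closedin (boundary2_top N) (through_word N w)"
  unfolding through_word_eq by (auto intro!: closedin_Union closedin_rectangle)

lemma continuous_map_indicator:
  assumes "openin X A" "closedin X A"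
  shows "continuous_map X euclideanreal (indicator A)"
  unfolding continuous_map_def
proof (intro conjI allI impI)
  fix U :: "real set"
  have A: "A \<subseteq> topspace X" using assms(1) by (rule openin_subset)
  have "openin X (topspace X - A)" using assms(2) by (simp add: closedin_def)
  moreover have "{x \<in> topspace X. indicator A x \<in> U} =
    (if 1 \<in> U then A else {}) \<union> (if 0 \<in> U then topspace X - A else {})"
    using A by (auto simp: indicator_def)
  ultimately show "openin X {x \<in> topspace X. indicator A x \<in> U}" using assms(1) by auto
qed simp

text \<open>The sets are compact and both open and closed, so this is a test function for the weak-*
  topology. The sign of its integral compares the weight of \<open>w\<close> with the length of the current.\<close>

definition weight :: "nat \<Rightarrow> nat \<Rightarrow> fword \<Rightarrow> bpoint \<times> bpoint \<Rightarrow> real"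
  where "weight N n w z = real n * indicator (through_word N w) z - indicator (through_id N) z"

lemma weight_compact_support:
  assumes "w \<noteq> []" shows "weight N n w \<in> cont_compact_support (boundary2_top N)"
proof -
  let ?X = "boundary2_top N" and ?S = "through_word N w \<union> through_id N"
  have "continuous_map ?X euclideanreal (weight N n w)"
    unfolding weight_def[abs_def]
    by (intro continuous_map_diff continuous_map_real_mult continuous_map_indicator)
      (simp_all add: through_word_top through_id_top closedin_through_word closedin_through_id assms)
  moreover have "compactin ?X (?X closure_of {x \<in> topspace ?X. weight N n w x \<noteq> 0})"
  proof (rule closed_compactin[of _ ?S])
    show "compactin ?X ?S" using through_word_top(2)[OF assms] through_id_top(2) by (rule compactin_Un)
    have "closedin ?X ?S" using closedin_through_word[OF assms] closedin_through_id by (rule closedin_Un)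
    then show "?X closure_of {x \<in> topspace ?X. weight N n w x \<noteq> 0} \<subseteq> ?S"
      by (rule closure_of_minimal[rotated]) (auto simp: weight_def indicator_def split: if_splits)
  qed simp
  ultimately show ?thesis by (simp add: cont_compact_support_def)
qed

lemma Curr_finite:
  assumes "\<mu> \<in> Curr N"
  shows "emeasure \<mu> (through_id N) < \<infinity>" "w \<noteq> [] \<Longrightarrow> emeasure \<mu> (through_word N w) < \<infinity>"
  using CurrD(3)[OF assms] through_id_top(2) through_word_top(2) by blast+

lemma integral_weight:
  assumes \<mu>: "\<mu> \<in> Curr N" and w: "w \<noteq> []"
  shows "integral\<^sup>L \<mu> (weight N n w) = real n * measure \<mu> (through_word N w) - measure \<mu> (through_id N)"
proof -
  have sub: "through_word N w \<subseteq> space \<mu>" "through_id N \<subseteq> space \<mu>"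
    using openin_subset[OF through_word_top(1)[OF w]] openin_subset[OF through_id_top(1)] CurrD(1)[OF \<mu>] by simp_all
  have sets: "through_word N w \<in> sets \<mu>" "through_id N \<in> sets \<mu>"
    using w by (simp_all add: CurrD(2)[OF \<mu>])
  have "integrable \<mu> (indicator (through_word N w) :: _ \<Rightarrow> real)" "integrable \<mu> (indicator (through_id N) :: _ \<Rightarrow> real)"
    using sets Curr_finite[OF \<mu>] w by (auto intro!: integrable_real_indicator)
  then show ?thesis
    unfolding weight_def[abs_def] using sub by (simp add: Int_absorb2)
qed

definition positive_currents :: "nat \<Rightarrow> nat \<Rightarrow> current set"
  where "positive_currents N n = {\<mu> \<in> Curr N. \<forall>w\<in>test_words N.
    emeasure \<mu> (through_id N) < of_nat n * emeasure \<mu> (through_word N w)}"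

lemma positive_iff_integral:
  assumes \<mu>: "\<mu> \<in> Curr N" and w: "w \<noteq> []"
  shows "emeasure \<mu> (through_id N) < of_nat n * emeasure \<mu> (through_word N w) \<longleftrightarrow> integral\<^sup>L \<mu> (weight N n w) \<in> {0<..}"
proof -
  have e: "emeasure \<mu> (through_id N) = ennreal (measure \<mu> (through_id N))"
    "emeasure \<mu> (through_word N w) = ennreal (measure \<mu> (through_word N w))"
    using Curr_finite(1)[OF \<mu>] Curr_finite(2)[OF \<mu> w] by (simp_all add: emeasure_eq_ennreal_measure)
  have n: "of_nat n * ennreal x = ennreal (real n * x)" if "x \<ge> 0" for x
    using that by (simp add: ennreal_mult ennreal_of_nat_eq_real_of_nat)
  show ?thesis
    unfolding e integral_weight[OF assms] n[OF measure_nonneg] by (simp add: ennreal_less_iff)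
qed

lemma topspace_Curr_top: "topspace (Curr_top N) \<subseteq> Curr N"
  unfolding Curr_top_def topology_generated_by_topspace by blast

lemma openin_positive_currents: "openin (Curr_top N) (topspace (Curr_top N) \<inter> positive_currents N n)"
proof -
  let ?A = "\<lambda>w. {\<mu> \<in> Curr N. integral\<^sup>L \<mu> (weight N n w) \<in> {0<..}}"
  have "openin (Curr_top N) (?A w)" if "w \<in> test_words N" for w
    unfolding Curr_top_def
    by (rule topology_generated_by_Basis, rule CollectI, rule exI[of _ "weight N n w"], rule exI[of _ "{0<..}"])
      (simp add: weight_compact_support[OF test_words(2)[OF that]])
  then have "openin (Curr_top N) (topspace (Curr_top N) \<inter> \<Inter>(?A ` test_words N))"
    using finite_test_words by (cases "test_words N = {}") (auto intro!: openin_Int openin_Inter)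
  moreover have "\<mu> \<in> \<Inter>(?A ` test_words N) \<longleftrightarrow> \<mu> \<in> positive_currents N n" if "\<mu> \<in> topspace (Curr_top N)" for \<mu>
  proof -
    have \<mu>: "\<mu> \<in> Curr N" using that topspace_Curr_top by blast
    show ?thesis
      using positive_iff_integral[OF \<mu> test_words(2)] \<mu> by (simp add: positive_currents_def)
  qed
  then have "topspace (Curr_top N) \<inter> \<Inter>(?A ` test_words N) = topspace (Curr_top N) \<inter> positive_currents N n"
    by blast
  ultimately show ?thesis by simp
qed

lemma proj_class_self: "\<mu> \<in> proj_class \<mu>"
  unfolding proj_class_def by (auto intro!: exI[of _ 1] simp: scale_measure_1)

lemma positive_scale:
  assumes "\<mu> \<in> Curr N" "\<nu> \<in> positive_currents N n" "\<mu> = scale_measure (ennreal r) \<nu>" "r > 0"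
  shows "\<mu> \<in> positive_currents N n"
proof -
  have "emeasure \<mu> (through_id N) < of_nat n * emeasure \<mu> (through_word N w)" if w: "w \<in> test_words N" for w
  proof -
    have "ennreal r * emeasure \<nu> (through_id N) < ennreal r * (of_nat n * emeasure \<nu> (through_word N w))"
      using assms(2,4) w unfolding positive_currents_def by (intro ennreal_mult_strict_left_mono) auto
    then show ?thesis by (simp add: assms(3) mult.left_commute)
  qed
  then show ?thesis using assms(1) by (simp add: positive_currents_def)
qed

text \<open>The classes of the currents in \<open>positive_currents N n\<close> form an open set that increases with \<open>n\<close>, and
  every class of full support lies in one of these sets, because cylinders are open and nonempty.\<close>

lemma compact_positive:
  assumes K: "compactin (PCurr_plus_top N) K"
  shows "\<exists>n. \<forall>c\<in>K. \<exists>\<mu>\<in>positive_currents N n. c = proj_class \<mu>"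
proof -
  define X where "X = subtopology (Curr_top N) (Curr_nonzero N)"
  have PX: "PCurr_top N = quotient_top X proj_class" by (simp add: PCurr_top_def X_def)
  define U where "U n = proj_class ` (topspace X \<inter> positive_currents N n)" for n
  have topX: "topspace X \<subseteq> Curr N" using topspace_Curr_top unfolding X_def by auto
  have "openin (PCurr_top N) (U n)" for n
    unfolding PX openin_quotient_top
  proof
    show "U n \<subseteq> proj_class ` topspace X" by (auto simp: U_def)
    have "{\<mu> \<in> topspace X. proj_class \<mu> \<in> U n} = topspace X \<inter> positive_currents N n"
    proof (intro subset_antisym subsetI)
      fix \<mu> assume "\<mu> \<in> {\<mu> \<in> topspace X. proj_class \<mu> \<in> U n}"
      then obtain \<nu> where \<mu>: "\<mu> \<in> topspace X" and \<nu>: "\<nu> \<in> positive_currents N n" "proj_class \<mu> = proj_class \<nu>"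
        unfolding U_def by blast
      then have "\<mu> \<in> proj_class \<nu>" using proj_class_self by blast
      then obtain r :: real where "r > 0" "\<mu> = scale_measure (ennreal r) \<nu>" by (auto simp: proj_class_def)
      then show "\<mu> \<in> topspace X \<inter> positive_currents N n" using positive_scale \<mu> \<nu>(1) topX by blast
    qed (auto simp: U_def)
    moreover have "openin X (topspace X \<inter> positive_currents N n)"
      unfolding X_def openin_subtopology using openin_positive_currents by auto
    ultimately show "openin X {\<mu> \<in> topspace X. proj_class \<mu> \<in> U n}" by simp
  qed
  moreover have "K \<subseteq> \<Union>(range U)"
  proof
    fix c assume "c \<in> K"
    then have c: "c \<in> topspace (PCurr_top N)" "c \<in> PCurr_plus N"
      using compactin_subset_topspace[OF K] by (auto simp: PCurr_plus_top_def)
    have "topspace (PCurr_top N) = proj_class ` topspace X"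
      using quotient_imp_surjective_map[OF quotient_map_quotient_top] PX by metis
    then obtain \<mu> where \<mu>: "\<mu> \<in> topspace X" "c = proj_class \<mu>" using c(1) by blast
    obtain \<nu> where \<nu>: "c = proj_class \<nu>" "full_support N \<nu>" using c(2) by (auto simp: PCurr_plus_def)
    have "\<mu> \<in> proj_class \<nu>" using proj_class_self \<mu>(2) \<nu>(1) by blast
    then obtain r :: real where r: "r > 0" "\<mu> = scale_measure (ennreal r) \<nu>" by (auto simp: proj_class_def)
    have \<mu>C: "\<mu> \<in> Curr N" using \<mu>(1) topX by blast
    have pos: "emeasure \<mu> (through_word N w) \<noteq> 0" if w: "w \<in> test_words N" for w
    proof -
      obtain z where z: "z \<in> through_word N w" using through_word_nonempty test_words[OF w] by blast
      have op: "openin (boundary2_top N) (through_word N w)" by (rule through_word_top(1)[OF test_words(2)[OF w]])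
      have "z \<in> measure_support (boundary2_top N) \<nu>"
        using \<nu>(2) z openin_subset[OF op] by (auto simp: full_support_def)
      then have "emeasure \<nu> (through_word N w) > 0" using op z by (simp add: measure_support_def)
      then show ?thesis using r by (simp add: ennreal_zero_less_mult_iff zero_less_iff_neq_zero[symmetric])
    qed
    have "\<exists>n. emeasure \<mu> (through_id N) < of_nat n * emeasure \<mu> (through_word N w)" if w: "w \<in> test_words N" for w
    proof -
      note ne = test_words(2)[OF w]
      have fin: "emeasure \<mu> (through_word N w) < \<infinity>" using Curr_finite(2)[OF \<mu>C ne] .
      then have "measure \<mu> (through_word N w) > 0"
        using pos[OF w] by (simp add: emeasure_eq_ennreal_measure zero_less_measure_iff)
      then obtain n where "measure \<mu> (through_id N) < real n * measure \<mu> (through_word N w)"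
        using reals_Archimedean3 by blast
      then show ?thesis unfolding positive_iff_integral[OF \<mu>C ne] integral_weight[OF \<mu>C ne] by auto
    qed
    then obtain m where m: "\<And>w. w \<in> test_words N \<Longrightarrow> emeasure \<mu> (through_id N) < of_nat (m w) * emeasure \<mu> (through_word N w)"
      by metis
    have "\<mu> \<in> positive_currents N (\<Sum>w\<in>test_words N. m w)"
      unfolding positive_currents_def
    proof (intro CollectI conjI ballI \<mu>C)
      fix w assume w: "w \<in> test_words N"
      have "m w \<le> (\<Sum>w\<in>test_words N. m w)" by (rule member_le_sum[OF w _ finite_test_words]) simp
      then have "(of_nat (m w) :: ennreal) \<le> of_nat (\<Sum>w\<in>test_words N. m w)" by (simp only: of_nat_le_iff)
      then show "emeasure \<mu> (through_id N) < of_nat (\<Sum>w\<in>test_words N. m w) * emeasure \<mu> (through_word N w)"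
        using m[OF w] by (meson less_le_trans mult_right_mono zero_le)
    qed
    then show "c \<in> \<Union>(range U)" using \<mu> unfolding U_def by blast
  qed
  moreover have KP: "compactin (PCurr_top N) K"
    using K unfolding PCurr_plus_top_def compactin_subtopology by blast
  ultimately obtain \<F> where \<F>: "finite \<F>" "\<F> \<subseteq> range U" "K \<subseteq> \<Union>\<F>"
    using compactinD[OF KP, of "range U"] by blast
  then obtain I where I: "finite I" "\<F> = U ` I" using finite_subset_image[OF \<F>(1,2)] by auto
  have mono: "positive_currents N i \<subseteq> positive_currents N j" if "i \<le> j" for i j
  proof
    fix \<mu> assume \<mu>: "\<mu> \<in> positive_currents N i"
    have "of_nat i * x \<le> of_nat j * x" for x :: ennreal using that by (intro mult_right_mono) simp_all
    then show "\<mu> \<in> positive_currents N j"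
      using \<mu> unfolding positive_currents_def by (blast intro: less_le_trans)
  qed
  have "\<exists>\<mu>\<in>positive_currents N (\<Sum>I). c = proj_class \<mu>" if "c \<in> K" for c
  proof -
    obtain i where i: "i \<in> I" "c \<in> U i" using \<open>c \<in> K\<close> \<F>(3) I(2) by blast
    then have "i \<le> \<Sum>I" using member_le_sum[of i I "\<lambda>i. i"] I(1) by simp
    then show ?thesis using mono i(2) unfolding U_def by blast
  qed
  then show ?thesis by blast
qed

section \<open>Automorphisms of bounded volume\<close>

lemma free_autoI: "\<Phi> \<in> auto (free_group N) \<Longrightarrow> free_auto N \<Phi>"
  by (auto simp: auto_def Bij_def hom_def intro!: free_auto.intro)

lemma auto_eq_on_letters:
  assumes "\<Phi> \<in> auto (free_group N)" "\<Psi> \<in> auto (free_group N)" "\<And>l. l \<in> letters N \<Longrightarrow> \<Phi> [l] = \<Psi> [l]"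
  shows "\<Phi> = \<Psi>"
proof
  fix x
  interpret \<Phi>: free_auto N \<Phi> using assms(1) by (rule free_autoI)
  interpret \<Psi>: free_auto N \<Psi> using assms(2) by (rule free_autoI)
  have "\<Phi> x = \<Psi> x" if "x \<in> FG N"
    using that
  proof (induction x)
    case (Cons l x)
    then have x: "x \<in> FG N" "l \<in> letters N" by (auto simp: FG_letters reduced_Cons)
    have l: "[l] \<in> FG N" using x by (simp add: letter_FG)
    have "[l] \<odot> x = l # x" using Cons.prems fmul_reduced_append[of "[l]" x] FG_reduced by simp
    then show ?case using \<Phi>.hom[OF l x(1)] \<Psi>.hom[OF l x(1)] Cons.IH[OF x(1)] assms(3)[OF x(2)] by simp
  qed simp
  moreover have "\<Phi> \<in> extensional (FG N)" "\<Psi> \<in> extensional (FG N)"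
    using assms by (auto simp: auto_def Bij_def)
  ultimately show "\<Phi> x = \<Psi> x" by (cases "x \<in> FG N") (auto simp: extensional_def)
qed

lemma finite_bounded_volume: "finite {\<Phi> \<in> auto (free_group N). (\<Sum>l\<in>letters N. length (\<Phi> [l])) \<le> R}"
  (is "finite ?B")
proof -
  let ?r = "\<lambda>\<Phi>. \<lambda>l\<in>letters N. \<Phi> [l]"
  have "?r ` ?B \<subseteq> (\<Pi>\<^sub>E l\<in>letters N. {w \<in> FG N. length w \<le> R})"
  proof (rule image_subsetI, rule PiE_I)
    fix \<Phi> l assume \<Phi>: "\<Phi> \<in> ?B" and l: "l \<in> letters N"
    interpret \<Phi>: free_auto N \<Phi> using \<Phi> by (auto intro: free_autoI)
    have "length (\<Phi> [l]) \<le> R"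
      using \<Phi> member_le_sum[OF l, of "\<lambda>l. length (\<Phi> [l])"] by simp
    moreover have "\<Phi> [l] \<in> FG N" using l by (simp add: letter_FG)
    ultimately show "?r \<Phi> l \<in> {w \<in> FG N. length w \<le> R}" using l by simp
  qed auto
  moreover have "finite (\<Pi>\<^sub>E l\<in>letters N. {w \<in> FG N. length w \<le> R})"
    by (intro finite_PiE finite_letters finite_FG_bounded)
  ultimately have "finite (?r ` ?B)" by (rule finite_subset)
  moreover have "inj_on ?r ?B"
  proof (rule inj_onI)
    fix \<Phi> \<Psi> assume *: "\<Phi> \<in> ?B" "\<Psi> \<in> ?B" "?r \<Phi> = ?r \<Psi>"
    have "\<Phi> [l] = \<Psi> [l]" if "l \<in> letters N" for l using fun_cong[OF *(3), of l] that by simp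
    then show "\<Phi> = \<Psi>" using auto_eq_on_letters * by blast
  qed
  ultimately show ?thesis by (rule finite_imageD)
qed

definition conjugation :: "nat \<Rightarrow> fword \<Rightarrow> fword \<Rightarrow> fword"
  where "conjugation N g = (\<lambda>x\<in>FG N. g \<odot> x \<odot> finv g)"

lemma inner_auto_eq: "inner_auto (free_group N) = conjugation N ` FG N"
  unfolding inner_auto_def conjugation_def
  by (intro image_cong refl restrict_ext) (simp add: fmul_assoc FG_reduced)

lemma AutoGroup_simps:
  "carrier (AutoGroup (free_group N)) = auto (free_group N)"
  "\<Phi> \<in> auto (free_group N) \<Longrightarrow> \<Psi> \<in> auto (free_group N) \<Longrightarrow> \<Phi> \<otimes>\<^bsub>AutoGroup (free_group N)\<^esub> \<Psi> = compose (FG N) \<Phi> \<Psi>"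
  by (auto simp: AutoGroup_def BijGroup_def auto_def)

lemma inner_auto_mem:
  assumes g: "g \<in> FG N" shows "conjugation N g \<in> auto (free_group N)"
proof -
  have red: "t \<in> FG N \<Longrightarrow> reduced t" for t by (rule FG_reduced)
  have "bij_betw (\<lambda>x. g \<odot> x \<odot> finv g) (FG N) (FG N)"
    by (rule bij_betwI[where g = "\<lambda>x. finv g \<odot> x \<odot> g"])
      (use g red in \<open>auto simp: fmul_assoc finv_fmul_cancel fmul_finv_cancel finv_fmul fmul_finv\<close>)
  moreover have "conjugation N g \<in> hom (free_group N) (free_group N)"
    using g red by (auto simp: hom_def conjugation_def fmul_assoc finv_fmul_cancel)
  ultimately show ?thesis by (simp add: auto_def Bij_def conjugation_def bij_betw_restrict_eq)
qed

lemma compose_inner: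
  assumes "\<Phi> \<in> auto (free_group N)" and g: "g \<in> FG N"
  shows "compose (FG N) \<Phi> (conjugation N g) = compose (FG N) (conjugation N (\<Phi> g)) \<Phi>"
proof -
  interpret free_auto N \<Phi> using assms(1) by (rule free_autoI)
  show ?thesis unfolding compose_def
    by (rule restrict_ext) (use g in \<open>simp add: conjugation_def hom \<Phi>_finv\<close>)
qed

lemma subgroup_inner_auto: "subgroup (inner_auto (free_group N)) (AutoGroup (free_group N))"
proof -
  interpret A: group "AutoGroup (free_group N)" by (rule group.AutoGroup[OF group_free_group])
  have red: "t \<in> FG N \<Longrightarrow> reduced t" for t by (rule FG_reduced)
  have mult: "compose (FG N) (conjugation N g) (conjugation N h) = conjugation N (g \<odot> h)" if "g \<in> FG N" "h \<in> FG N" for g h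
    unfolding compose_def
    by (subst conjugation_def[of N "g \<odot> h"], rule restrict_ext)
      (use that red in \<open>simp add: conjugation_def finv_of_fmul fmul_assoc\<close>)
  have one: "\<one>\<^bsub>AutoGroup (free_group N)\<^esub> = conjugation N []"
    by (auto simp: AutoGroup_def BijGroup_def conjugation_def red intro!: restrict_ext)
  show ?thesis
  proof (rule A.subgroupI)
    show "inner_auto (free_group N) \<subseteq> carrier (AutoGroup (free_group N))"
      using inner_auto_mem by (auto simp: inner_auto_eq AutoGroup_simps)
    show "inner_auto (free_group N) \<noteq> {}" unfolding inner_auto_eq using Nil_FG by blast
    fix a assume "a \<in> inner_auto (free_group N)"
    then obtain g where g: "a = conjugation N g" "g \<in> FG N" by (auto simp: inner_auto_eq)
    have "conjugation N (finv g) \<otimes>\<^bsub>AutoGroup (free_group N)\<^esub> a = \<one>\<^bsub>AutoGroup (free_group N)\<^esub>"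
      using g inner_auto_mem mult red by (simp add: AutoGroup_simps one finv_fmul)
    then have "inv\<^bsub>AutoGroup (free_group N)\<^esub> a = conjugation N (finv g)"
      using g inner_auto_mem by (intro A.inv_equality) (simp_all add: AutoGroup_simps)
    then show "inv\<^bsub>AutoGroup (free_group N)\<^esub> a \<in> inner_auto (free_group N)" using g by (simp add: inner_auto_eq)
    fix b assume "b \<in> inner_auto (free_group N)"
    then obtain h where "b = conjugation N h" "h \<in> FG N" by (auto simp: inner_auto_eq)
    then show "a \<otimes>\<^bsub>AutoGroup (free_group N)\<^esub> b \<in> inner_auto (free_group N)"
      using g inner_auto_mem mult by (auto simp: AutoGroup_simps inner_auto_eq)
  qed
qed

text \<open>The class does not depend on the representative that the definition of the action chooses.\<close>

lemma out_class:
  assumes "\<phi> \<in> carrier (OutGroup (free_group N))"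
  defines "\<Phi> \<equiv> (SOME \<Phi>. \<Phi> \<in> \<phi>)"
  shows "\<Phi> \<in> auto (free_group N)" "\<phi> = inner_auto (free_group N) #>\<^bsub>AutoGroup (free_group N)\<^esub> \<Phi>"
proof -
  let ?A = "AutoGroup (free_group N)"
  interpret A: group ?A by (rule group.AutoGroup[OF group_free_group])
  obtain \<Phi>0 where \<Phi>0: "\<Phi>0 \<in> auto (free_group N)" "\<phi> = inner_auto (free_group N) #>\<^bsub>?A\<^esub> \<Phi>0"
    using assms(1) by (auto simp: OutGroup_def FactGroup_def RCOSETS_def AutoGroup_simps)
  have "\<Phi>0 \<in> \<phi>" unfolding \<Phi>0(2) using A.rcos_self[OF _ subgroup_inner_auto] \<Phi>0(1) by (simp add: AutoGroup_simps)
  then have in\<phi>: "\<Phi> \<in> \<phi>" unfolding \<Phi>_def by (rule someI[of "\<lambda>\<Phi>. \<Phi> \<in> \<phi>"])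
  then show \<Phi>: "\<Phi> \<in> auto (free_group N)"
    using A.r_coset_subset_G[OF subgroup.subset[OF subgroup_inner_auto], of \<Phi>0] \<Phi>0 by (auto simp: AutoGroup_simps)
  show "\<phi> = inner_auto (free_group N) #>\<^bsub>?A\<^esub> \<Phi>"
    using A.repr_independence[OF _ _ subgroup_inner_auto, of \<Phi> \<Phi>0] in\<phi> \<Phi>0 by (simp add: AutoGroup_simps)
qed

lemma coset_compose_inner:
  assumes "\<Phi> \<in> auto (free_group N)" "g \<in> FG N"
  shows "inner_auto (free_group N) #>\<^bsub>AutoGroup (free_group N)\<^esub> compose (FG N) (conjugation N g) \<Phi> =
    inner_auto (free_group N) #>\<^bsub>AutoGroup (free_group N)\<^esub> \<Phi>"
proof -
  let ?A = "AutoGroup (free_group N)"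
  interpret A: group ?A by (rule group.AutoGroup[OF group_free_group])
  have "compose (FG N) (conjugation N g) \<Phi> = conjugation N g \<otimes>\<^bsub>?A\<^esub> \<Phi>"
    using assms inner_auto_mem by (simp add: AutoGroup_simps)
  then have "compose (FG N) (conjugation N g) \<Phi> \<in> inner_auto (free_group N) #>\<^bsub>?A\<^esub> \<Phi>"
    using assms by (auto simp: r_coset_def inner_auto_eq)
  then show ?thesis
    using A.repr_independence[OF _ _ subgroup_inner_auto] assms by (metis AutoGroup_simps(1))
qed

section \<open>Proper discontinuity\<close>

theorem corollary1p2:
  fixes N :: nat
  assumes "N \<ge> 3"
  shows "properly_discontinuous (OutGroup (free_group N)) (PCurr_plus_top N) (out_act_proj N)"
  unfolding properly_discontinuous_def
proof (intro allI impI)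
  fix K assume K: "compactin (PCurr_plus_top N) K"
  let ?G = "free_group N" and ?A = "AutoGroup (free_group N)"
  interpret A: group ?A by (rule group.AutoGroup[OF group_free_group])
  obtain n where n: "\<And>c. c \<in> K \<Longrightarrow> \<exists>\<mu>\<in>positive_currents N n. c = proj_class \<mu>"
    using compact_positive[OF K] by blast
  define B where "B = {\<Psi> \<in> auto ?G. (\<Sum>l\<in>letters N. length (\<Psi> [l])) \<le> 2 * N * ((16 * N + 4) * n)}"
  have finB: "finite B" unfolding B_def by (rule finite_bounded_volume)
  let ?coset = "\<lambda>\<Psi>. inner_auto ?G #>\<^bsub>?A\<^esub> \<Psi>"
  have twist_B: "\<exists>d\<in>FG N. compose (FG N) \<Psi> (conjugation N d) \<in> B"
    if \<Psi>: "\<Psi> \<in> auto ?G" and \<mu>: "\<mu> \<in> positive_currents N n"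
      and le: "emeasure \<mu> (boundary2_map \<Psi> -` through_id N \<inter> boundary2 N) \<le> emeasure \<mu> (through_id N)" for \<Psi> \<mu>
  proof -
    interpret \<Psi>: free_auto N \<Psi> using \<Psi> by (rule free_autoI)
    obtain d where d: "d \<in> FG N" "(\<Sum>l\<in>letters N. length (\<Psi>.twist d [l])) \<le> 2 * N * ((16 * N + 4) * n)"
      using \<Psi>.bounded_volume[OF _ _ _ le, of n] \<mu> assms unfolding positive_currents_def by auto
    have "\<Psi>.twist d [l] = compose (FG N) \<Psi> (conjugation N d) [l]" if "l \<in> letters N" for l
      using that by (simp add: \<Psi>.twist_def compose_def conjugation_def letter_FG del: foldr.simps)
    then have "(\<Sum>l\<in>letters N. length (compose (FG N) \<Psi> (conjugation N d) [l])) \<le> 2 * N * ((16 * N + 4) * n)"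
      using d(2) by simp
    moreover have "compose (FG N) \<Psi> (conjugation N d) \<in> auto ?G"
      using A.m_closed[of \<Psi> "conjugation N d"] \<Psi> inner_auto_mem[OF d(1)] by (simp add: AutoGroup_simps)
    ultimately show ?thesis using d(1) unfolding B_def by blast
  qed
  have "{\<phi> \<in> carrier (OutGroup ?G). K \<inter> out_act_proj N \<phi> ` K \<noteq> {}}
    \<subseteq> ?coset ` B \<union> (\<lambda>\<Psi>. ?coset (inv\<^bsub>?A\<^esub> \<Psi>)) ` B"
  proof
    fix \<phi> assume "\<phi> \<in> {\<phi> \<in> carrier (OutGroup ?G). K \<inter> out_act_proj N \<phi> ` K \<noteq> {}}"
    then obtain c where \<phi>: "\<phi> \<in> carrier (OutGroup ?G)" and c: "c \<in> K" "out_act_proj N \<phi> c \<in> K" by blast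
    obtain \<mu> where \<mu>: "\<mu> \<in> positive_currents N n" "c = proj_class \<mu>" using n[OF c(1)] by blast
    obtain \<nu> where \<nu>: "\<nu> \<in> positive_currents N n" "out_act_proj N \<phi> c = proj_class \<nu>" using n[OF c(2)] by blast
    have \<mu>C: "\<mu> \<in> Curr N" and \<nu>C: "\<nu> \<in> Curr N" using \<mu>(1) \<nu>(1) by (auto simp: positive_currents_def)
    define \<Phi> where "\<Phi> = (SOME \<Phi>. \<Phi> \<in> \<phi>)"
    have \<Phi>: "\<Phi> \<in> auto ?G" "\<phi> = ?coset \<Phi>" using out_class[OF \<phi>] unfolding \<Phi>_def by blast+
    interpret \<Phi>: free_auto N \<Phi> using \<Phi>(1) by (rule free_autoI)
    interpret \<Phi>b: boundary_iso N \<Phi> "inv_into (FG N) \<Phi>" by (rule \<Phi>.boundary_iso_auto)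
    have "out_act N \<phi> \<mu> \<in> proj_class \<nu>"
      using \<nu>(2) \<mu>(2) proj_class_self[of \<mu>] unfolding out_act_proj_def by blast
    then obtain r :: real where r: "r > 0" "push N (boundary2_map \<Phi>) \<mu> = scale_measure (ennreal r) \<nu>"
      by (auto simp: proj_class_def out_act_def \<Phi>_def)
    have push: "emeasure \<mu> (boundary2_map \<Phi> -` S \<inter> boundary2 N) = ennreal r * emeasure \<nu> S"
      if "S \<in> sets (borel_of (boundary2_top N))" for S
      using \<Phi>b.emeasure_push(1)[OF CurrD(2)[OF \<mu>C] that] r(2) by simp
    show "\<phi> \<in> ?coset ` B \<union> (\<lambda>\<Psi>. ?coset (inv\<^bsub>?A\<^esub> \<Psi>)) ` B"
    proof (cases "ennreal r * emeasure \<nu> (through_id N) \<le> emeasure \<mu> (through_id N)")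
      case True
      then obtain d where d: "d \<in> FG N" "compose (FG N) \<Phi> (conjugation N d) \<in> B"
        using twist_B[OF \<Phi>(1) \<mu>(1)] push[of "through_id N"] by auto
      have "?coset (compose (FG N) \<Phi> (conjugation N d)) = \<phi>"
        using coset_compose_inner[OF \<Phi>(1) \<Phi>.\<Phi>_FG[OF d(1)]] \<Phi>(2) compose_inner[OF \<Phi>(1) d(1)] by simp
      then show ?thesis using d(2) by blast
    next
      case False
      \<comment> \<open>In this case the inverse automorphism does not increase the length of \<open>\<nu>\<close>.\<close>
      define \<Psi> where "\<Psi> = inv\<^bsub>?A\<^esub> \<Phi>"
      have \<Psi>: "\<Psi> \<in> auto ?G" using A.inv_closed[of \<Phi>] \<Phi>(1) by (simp add: \<Psi>_def AutoGroup_simps)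
      interpret \<Psi>: free_auto N \<Psi> using \<Psi> by (rule free_autoI)
      interpret \<Psi>b: boundary_iso N \<Psi> "inv_into (FG N) \<Psi>" by (rule \<Psi>.boundary_iso_auto)
      have "compose (FG N) \<Psi> \<Phi> = (\<lambda>x\<in>FG N. x)"
        using A.l_inv[of \<Phi>] \<Phi>(1) \<Psi> by (simp add: \<Psi>_def[symmetric] AutoGroup_simps)
          (simp add: AutoGroup_def BijGroup_def)
      then have \<Psi>\<Phi>: "\<Psi> (\<Phi> x) = x" if "x \<in> FG N" for x
        using that by (metis compose_eq restrict_apply')
      have bm: "boundary_map \<Psi> (boundary_map \<Phi> p) = p" if p: "p \<in> boundary N" for p
      proof -
        have "\<Psi> \<circ> (\<Phi> \<circ> x) = x" if "x \<in> p" for x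
          using boundary_seq_FG[OF p that] \<Psi>\<Phi> by auto
        then show ?thesis by (force simp: boundary_map_def image_image)
      qed
      let ?S = "boundary2_map \<Psi> -` through_id N \<inter> boundary2 N"
      have S: "?S \<in> sets (borel_of (boundary2_top N))"
        by (rule \<Psi>b.emeasure_push(2)[OF CurrD(2)[OF \<nu>C]]) simp
      have "boundary2_map \<Phi> -` ?S \<inter> boundary2 N = through_id N"
      proof (intro Set.set_eqI)
        fix z
        have "through_id N \<subseteq> boundary2 N" using openin_subset[OF through_id_top(1)] by simp
        moreover have "boundary2_map \<Psi> (boundary2_map \<Phi> z) = z" if "z \<in> boundary2 N"
          using that bm by (auto simp: boundary2_map_def boundary2_def)
        ultimately show "z \<in> boundary2_map \<Phi> -` ?S \<inter> boundary2 N \<longleftrightarrow> z \<in> through_id N"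
          using \<Phi>b.boundary2_map_in[of z] by auto
      qed
      then have "ennreal r * emeasure \<nu> ?S = emeasure \<mu> (through_id N)" using push[OF S] by simp
      also have "\<dots> \<le> ennreal r * emeasure \<nu> (through_id N)" using False by simp
      finally have "emeasure \<nu> ?S \<le> emeasure \<nu> (through_id N)"
        using r(1) by (subst (asm) ennreal_mult_le_mult_iff) auto
      then obtain d where d: "d \<in> FG N" "compose (FG N) \<Psi> (conjugation N d) \<in> B"
        using twist_B[OF \<Psi> \<nu>(1)] by blast
      have cA: "\<Psi> \<in> carrier ?A" "conjugation N d \<in> carrier ?A" "\<Phi> \<in> carrier ?A"
        using \<Psi> \<Phi>(1) inner_auto_mem[OF d(1)] by (simp_all add: AutoGroup_simps)
      have "compose (FG N) \<Psi> (conjugation N d) = \<Psi> \<otimes>\<^bsub>?A\<^esub> conjugation N d"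
        by (rule AutoGroup_simps(2)[OF \<Psi> inner_auto_mem[OF d(1)], symmetric])
      moreover have "inv\<^bsub>?A\<^esub> \<Psi> = \<Phi>" unfolding \<Psi>_def by (rule A.inv_inv[OF cA(3)])
      ultimately have "inv\<^bsub>?A\<^esub> (compose (FG N) \<Psi> (conjugation N d)) = inv\<^bsub>?A\<^esub> (conjugation N d) \<otimes>\<^bsub>?A\<^esub> \<Phi>"
        using A.inv_mult_group[OF cA(1,2)] by simp
      moreover have "inv\<^bsub>?A\<^esub> (conjugation N d) \<in> inner_auto ?G"
        using subgroup.m_inv_closed[OF subgroup_inner_auto] d(1) by (auto simp: inner_auto_eq)
      then obtain e where e: "e \<in> FG N" "inv\<^bsub>?A\<^esub> (conjugation N d) = conjugation N e" by (auto simp: inner_auto_eq)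
      ultimately have "inv\<^bsub>?A\<^esub> (compose (FG N) \<Psi> (conjugation N d)) = compose (FG N) (conjugation N e) \<Phi>"
        using AutoGroup_simps(2)[OF inner_auto_mem[OF e(1)] \<Phi>(1)] by simp
      then have "?coset (inv\<^bsub>?A\<^esub> (compose (FG N) \<Psi> (conjugation N d))) = \<phi>"
        using coset_compose_inner[OF \<Phi>(1) e(1)] \<Phi>(2) by simp
      then show ?thesis using d(2) by blast
    qed
  qed
  then show "finite {\<phi> \<in> carrier (OutGroup ?G). K \<inter> out_act_proj N \<phi> ` K \<noteq> {}}"
    by (rule finite_subset) (use finB in simp)
qed

end
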